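(* A compact integrable $G_2$ manifold $(M,\varphi)$ with closed torsion, $dT=0$, and zero Riemannian scalar curvature is parallel, $\nabla^g\varphi=0$.
   Context: A $G_2$ structure on a smooth 7-manifold $M$ is a 3-form $\varphi$ which near each point has, in a suitable local coframe $e_1,\dots,e_7$, the form $\varphi=e_{127}+e_{135}-e_{146}-e_{236}-e_{245}+e_{347}+e_{567}$, where $e_{ijk}=e_i\wedge e_j\wedge e_k$. It determines a Riemannian metric $g$ and an orientation for which such coframes are oriented orthonormal; $*$ is the Hodge star and $\nabla^g$ the Levi-Civita connection. "Riemannian scalar curvature" is the scalar curvature $Scal^g$ of $g$. $(d\varphi,*\varphi)$ is the pointwise scalar product of 4-forms, so $d\varphi\wedge\varphi=(d\varphi,*\varphi)\,vol$. The Lee form is $\theta=-\frac13*( *d\varphi\wedge\varphi)$. The $G_2$ structure is integrable if $d{*}\varphi=\theta\wedge{*}\varphi$. On an integrable $G_2$ manifold there is a unique metric connection $\nabla$ with $\nabla\varphi=0$ whose torsion $T(X,Y,Z)=g(\nabla_XY-\nabla_YX-[X,Y],Z)$ is a 3-form (the characteristic connection; "the torsion" always means this $T$); $T=-*d\varphi+*(\theta\wedge\varphi)+\frac16(d\varphi,*\varphi)\varphi$. *)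

theory Defs
  imports "HOL-Analysis.Analysis" "HOL-Combinatorics.Permutations"
begin

section \<open>Smooth maps and manifolds\<close>

abbreviation dir_deriv ::
  "('v::real_normed_vector \<Rightarrow> 'w::real_normed_vector) \<Rightarrow> 'v \<Rightarrow> 'v \<Rightarrow> 'w"
  where "dir_deriv f x v \<equiv> frechet_derivative f (at x) v"

primrec Ck_on :: "nat \<Rightarrow> 'v::real_normed_vector set \<Rightarrow> ('v \<Rightarrow> 'w::real_normed_vector) \<Rightarrow> bool" where
  "Ck_on 0 S f \<longleftrightarrow> continuous_on S f"
| "Ck_on (Suc k) S f \<longleftrightarrow>
     (\<forall>x\<in>S. f differentiable (at x)) \<and> (\<forall>v. Ck_on k S (\<lambda>x. dir_deriv f x v))"

text \<open>Only used for open \<open>S\<close>.\<close>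

definition smooth_on :: "'v::real_normed_vector set \<Rightarrow> ('v \<Rightarrow> 'w::real_normed_vector) \<Rightarrow> bool"
  where "smooth_on S f \<longleftrightarrow> (\<forall>k. Ck_on k S f)"

text \<open>A chart is a pair of its domain and its coordinate map; values of the coordinate map
  outside the domain carry no meaning.\<close>

type_synonym ('a, 'n) chart = "'a set \<times> ('a \<Rightarrow> real^'n)"

definition target :: "('a, 'n::finite) chart \<Rightarrow> (real^'n) set"
  where "target c = snd c ` fst c"

definition transition :: "('a, 'n::finite) chart \<Rightarrow> ('a, 'n) chart \<Rightarrow> real^'n \<Rightarrow> real^'n"
  where "transition c d = snd d \<circ> inv_into (fst c) (snd c)"

definition smooth_manifold :: "'a topology \<Rightarrow> ('a, 'n::finite) chart set \<Rightarrow> bool" where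
  "smooth_manifold M A \<longleftrightarrow>
     Hausdorff_space M \<and> second_countable M \<and>
     (\<forall>c\<in>A. openin M (fst c) \<and> open (target c) \<and>
        homeomorphic_map (subtopology M (fst c)) (top_of_set (target c)) (snd c)) \<and>
     (\<Union>c\<in>A. fst c) = topspace M \<and>
     (\<forall>c\<in>A. \<forall>d\<in>A. smooth_on (snd c ` (fst c \<inter> fst d)) (transition c d))"

section \<open>Tensors in coordinates\<close>

text \<open>A covariant tensor of rank \<open>k\<close> at a point is a function of lists of \<open>k\<close> vectors; its
  values on lists of other lengths carry no meaning. A field on a coordinate domain
  is a function \<open>real^'n \<Rightarrow> (real^'n) list \<Rightarrow> real\<close>, and a global field is a family of such functions
  indexed by the charts.\<close>

type_synonym 'n tensor = "(real^'n) list \<Rightarrow> real"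

definition alternating_form :: "nat \<Rightarrow> 'n::finite tensor \<Rightarrow> bool" where
  "alternating_form k \<alpha> \<longleftrightarrow>
     (\<forall>vs i. length vs = k \<and> i < k \<longrightarrow> linear (\<lambda>v. \<alpha> (vs[i := v]))) \<and>
     (\<forall>vs i j. length vs = k \<and> i < j \<and> j < k \<and> vs ! i = vs ! j \<longrightarrow> \<alpha> vs = 0)"

definition tensor_field ::
  "('a, 'n::finite) chart set \<Rightarrow> nat \<Rightarrow> (('a, 'n) chart \<Rightarrow> real^'n \<Rightarrow> 'n tensor) \<Rightarrow> bool" where
  "tensor_field A k \<alpha> \<longleftrightarrow>
     (\<forall>c\<in>A. \<forall>d\<in>A. \<forall>x\<in>snd c ` (fst c \<inter> fst d). \<forall>vs. length vs = k \<longrightarrow>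
        \<alpha> c x vs = \<alpha> d (transition c d x) (map (dir_deriv (transition c d) x) vs))"

text \<open>Normalised so that \<open>(e\<^sub>1 \<and> \<dots> \<and> e\<^sub>k)(v\<^sub>1, \<dots>, v\<^sub>k) = det (e\<^sub>i v\<^sub>j)\<close>;
  \<open>k\<close> and \<open>l\<close> are the degrees of the two factors.\<close>

definition wedge :: "nat \<Rightarrow> nat \<Rightarrow> 'n::finite tensor \<Rightarrow> 'n tensor \<Rightarrow> 'n tensor" where
  "wedge k l \<alpha> \<beta> vs =
     (\<Sum>\<sigma> | \<sigma> permutes {..<k + l}.
        of_int (sign \<sigma>) * \<alpha> (map (\<lambda>i. vs ! \<sigma> i) [0..<k]) * \<beta> (map (\<lambda>i. vs ! \<sigma> i) [k..<k + l]))
     / (fact k * fact l)"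

text \<open>\<open>(d\<alpha>)(v\<^sub>0, \<dots>, v\<^sub>k) = \<Sum>\<^sub>i (-1)\<^sup>i v\<^sub>i (\<alpha>(v\<^sub>0, \<dots>, v\<^sub>k without v\<^sub>i))\<close> for vectors extended as
  constant (hence commuting) vector fields of the coordinate domain.\<close>

definition ext_deriv :: "(real^'n::finite \<Rightarrow> 'n tensor) \<Rightarrow> real^'n \<Rightarrow> 'n tensor" where
  "ext_deriv \<alpha> x vs =
     (\<Sum>i<length vs. (-1) ^ i * dir_deriv (\<lambda>y. \<alpha> y (take i vs @ drop (Suc i) vs)) x (vs ! i))"

text \<open>\<open>(*\<alpha>)\<^bsub>w\<^esub> = (1/k!) g\<^bsup>i\<^sub>1j\<^sub>1\<^esup> \<dots> g\<^bsup>i\<^sub>kj\<^sub>k\<^esup> \<alpha>\<^bsub>i\<^sub>1\<dots>i\<^sub>k\<^esub> vol\<^bsub>j\<^sub>1\<dots>j\<^sub>kw\<^esub>\<close>, the convention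
  \<open>\<alpha> \<and> *\<beta> = (\<alpha>, \<beta>) vol\<close>. Here \<open>G\<close> is the matrix of the metric at the point and \<open>k\<close> the degree.\<close>

definition hodge :: "real^'n::finite^'n \<Rightarrow> 'n tensor \<Rightarrow> nat \<Rightarrow> 'n tensor \<Rightarrow> 'n tensor" where
  "hodge G vol k \<alpha> ws =
     (\<Sum>I | length I = k. \<Sum>J | length J = k.
        (\<Prod>m<k. matrix_inv G $ (I ! m) $ (J ! m)) *
        \<alpha> (map (\<lambda>i. axis i 1) I) * vol (map (\<lambda>j. axis j 1) J @ ws)) / fact k"

section \<open>Connections and curvature in coordinates\<close>

text \<open>A connection on a coordinate domain is given by its Christoffel symbols
  \<open>\<Gamma> x u v = \<Gamma>\<^sup>k\<^sub>i\<^sub>j u\<^sup>i v\<^sup>j \<partial>\<^sub>k\<close>.\<close>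

type_synonym 'n christoffel = "real^'n \<Rightarrow> real^'n \<Rightarrow> real^'n \<Rightarrow> real^'n"

definition nabla ::
  "'n::finite christoffel \<Rightarrow> (real^'n \<Rightarrow> real^'n) \<Rightarrow> (real^'n \<Rightarrow> real^'n) \<Rightarrow> real^'n \<Rightarrow> real^'n"
  where "nabla \<Gamma> X Y x = dir_deriv Y x (X x) + \<Gamma> x (X x) (Y x)"

definition lie_bracket ::
  "(real^'n::finite \<Rightarrow> real^'n) \<Rightarrow> (real^'n \<Rightarrow> real^'n) \<Rightarrow> real^'n \<Rightarrow> real^'n"
  where "lie_bracket X Y x = dir_deriv Y x (X x) - dir_deriv X x (Y x)"

text \<open>The covariant derivative \<open>(\<nabla>\<^sub>u \<alpha>)(v\<^sub>1, \<dots>, v\<^sub>k)\<close>.\<close>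

definition nabla_tensor ::
  "'n::finite christoffel \<Rightarrow> (real^'n \<Rightarrow> 'n tensor) \<Rightarrow> real^'n \<Rightarrow> real^'n \<Rightarrow> 'n tensor" where
  "nabla_tensor \<Gamma> \<alpha> x u vs =
     dir_deriv (\<lambda>y. \<alpha> y vs) x u - (\<Sum>i<length vs. \<alpha> x (vs[i := \<Gamma> x u (vs ! i)]))"

definition connection ::
  "('a, 'n::finite) chart set \<Rightarrow> (('a, 'n) chart \<Rightarrow> 'n christoffel) \<Rightarrow> bool" where
  "connection A \<Gamma> \<longleftrightarrow>
     (\<forall>c\<in>A. (\<forall>x\<in>target c. bilinear (\<Gamma> c x)) \<and> (\<forall>u v. smooth_on (target c) (\<lambda>x. \<Gamma> c x u v))) \<and>
     (\<forall>c\<in>A. \<forall>d\<in>A. \<forall>x\<in>snd c ` (fst c \<inter> fst d). \<forall>u v.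
        (let \<tau> = transition c d in
           dir_deriv \<tau> x (\<Gamma> c x u v) =
           dir_deriv (\<lambda>y. dir_deriv \<tau> y v) x u +
           \<Gamma> d (\<tau> x) (dir_deriv \<tau> x u) (dir_deriv \<tau> x v)))"

definition metric_tensor :: "(real^'n::finite \<Rightarrow> real^'n^'n) \<Rightarrow> real^'n \<Rightarrow> 'n tensor"
  where "metric_tensor G x vs = (vs ! 0) \<bullet> (G x *v (vs ! 1))"

text \<open>Torsion and curvature are tensorial, so they may be evaluated on vectors extended as
  constant vector fields of the coordinate domain.\<close>

definition torsion ::
  "(real^'n::finite \<Rightarrow> real^'n^'n) \<Rightarrow> 'n christoffel \<Rightarrow> real^'n \<Rightarrow> 'n tensor" where
  "torsion G \<Gamma> x vs =
     (let X = (\<lambda>_. vs ! 0); Y = (\<lambda>_. vs ! 1) in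
        metric_tensor G x [nabla \<Gamma> X Y x - nabla \<Gamma> Y X x - lie_bracket X Y x, vs ! 2])"

text \<open>\<open>\<Gamma>\<^sup>k\<^sub>i\<^sub>j = (1/2) g\<^sup>k\<^sup>l (\<partial>\<^sub>i g\<^sub>j\<^sub>l + \<partial>\<^sub>j g\<^sub>i\<^sub>l - \<partial>\<^sub>l g\<^sub>i\<^sub>j)\<close>\<close>

definition levi_civita :: "(real^'n::finite \<Rightarrow> real^'n^'n) \<Rightarrow> 'n christoffel" where
  "levi_civita G x u v =
     (1/2) *\<^sub>R (matrix_inv (G x) *v
       (\<chi> l. dir_deriv (\<lambda>y. metric_tensor G y [v, axis l 1]) x u
           + dir_deriv (\<lambda>y. metric_tensor G y [u, axis l 1]) x v
           - dir_deriv (\<lambda>y. metric_tensor G y [u, v]) x (axis l 1)))"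

definition curvature ::
  "'n::finite christoffel \<Rightarrow> real^'n \<Rightarrow> real^'n \<Rightarrow> real^'n \<Rightarrow> real^'n \<Rightarrow> real^'n" where
  "curvature \<Gamma> x u v w =
     (let X = (\<lambda>_. u); Y = (\<lambda>_. v); Z = (\<lambda>_. w) in
        nabla \<Gamma> X (nabla \<Gamma> Y Z) x - nabla \<Gamma> Y (nabla \<Gamma> X Z) x - nabla \<Gamma> (lie_bracket X Y) Z x)"

definition ricci :: "'n::finite christoffel \<Rightarrow> real^'n \<Rightarrow> real^'n \<Rightarrow> real^'n \<Rightarrow> real"
  where "ricci \<Gamma> x v w = (\<Sum>i\<in>UNIV. curvature \<Gamma> x (axis i 1) v w $ i)"

definition riemannian_scalar :: "(real^'n::finite \<Rightarrow> real^'n^'n) \<Rightarrow> real^'n \<Rightarrow> real" where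
  "riemannian_scalar G x =
     (\<Sum>j\<in>UNIV. \<Sum>k\<in>UNIV. matrix_inv (G x) $ j $ k * ricci (levi_civita G) x (axis j 1) (axis k 1))"

section \<open>$G_2$ structures\<close>

text \<open>A coframe at a point is a matrix \<open>e\<close> whose rows are the covectors \<open>e\<^sub>i\<close>. The index type
  \<open>7\<close> consists of the numerals \<open>1, \<dots>, 7\<close>, where \<open>7 = 0\<close>.\<close>

primrec coframe_wedge :: "real^7^7 \<Rightarrow> 7 list \<Rightarrow> 7 tensor" where
  "coframe_wedge e [] = (\<lambda>vs. 1)"
| "coframe_wedge e (i # I) =
     wedge 1 (length I) (\<lambda>vs. (e *v (vs ! 0)) $ i) (coframe_wedge e I)"

definition adapted_coframe :: "7 tensor \<Rightarrow> real^7^7 \<Rightarrow> bool" where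
  "adapted_coframe p e \<longleftrightarrow> invertible e \<and>
     (\<forall>vs. length vs = 3 \<longrightarrow>
        p vs = coframe_wedge e [1,2,7] vs + coframe_wedge e [1,3,5] vs - coframe_wedge e [1,4,6] vs
             - coframe_wedge e [2,3,6] vs - coframe_wedge e [2,4,5] vs + coframe_wedge e [3,4,7] vs
             + coframe_wedge e [5,6,7] vs)"

definition G2_structure ::
  "('a, 7) chart set \<Rightarrow> (('a, 7) chart \<Rightarrow> real^7 \<Rightarrow> 7 tensor) \<Rightarrow> bool" where
  "G2_structure A \<phi> \<longleftrightarrow>
     tensor_field A 3 \<phi> \<and>
     (\<forall>c\<in>A. \<forall>x\<in>target c. \<exists>U e. open U \<and> x \<in> U \<and> U \<subseteq> target c \<and> smooth_on U e \<and>
        (\<forall>y\<in>U. adapted_coframe (\<phi> c y) (e y)))"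

text \<open>Two adapted coframes at a point differ by an element of $G_2 \subset SO(7)$, so the metric
  and the volume form below do not depend on the choice made here.\<close>

definition some_coframe :: "7 tensor \<Rightarrow> real^7^7"
  where "some_coframe p = (SOME e. adapted_coframe p e)"

definition G2_metric :: "(real^7 \<Rightarrow> 7 tensor) \<Rightarrow> real^7 \<Rightarrow> real^7^7"
  where "G2_metric \<phi> x = transpose (some_coframe (\<phi> x)) ** some_coframe (\<phi> x)"

definition G2_volume :: "(real^7 \<Rightarrow> 7 tensor) \<Rightarrow> real^7 \<Rightarrow> 7 tensor"
  where "G2_volume \<phi> x = coframe_wedge (some_coframe (\<phi> x)) [1,2,3,4,5,6,7]"

definition G2_star :: "(real^7 \<Rightarrow> 7 tensor) \<Rightarrow> nat \<Rightarrow> (real^7 \<Rightarrow> 7 tensor) \<Rightarrow> real^7 \<Rightarrow> 7 tensor"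
  where "G2_star \<phi> k \<alpha> x = hodge (G2_metric \<phi> x) (G2_volume \<phi> x) k (\<alpha> x)"

definition lee_form :: "(real^7 \<Rightarrow> 7 tensor) \<Rightarrow> real^7 \<Rightarrow> 7 tensor" where
  "lee_form \<phi> x vs =
     - (1/3) * G2_star \<phi> 6 (\<lambda>y. wedge 3 3 (G2_star \<phi> 4 (ext_deriv \<phi>) y) (\<phi> y)) x vs"

definition integrable_G2 ::
  "('a, 7) chart set \<Rightarrow> (('a, 7) chart \<Rightarrow> real^7 \<Rightarrow> 7 tensor) \<Rightarrow> bool" where
  "integrable_G2 A \<phi> \<longleftrightarrow> G2_structure A \<phi> \<and>
     (\<forall>c\<in>A. \<forall>x\<in>target c. \<forall>vs. length vs = 5 \<longrightarrow>
        ext_deriv (G2_star (\<phi> c) 3 (\<phi> c)) x vs =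
        wedge 1 4 (lee_form (\<phi> c) x) (G2_star (\<phi> c) 3 (\<phi> c) x) vs)"

definition characteristic_connection ::
  "('a, 7) chart set \<Rightarrow> (('a, 7) chart \<Rightarrow> real^7 \<Rightarrow> 7 tensor) \<Rightarrow>
   (('a, 7) chart \<Rightarrow> 7 christoffel) \<Rightarrow> bool" where
  "characteristic_connection A \<phi> \<Gamma> \<longleftrightarrow>
     connection A \<Gamma> \<and>
     (\<forall>c\<in>A. \<forall>x\<in>target c.
        (\<forall>u vs. length vs = 2 \<longrightarrow>
           nabla_tensor (\<Gamma> c) (metric_tensor (G2_metric (\<phi> c))) x u vs = 0) \<and>
        (\<forall>u vs. length vs = 3 \<longrightarrow> nabla_tensor (\<Gamma> c) (\<phi> c) x u vs = 0) \<and>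
        alternating_form 3 (torsion (G2_metric (\<phi> c)) (\<Gamma> c) x))"

definition closed_torsion ::
  "('a, 7) chart set \<Rightarrow> (('a, 7) chart \<Rightarrow> real^7 \<Rightarrow> 7 tensor) \<Rightarrow>
   (('a, 7) chart \<Rightarrow> 7 christoffel) \<Rightarrow> bool" where
  "closed_torsion A \<phi> \<Gamma> \<longleftrightarrow>
     (\<forall>c\<in>A. \<forall>x\<in>target c. \<forall>vs. length vs = 4 \<longrightarrow>
        ext_deriv (torsion (G2_metric (\<phi> c)) (\<Gamma> c)) x vs = 0)"

definition parallel_G2 ::
  "('a, 7) chart set \<Rightarrow> (('a, 7) chart \<Rightarrow> real^7 \<Rightarrow> 7 tensor) \<Rightarrow> bool" where
  "parallel_G2 A \<phi> \<longleftrightarrow>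
     (\<forall>c\<in>A. \<forall>x\<in>target c. \<forall>u vs. length vs = 3 \<longrightarrow>
        nabla_tensor (levi_civita (G2_metric (\<phi> c))) (\<phi> c) x u vs = 0)"

end

theory Submission
  imports Defs
begin

text \<open>
  Let \<open>R\<close> be the curvature of the characteristic connection and let $\ast\varphi$ be the dual 4-form.
  Since \<open>R\<close> takes values in $\mathfrak{g}_2$, contracting it with $\ast\varphi$ gives a multiple of its
  scalar curvature $Scal^g - \frac14 |T|^2$; by the Bianchi identity and $dT = 0$ the same contraction
  is a multiple of that of $\sum_m T_{abm} T_{pqm}$ with $\ast\varphi$. So if $Scal^g = 0$, the latter is
  a positive multiple of $|T|^2$. On the other hand $dT = 0$ and $\nabla\varphi = 0$ show that it is a multiple of
  $d(T \wedge \varphi)$. By the divergence theorem on the compact manifold \<open>T = 0\<close>, so the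
  characteristic connection is the Levi-Civita connection.
\<close>

section \<open>Alternating sums over permutations\<close>

definition altsum :: "(('n::finite \<Rightarrow> 'n) \<Rightarrow> real) \<Rightarrow> real" where
  "altsum F = (\<Sum>p | p permutes UNIV. of_int (sign p) * F p)"

lemma altsum_add: "altsum (\<lambda>p. F p + G p) = altsum F + altsum G"
  by (simp add: altsum_def distrib_left sum.distrib)

lemma altsum_minus: "altsum (\<lambda>p. - F p) = - altsum F"
  by (simp add: altsum_def sum_negf)

lemma altsum_cmult: "altsum (\<lambda>p. c * F p) = c * altsum F"
  by (simp add: altsum_def sum_distrib_left ac_simps)

lemma altsum_sum: "altsum (\<lambda>p. \<Sum>i\<in>I. F i p) = (\<Sum>i\<in>I. altsum (F i))"
  by (simp add: altsum_def sum_distrib_left) (rule sum.swap)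

lemma altsum_transpose:
  assumes "i \<noteq> j"
  shows "altsum (\<lambda>p. F (p \<circ> Transposition.transpose i j)) = - altsum F"
proof -
  have s: "Transposition.transpose i j permutes UNIV"
    by (simp add: permutes_swap_id)
  have "altsum F = (\<Sum>p | p permutes UNIV. of_int (sign (p \<circ> Transposition.transpose i j)) * F (p \<circ> Transposition.transpose i j))"
    unfolding altsum_def
    by
       (rule sum_permutations_compose_right [OF s])
  also have "\<dots> = (\<Sum>p | p permutes UNIV. - (of_int (sign p) * F (p \<circ> Transposition.transpose i j)))"
  proof (rule sum.cong [OF refl])
    fix p :: "'a \<Rightarrow> 'a" assume "p \<in> {p. p permutes UNIV}"
    then have "permutation p" "permutation (Transposition.transpose i j)"
      using s finite permutation_permutes by blast+
    then have "sign (p \<circ> Transposition.transpose i j) = - sign p"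
      using assms by (simp add: sign_compose sign_swap_id)
    then show "of_int (sign (p \<circ> Transposition.transpose i j)) * F (p \<circ> Transposition.transpose i j) =
          - (of_int (sign p) * F (p \<circ> Transposition.transpose i j))" by simp
  qed
  finally show ?thesis by (simp add: altsum_def sum_negf)
qed

definition multilinear :: "(('n::finite \<Rightarrow> real^'n) \<Rightarrow> real) \<Rightarrow> bool" where
  "multilinear M \<longleftrightarrow> (\<forall>i f. linear (\<lambda>v. M (f(i := v))))"

lemma multilinear_expand_on:
  fixes M :: "('n::finite \<Rightarrow> real^'n) \<Rightarrow> real"
  assumes M: "multilinear M"
  shows "M f = (\<Sum>q\<in>Pi\<^sub>E S (\<lambda>_. UNIV). (\<Prod>i\<in>S. f i $ q i) * M (\<lambda>i. if i \<in> S then axis (q i) 1 else f i))"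
  using finite [of S]
proof (induction S arbitrary: f rule: finite_induct)
  case empty
  then show ?case by simp
next
  case (insert a S)
  have lin: "linear (\<lambda>v. M (g(a := v)))" for g
    using M by (simp add: multilinear_def)
  have *: "M f = (\<Sum>b\<in>UNIV. f a $ b * M (f(a := axis b 1)))" for f
  proof -
    have "M f = M (f(a := (\<Sum>b\<in>UNIV. f a $ b *\<^sub>R axis b 1)))"
      using basis_expansion [of "f a"] by (simp add: scalar_mult_eq_scaleR)
    then show ?thesis
      using linear_sum [OF lin [of f], of "\<lambda>b. f a $ b *\<^sub>R axis b 1" UNIV]
      by (simp add: linear_cmul [OF lin])
  qed
  have "M f = (\<Sum>b\<in>UNIV. f a $ b * M (f(a := axis b 1)))" by (rule *)
  also have "\<dots> = (\<Sum>b\<in>UNIV. f a $ b * (\<Sum>q\<in>Pi\<^sub>E S (\<lambda>_. UNIV). (\<Prod>i\<in>S. f i $ q i) *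
        M (\<lambda>i. if i \<in> insert a S then axis ((q(a := b)) i) 1 else f i)))"
  proof (rule sum.cong [OF refl])
    fix b :: 'n
    have "M (f(a := axis b 1)) = (\<Sum>q\<in>Pi\<^sub>E S (\<lambda>_. UNIV). (\<Prod>i\<in>S. (f(a := axis b 1)) i $ q i) *
        M (\<lambda>i. if i \<in> S then axis (q i) 1 else (f(a := axis b 1)) i))"
      by (rule insert.IH)
    also have "\<dots> = (\<Sum>q\<in>Pi\<^sub>E S (\<lambda>_. UNIV). (\<Prod>i\<in>S. f i $ q i) *
        M (\<lambda>i. if i \<in> insert a S then axis ((q(a := b)) i) 1 else f i))"
      using insert.hyps
      by (intro sum.cong refl arg_cong2 [where f = "(*)"] prod.cong arg_cong [where f = M]) (auto simp: fun_eq_iff)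
    finally show "f a $ b * M (f(a := axis b 1)) = f a $ b * \<dots>" by simp
  qed
  also have "\<dots> = (\<Sum>(b, q)\<in>UNIV \<times> Pi\<^sub>E S (\<lambda>_. UNIV). (\<Prod>i\<in>insert a S. f i $ (q(a := b)) i) *
        M (\<lambda>i. if i \<in> insert a S then axis ((q(a := b)) i) 1 else f i))"
    unfolding sum.cartesian_product [symmetric] sum_distrib_left
    using insert.hyps by (intro sum.cong refl) (auto simp: ac_simps intro!: prod.cong)
  also have "\<dots> = (\<Sum>q\<in>Pi\<^sub>E (insert a S) (\<lambda>_. UNIV). (\<Prod>i\<in>insert a S. f i $ q i) *
        M (\<lambda>i. if i \<in> insert a S then axis (q i) 1 else f i))"
    unfolding PiE_insert_eq
    by (subst sum.reindex [OF inj_combinator [OF insert.hyps(2)]]) (simp add: case_prod_unfold)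
  finally show ?case .
qed

lemma multilinear_expand:
  fixes M :: "('n::finite \<Rightarrow> real^'n) \<Rightarrow> real"
  assumes "multilinear M"
  shows "M f = (\<Sum>q\<in>UNIV. (\<Prod>i\<in>UNIV. f i $ q i) * M (\<lambda>i. axis (q i) 1))"
  using multilinear_expand_on [OF assms, of f UNIV] by (simp add: PiE_UNIV_domain)

lemma altsum_linear_image:
  fixes M :: "('n::finite \<Rightarrow> real^'n) \<Rightarrow> real" and L :: "real^'n^'n"
  assumes M: "multilinear M"
  shows "altsum (\<lambda>p. M (\<lambda>i. L *v axis (p i) 1)) = det L * altsum (\<lambda>p. M (\<lambda>i. axis (p i) 1))"
proof -
  let ?P = "{p::'n \<Rightarrow> 'n. p permutes UNIV}"
  have L: "(L *v axis b 1) $ a = L $ a $ b" for a b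
    by (simp add: matrix_vector_mul_component inner_axis)
  have d: "(\<Sum>p\<in>?P. of_int (sign p) * (\<Prod>i\<in>UNIV. L $ q i $ p i)) = det (\<chi> i. L $ q i)" for q
    by (simp add: det_def)
  have z: "det (\<chi> i. L $ q i) = 0" if "q \<notin> ?P" for q
  proof -
    have "\<not> inj q"
      using that finite_UNIV_inj_surj [of q] by (auto simp: bij_def intro: bij_imp_permutes)
    then obtain i j where "i \<noteq> j" "q i = q j" by (auto simp: inj_def)
    then show ?thesis by (intro det_identical_rows [of i j]) (auto simp: row_def)
  qed
  have "altsum (\<lambda>p. M (\<lambda>i. L *v axis (p i) 1)) =
      (\<Sum>p\<in>?P. of_int (sign p) * (\<Sum>q\<in>UNIV. (\<Prod>i\<in>UNIV. L $ q i $ p i) * M (\<lambda>i. axis (q i) 1)))"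
    unfolding altsum_def by (subst multilinear_expand [OF M]) (simp add: L)
  also have "\<dots> = (\<Sum>q\<in>UNIV. (\<Sum>p\<in>?P. of_int (sign p) * (\<Prod>i\<in>UNIV. L $ q i $ p i)) * M (\<lambda>i. axis (q i) 1))"
    unfolding sum_distrib_left sum_distrib_right by (subst sum.swap) (simp add: ac_simps)
  also have "\<dots> = (\<Sum>q\<in>UNIV. det (\<chi> i. L $ q i) * M (\<lambda>i. axis (q i) 1))"
    by (simp add: d)
  also have "\<dots> = (\<Sum>q\<in>?P. det (\<chi> i. L $ q i) * M (\<lambda>i. axis (q i) 1))"
    using z by (intro sum.mono_neutral_right) auto
  also have "\<dots> = (\<Sum>q\<in>?P. of_int (sign q) * det L * M (\<lambda>i. axis (q i) 1))"
    by (intro sum.cong refl) (simp add: det_permute_rows)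
  finally show ?thesis by (simp add: altsum_def sum_distrib_left ac_simps)
qed

lemma altsum_slots:
  fixes M :: "('n::finite \<Rightarrow> real^'n) \<Rightarrow> real" and N :: "real^'n \<Rightarrow> real^'n"
  assumes M: "multilinear M" and N: "linear N"
  shows "(\<Sum>i\<in>UNIV. altsum (\<lambda>p. M ((\<lambda>j. axis (p j) 1)(i := N (axis (p i) 1))))) =
    (\<Sum>a\<in>UNIV. N (axis a 1) $ a) * altsum (\<lambda>p. M (\<lambda>i. axis (p i) 1))"
proof -
  let ?P = "{p::'n \<Rightarrow> 'n. p permutes UNIV}"
  let ?X = "\<lambda>p j. axis (p j) (1::real)"
  have lin: "linear (\<lambda>v. M (g(a := v)))" for g a
    using M by (simp add: multilinear_def)
  have e: "M ((?X p)(i := N (axis (p i) 1))) =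
     (\<Sum>a\<in>UNIV. \<Sum>b\<in>UNIV. N (axis b 1) $ a * (if p i = b then M (?X (p(i := a))) else 0))" for p :: "'n \<Rightarrow> 'n" and i
  proof -
    have "M ((?X p)(i := N (axis (p i) 1))) = M ((?X p)(i := (\<Sum>a\<in>UNIV. N (axis (p i) 1) $ a *\<^sub>R axis a 1)))"
      using basis_expansion [of "N (axis (p i) 1)"] by (simp add: scalar_mult_eq_scaleR)
    also have "\<dots> = (\<Sum>a\<in>UNIV. N (axis (p i) 1) $ a * M ((?X p)(i := axis a 1)))"
      using linear_sum [OF lin, of "?X p" i "\<lambda>a. N (axis (p i) 1) $ a *\<^sub>R axis a 1" UNIV]
      by (simp add: linear_cmul [OF lin])
    also have "\<dots> = (\<Sum>a\<in>UNIV. N (axis (p i) 1) $ a * M (?X (p(i := a))))"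
      by (intro sum.cong refl arg_cong2 [where f = "(*)"] arg_cong [where f = M]) auto
    finally show ?thesis by (simp add: if_distrib [where f = "\<lambda>x. _ * x"] cong: if_cong)
  qed
  have s: "(\<Sum>i\<in>UNIV. altsum (\<lambda>p. if p i = b then M (?X (p(i := a))) else 0)) =
      (if a = b then altsum (\<lambda>p. M (?X p)) else 0)" for a b
  proof -
    define u where "u = id(b := a)"
    have "(\<Sum>i\<in>UNIV. altsum (\<lambda>p. if p i = b then M (?X (p(i := a))) else 0)) =
        altsum (\<lambda>p. \<Sum>i\<in>UNIV. if p i = b then M (?X (p(i := a))) else 0)"
      by (simp add: altsum_sum)
    also have "\<dots> = altsum (\<lambda>p. M (?X (u \<circ> p)))"
      unfolding altsum_def
    proof (intro sum.cong refl arg_cong2 [where f = "(*)"])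
      fix p assume "p \<in> ?P"
      then have bij: "bij p" by (simp add: permutes_bij)
      then obtain i where i: "p i = b" by (metis bij_pointE)
      have "p j = b \<longleftrightarrow> j = i" for j using i bij by (metis bij_pointE)
      then have "(\<Sum>i\<in>UNIV. if p i = b then M (?X (p(i := a))) else 0) = M (?X (p(i := a)))"
        by simp
      moreover have "p(i := a) = u \<circ> p"
        using \<open>\<And>j. p j = b \<longleftrightarrow> j = i\<close> by (auto simp: u_def fun_eq_iff)
      ultimately show "(\<Sum>i\<in>UNIV. if p i = b then M (?X (p(i := a))) else 0) = M (?X (u \<circ> p))"
        by simp
    qed
    also have "\<dots> = (if a = b then altsum (\<lambda>p. M (?X p)) else 0)"
    proof (cases "a = b")
      case True
      then have "u = id" by (auto simp: u_def)
      with True show ?thesis by simp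
    next
      case False
      let ?t = "Transposition.transpose a b"
      have t: "?t permutes UNIV" by (simp add: permutes_swap_id)
      have ut: "u \<circ> (?t \<circ> p) = u \<circ> p" for p :: "'n \<Rightarrow> 'n"
        by (auto simp: u_def fun_eq_iff Transposition.transpose_def)
      have "altsum (\<lambda>p. M (?X (u \<circ> p))) =
          (\<Sum>p\<in>?P. of_int (sign (?t \<circ> p)) * M (?X (u \<circ> (?t \<circ> p))))"
        unfolding altsum_def by (rule setum_permutations_compose_left [OF t])
      also have "\<dots> = (\<Sum>p\<in>?P. - (of_int (sign p) * M (?X (u \<circ> p))))"
      proof (rule sum.cong [OF refl])
        fix p assume "p \<in> ?P"
        then have "permutation p" "permutation ?t"
          using t finite permutation_permutes by blast+
        then have "sign (?t \<circ> p) = - sign p"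
          using False by (simp add: sign_compose sign_swap_id)
        then show "of_int (sign (?t \<circ> p)) * M (?X (u \<circ> (?t \<circ> p))) = - (of_int (sign p) * M (?X (u \<circ> p)))"
          by (simp add: ut)
      qed
      also have "\<dots> = - altsum (\<lambda>p. M (?X (u \<circ> p)))"
        by (simp add: altsum_def sum_negf)
      finally show ?thesis using False by simp
    qed
    finally show ?thesis .
  qed
  have "(\<Sum>i\<in>UNIV. altsum (\<lambda>p. M ((?X p)(i := N (axis (p i) 1))))) =
      (\<Sum>i\<in>UNIV. \<Sum>a\<in>UNIV. \<Sum>b\<in>UNIV. N (axis b 1) $ a * altsum (\<lambda>p. if p i = b then M (?X (p(i := a))) else 0))"
    by (simp add: e altsum_sum altsum_cmult)
  also have "\<dots> = (\<Sum>a\<in>UNIV. \<Sum>b\<in>UNIV. N (axis b 1) $ a * (\<Sum>i\<in>UNIV. altsum (\<lambda>p. if p i = b then M (?X (p(i := a))) else 0)))"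
    unfolding sum_distrib_left
    by (subst sum.swap, rule sum.cong [OF refl], rule sum.swap)
  also have "\<dots> = (\<Sum>a\<in>UNIV. N (axis a 1) $ a * altsum (\<lambda>p. M (?X p)))"
    unfolding s by (simp add: if_distrib [where f = "\<lambda>x. _ * x"] cong: if_cong)
  finally show ?thesis by (simp add: sum_distrib_right)
qed

section \<open>The model three-form\<close>

lemma exhaust_7:
  fixes x :: 7
  shows "x = 1 \<or> x = 2 \<or> x = 3 \<or> x = 4 \<or> x = 5 \<or> x = 6 \<or> x = 7"
proof (induct x)
  case (of_int z)
  then have "z = 0 \<or> z = 1 \<or> z = 2 \<or> z = 3 \<or> z = 4 \<or> z = 5 \<or> z = 6" by fastforce
  then show ?case by auto
qed

lemma UNIV_7: "UNIV = {1, 2, 3, 4, 5, 6, 7::7}"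
  using exhaust_7 by auto

lemma sum_7: "sum f (UNIV::7 set) = f 1 + f 2 + f 3 + f 4 + f 5 + f 6 + f 7"
  unfolding UNIV_7 by (simp add: ac_simps)

lemma forall_7: "(\<forall>i::7. P i) \<longleftrightarrow> P 1 \<and> P 2 \<and> P 3 \<and> P 4 \<and> P 5 \<and> P 6 \<and> P 7"
  by (metis exhaust_7)

definition tri :: "7 \<Rightarrow> 7 \<Rightarrow> 7 \<Rightarrow> real^7 \<Rightarrow> real^7 \<Rightarrow> real^7 \<Rightarrow> real" where
  "tri i j k x y z = x$i * (y$j * z$k - y$k * z$j) - x$j * (y$i * z$k - y$k * z$i)
     + x$k * (y$i * z$j - y$j * z$i)"

definition Phi0 :: "real^7 \<Rightarrow> real^7 \<Rightarrow> real^7 \<Rightarrow> real" where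
  "Phi0 x y z = tri 1 2 7 x y z + tri 1 3 5 x y z - tri 1 4 6 x y z - tri 2 3 6 x y z
     - tri 2 4 5 x y z + tri 3 4 7 x y z + tri 5 6 7 x y z"

definition phi0 :: "7 \<Rightarrow> 7 \<Rightarrow> 7 \<Rightarrow> real" where
  "phi0 a b c = Phi0 (axis a 1) (axis b 1) (axis c 1)"

definition psi0 :: "7 \<Rightarrow> 7 \<Rightarrow> 7 \<Rightarrow> 7 \<Rightarrow> real" where
  "psi0 a b c d = (\<Sum>m\<in>UNIV. phi0 a b m * phi0 c d m)
     - (if a = c \<and> b = d then 1 else 0) + (if a = d \<and> b = c then 1 else 0)"

definition eps :: "(7 \<Rightarrow> 7) \<Rightarrow> real" where
  "eps f = (if bij f then of_int (sign f) else 0)"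

definition vec7 :: "'b \<Rightarrow> 'b \<Rightarrow> 'b \<Rightarrow> 'b \<Rightarrow> 'b \<Rightarrow> 'b \<Rightarrow> 'b \<Rightarrow> 7 \<Rightarrow> 'b" where
  "vec7 a b c d e f g i = (if i = 1 then a else if i = 2 then b else if i = 3 then c
     else if i = 4 then d else if i = 5 then e else if i = 6 then f else g)"

abbreviation e7 :: "7 \<Rightarrow> 7 \<Rightarrow> 7 \<Rightarrow> 7 \<Rightarrow> 7 \<Rightarrow> 7 \<Rightarrow> 7 \<Rightarrow> real" where
  "e7 a b c d e f g \<equiv> eps (vec7 a b c d e f g)"

lemma eps_transpose:
  assumes "i \<noteq> j"
  shows "eps (f \<circ> Transposition.transpose i j) = - eps f"
proof -
  have s: "Transposition.transpose i j permutes UNIV"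
    by (simp add: permutes_swap_id)
  then have "bij (Transposition.transpose i j)" by (rule permutes_bij)
  then have b: "bij (f \<circ> Transposition.transpose i j) \<longleftrightarrow> bij f"
    by (metis bij_comp comp_assoc transpose_comp_involutory comp_id)
  show ?thesis
  proof (cases "bij f")
    case True
    then have "f permutes UNIV" by (intro bij_imp_permutes) auto
    then have "permutation f" "permutation (Transposition.transpose i j)"
      using s finite permutation_permutes by blast+
    then have "sign (f \<circ> Transposition.transpose i j) = - sign f"
      using assms by (simp add: sign_compose sign_swap_id)
    with True b show ?thesis by (simp add: eps_def)
  qed (simp add: eps_def b)
qed

lemma e7_swap:
  "e7 b a c d e f g = - e7 a b c d e f g"
  "e7 a c b d e f g = - e7 a b c d e f g"
  "e7 a b d c e f g = - e7 a b c d e f g"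
  "e7 a b c e d f g = - e7 a b c d e f g"
  "e7 a b c d f e g = - e7 a b c d e f g"
  "e7 a b c d e g f = - e7 a b c d e f g"
proof -
  have x: "(if P then x else if P' then y else z) = h \<longleftrightarrow> (P \<longrightarrow> x = h) \<and> (\<not> P \<longrightarrow> P' \<longrightarrow> y = h) \<and> (\<not>P \<longrightarrow> \<not>P' \<longrightarrow> z = h)" for P P' x y z and h :: 7
    by auto
  note d = fun_eq_iff forall_7 vec7_def Transposition.transpose_def
  show "e7 b a c d e f g = - e7 a b c d e f g"
    by (subst eps_transpose [of 1 2, symmetric], simp) (rule arg_cong [of _ _ eps], simp add: d)
  show "e7 a c b d e f g = - e7 a b c d e f g"
    by (subst eps_transpose [of 2 3, symmetric], simp) (rule arg_cong [of _ _ eps], simp add: d)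
  show "e7 a b d c e f g = - e7 a b c d e f g"
    by (subst eps_transpose [of 3 4, symmetric], simp) (rule arg_cong [of _ _ eps], simp add: d)
  show "e7 a b c e d f g = - e7 a b c d e f g"
    by (subst eps_transpose [of 4 5, symmetric], simp) (rule arg_cong [of _ _ eps], simp add: d)
  show "e7 a b c d f e g = - e7 a b c d e f g"
    by (subst eps_transpose [of 5 6, symmetric], simp) (rule arg_cong [of _ _ eps], simp add: d)
  show "e7 a b c d e g f = - e7 a b c d e f g"
    by (subst eps_transpose [of 6 7, symmetric], simp) (rule arg_cong [of _ _ eps], simp add: d)
qed

lemma e7_base: "e7 1 2 3 4 5 6 7 = 1"
proof -
  have "vec7 1 2 3 4 5 6 7 = id"
    unfolding fun_eq_iff forall_7 by (simp add: vec7_def)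
  then show ?thesis by (simp add: eps_def)
qed

lemma e7_not_distinct:
  assumes "\<not> distinct [a, b, c, d, e, f, g]"
  shows "e7 a b c d e f g = 0"
proof -
  have "\<not> inj (vec7 a b c d e f g)"
  proof
    assume i: "inj (vec7 a b c d e f g)"
    have "vec7 a b c d e f g i = vec7 a b c d e f g j \<longrightarrow> i = j" for i j
      using i by (auto simp: inj_def)
    then have "\<forall>i j. vec7 a b c d e f g i = vec7 a b c d e f g j \<longrightarrow> i = j" by blast
    then have "distinct [a, b, c, d, e, f, g]"
      unfolding forall_7 by (simp add: vec7_def)
    with assms show False by blast
  qed
  then show ?thesis by (simp add: eps_def bij_def)
qed

lemma e7_sort:
  "e7 a 1 b c d e f = - e7 1 a b c d e f"
  "e7 a b 1 c d e f = e7 1 a b c d e f"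
  "e7 a b c 1 d e f = - e7 1 a b c d e f"
  "e7 a b c d 1 e f = e7 1 a b c d e f"
  "e7 a b c d e 1 f = - e7 1 a b c d e f"
  "e7 a b c d e f 1 = e7 1 a b c d e f"
  "e7 1 a 2 b c d e = - e7 1 2 a b c d e"
  "e7 1 a b 2 c d e = e7 1 2 a b c d e"
  "e7 1 a b c 2 d e = - e7 1 2 a b c d e"
  "e7 1 a b c d 2 e = e7 1 2 a b c d e"
  "e7 1 a b c d e 2 = - e7 1 2 a b c d e"
  "e7 1 2 a 3 b c d = - e7 1 2 3 a b c d"
  "e7 1 2 a b 3 c d = e7 1 2 3 a b c d"
  "e7 1 2 a b c 3 d = - e7 1 2 3 a b c d"
  "e7 1 2 a b c d 3 = e7 1 2 3 a b c d"
  "e7 1 2 3 a 4 b c = - e7 1 2 3 4 a b c"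
  "e7 1 2 3 a b 4 c = e7 1 2 3 4 a b c"
  "e7 1 2 3 a b c 4 = - e7 1 2 3 4 a b c"
  "e7 1 2 3 4 a 5 b = - e7 1 2 3 4 5 a b"
  "e7 1 2 3 4 a b 5 = e7 1 2 3 4 5 a b"
  "e7 1 2 3 4 5 a 6 = - e7 1 2 3 4 5 6 a"
  using e7_swap by (metis minus_minus)+

lemma phi0_table:
  "phi0 1 1 m = 0"
  "phi0 1 2 m = (if m = 7 then 1 else 0)"
  "phi0 1 3 m = (if m = 5 then 1 else 0)"
  "phi0 1 4 m = (if m = 6 then - 1 else 0)"
  "phi0 1 5 m = (if m = 3 then - 1 else 0)"
  "phi0 1 6 m = (if m = 4 then 1 else 0)"
  "phi0 1 7 m = (if m = 2 then - 1 else 0)"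
  "phi0 2 1 m = (if m = 7 then - 1 else 0)"
  "phi0 2 2 m = 0"
  "phi0 2 3 m = (if m = 6 then - 1 else 0)"
  "phi0 2 4 m = (if m = 5 then - 1 else 0)"
  "phi0 2 5 m = (if m = 4 then 1 else 0)"
  "phi0 2 6 m = (if m = 3 then 1 else 0)"
  "phi0 2 7 m = (if m = 1 then 1 else 0)"
  "phi0 3 1 m = (if m = 5 then - 1 else 0)"
  "phi0 3 2 m = (if m = 6 then 1 else 0)"
  "phi0 3 3 m = 0"
  "phi0 3 4 m = (if m = 7 then 1 else 0)"
  "phi0 3 5 m = (if m = 1 then 1 else 0)"
  "phi0 3 6 m = (if m = 2 then - 1 else 0)"
  "phi0 3 7 m = (if m = 4 then - 1 else 0)"
  "phi0 4 1 m = (if m = 6 then 1 else 0)"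
  "phi0 4 2 m = (if m = 5 then 1 else 0)"
  "phi0 4 3 m = (if m = 7 then - 1 else 0)"
  "phi0 4 4 m = 0"
  "phi0 4 5 m = (if m = 2 then - 1 else 0)"
  "phi0 4 6 m = (if m = 1 then - 1 else 0)"
  "phi0 4 7 m = (if m = 3 then 1 else 0)"
  "phi0 5 1 m = (if m = 3 then 1 else 0)"
  "phi0 5 2 m = (if m = 4 then - 1 else 0)"
  "phi0 5 3 m = (if m = 1 then - 1 else 0)"
  "phi0 5 4 m = (if m = 2 then 1 else 0)"
  "phi0 5 5 m = 0"
  "phi0 5 6 m = (if m = 7 then 1 else 0)"
  "phi0 5 7 m = (if m = 6 then - 1 else 0)"
  "phi0 6 1 m = (if m = 4 then - 1 else 0)"
  "phi0 6 2 m = (if m = 3 then - 1 else 0)"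
  "phi0 6 3 m = (if m = 2 then 1 else 0)"
  "phi0 6 4 m = (if m = 1 then 1 else 0)"
  "phi0 6 5 m = (if m = 7 then - 1 else 0)"
  "phi0 6 6 m = 0"
  "phi0 6 7 m = (if m = 5 then 1 else 0)"
  "phi0 7 1 m = (if m = 2 then 1 else 0)"
  "phi0 7 2 m = (if m = 1 then - 1 else 0)"
  "phi0 7 3 m = (if m = 4 then 1 else 0)"
  "phi0 7 4 m = (if m = 3 then - 1 else 0)"
  "phi0 7 5 m = (if m = 6 then 1 else 0)"
  "phi0 7 6 m = (if m = 5 then - 1 else 0)"
  "phi0 7 7 m = 0"
  unfolding phi0_def Phi0_def tri_def axis_def by simp_all

lemma sum_axis_triple:
  fixes X :: "7 \<Rightarrow> 7 \<Rightarrow> 7 \<Rightarrow> real"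
  shows "(\<Sum>e\<in>UNIV. \<Sum>f\<in>UNIV. \<Sum>g\<in>UNIV. X e f g * (axis e 1 $ i * (axis f 1 $ j * axis g 1 $ k))) = X i j k"
proof -
  have "axis e (1::real) $ i = (if i = e then 1 else 0)" for e i :: 7
    by (auto simp: axis_def)
  then show ?thesis
    by (simp add: if_distrib [where f = "\<lambda>x. _ * x"] if_distrib [where f = "\<lambda>x. x * _"] cong: if_cong)
qed

lemma sum_tri:
  fixes X :: "7 \<Rightarrow> 7 \<Rightarrow> 7 \<Rightarrow> real"
  shows "(\<Sum>e\<in>UNIV. \<Sum>f\<in>UNIV. \<Sum>g\<in>UNIV. X e f g * tri i j k (axis e 1) (axis f 1) (axis g 1)) =
     X i j k - X i k j - X j i k + X k i j + X j k i - X k j i"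
proof -
  have "X e f g * tri i j k (axis e 1) (axis f 1) (axis g 1) =
      X e f g * (axis e 1 $ i * (axis f 1 $ j * axis g 1 $ k)) - X e f g * (axis e 1 $ i * (axis f 1 $ k * axis g 1 $ j))
    - X e f g * (axis e 1 $ j * (axis f 1 $ i * axis g 1 $ k)) + X e f g * (axis e 1 $ k * (axis f 1 $ i * axis g 1 $ j))
    + X e f g * (axis e 1 $ j * (axis f 1 $ k * axis g 1 $ i)) - X e f g * (axis e 1 $ k * (axis f 1 $ j * axis g 1 $ i))" for e f g
    unfolding tri_def by algebra
  then show ?thesis
    by (simp only: sum.distrib sum_subtractf sum_axis_triple)
qed

lemma e7_sum_tri:
  "(\<Sum>e\<in>UNIV. \<Sum>f\<in>UNIV. \<Sum>g\<in>UNIV. e7 a b c d e f g * tri i j k (axis e 1) (axis f 1) (axis g 1)) =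
     6 * e7 a b c d i j k"
  unfolding sum_tri
  using e7_swap(5) [of a b c d i j k] e7_swap(5) [of a b c d i k j] e7_swap(5) [of a b c d k j i]
    e7_swap(6) [of a b c d i j k] e7_swap(6) [of a b c d j i k] e7_swap(6) [of a b c d k i j]
  by linarith

lemma if_mult: "(if P then x else 0) * y = (if P then x * y else (0::real))"
  by simp

lemma tri_skew: "tri i j k y x z = - tri i j k x y z" "tri i j k x z y = - tri i j k x y z"
  unfolding tri_def by algebra+

lemma Phi0_skew: "Phi0 y x z = - Phi0 x y z" "Phi0 x z y = - Phi0 x y z"
  unfolding Phi0_def
  by (simp_all only: tri_skew(1) [where x = x and y = y] tri_skew(2) [where y = y and z = z])

lemma phi0_skew: "phi0 b a c = - phi0 a b c" "phi0 a c b = - phi0 a b c"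
  unfolding phi0_def by (rule Phi0_skew)+

lemma psi0_skew: "psi0 b a c d = - psi0 a b c d" "psi0 a b d c = - psi0 a b c d"
proof -
  have "(\<Sum>m\<in>UNIV. phi0 b a m * phi0 c d m) = - (\<Sum>m\<in>UNIV. phi0 a b m * phi0 c d m)"
    by (simp only: phi0_skew(1) [of b a] mult_minus_left sum_negf)
  moreover have "(\<Sum>m\<in>UNIV. phi0 a b m * phi0 d c m) = - (\<Sum>m\<in>UNIV. phi0 a b m * phi0 c d m)"
    by (simp only: phi0_skew(1) [of d c] mult_minus_right sum_negf)
  moreover have "(if b = c \<and> a = d then 1 else 0 :: real) = (if a = d \<and> b = c then 1 else 0)"
    "(if b = d \<and> a = c then 1 else 0 :: real) = (if a = c \<and> b = d then 1 else 0)"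
    by (simp_all only: conj_commute)
  ultimately show "psi0 b a c d = - psi0 a b c d" "psi0 a b d c = - psi0 a b c d"
    unfolding psi0_def by linarith+
qed

definition rank7 :: "7 \<Rightarrow> nat" where
  "rank7 = vec7 1 2 3 4 5 6 7"

lemma rank7_simps: "rank7 1 = 1" "rank7 2 = 2" "rank7 3 = 3" "rank7 4 = 4" "rank7 5 = 5" "rank7 6 = 6" "rank7 7 = 7"
  by (simp_all add: rank7_def vec7_def)

lemma rank7_linear: "rank7 a < rank7 b \<or> rank7 b < rank7 a \<or> a = b"
  using exhaust_7 [of a] exhaust_7 [of b] by (auto simp: rank7_simps)

lemma sorted_quadruple_cases:
  assumes swap: "\<And>a b c d. Q a b c d \<Longrightarrow> Q b a c d" "\<And>a b c d. Q a b c d \<Longrightarrow> Q a c b d"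
      "\<And>a b c d. Q a b c d \<Longrightarrow> Q a b d c"
    and eq: "\<And>a c d. Q a a c d"
    and sorted: "Q 1 2 3 4 \<and> Q 1 2 3 5 \<and> Q 1 2 3 6 \<and> Q 1 2 3 7 \<and> Q 1 2 4 5 \<and> Q 1 2 4 6 \<and> Q 1 2 4 7 \<and> Q 1 2 5 6 \<and> Q 1 2 5 7 \<and> Q 1 2 6 7 \<and> Q 1 3 4 5 \<and> Q 1 3 4 6 \<and> Q 1 3 4 7 \<and> Q 1 3 5 6 \<and> Q 1 3 5 7 \<and> Q 1 3 6 7 \<and> Q 1 4 5 6 \<and> Q 1 4 5 7 \<and> Q 1 4 6 7 \<and> Q 1 5 6 7 \<and> Q 2 3 4 5 \<and> Q 2 3 4 6 \<and> Q 2 3 4 7 \<and> Q 2 3 5 6 \<and> Q 2 3 5 7 \<and> Q 2 3 6 7 \<and> Q 2 4 5 6 \<and> Q 2 4 5 7 \<and> Q 2 4 6 7 \<and> Q 2 5 6 7 \<and> Q 3 4 5 6 \<and> Q 3 4 5 7 \<and> Q 3 4 6 7 \<and> Q 3 5 6 7 \<and> Q 4 5 6 7"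
  shows "Q (a::7) b c d"
proof -
  have s: "Q a b c d" if "rank7 a < rank7 b" "rank7 b < rank7 c" "rank7 c < rank7 d" for a b c d
  proof -
    have "\<forall>a b c d. rank7 a < rank7 b \<longrightarrow> rank7 b < rank7 c \<longrightarrow> rank7 c < rank7 d \<longrightarrow> Q a b c d"
      unfolding forall_7 rank7_simps by (simp add: sorted)
    then show ?thesis using that by blast
  qed
  have e: "Q a b c d" if "a = b \<or> a = c \<or> a = d \<or> b = c \<or> b = d \<or> c = d" for a b c d
    using that swap eq by metis
  define r where "r a b \<longleftrightarrow> rank7 a < rank7 b" for a b
  have t: "r a b \<Longrightarrow> r b c \<Longrightarrow> r a c" for a b c by (auto simp: r_def)
  have l: "r a b \<or> r b a \<or> a = b" for a b using rank7_linear by (simp add: r_def)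
  have s2: "Q a b c d" if "r a b" "r b c" for a b c d
    using s [folded r_def] that l [of c d] l [of b d] l [of a d] e [of a b c d] swap by metis
  have s3: "Q a b c d" if "r a b" for a b c d
    using s2 that l [of b c] l [of a c] e [of a b c d] swap by metis
  show ?thesis
    using s3 l [of a b] e [of a b c d] swap by metis
qed

lemma psi0_middle: "psi0 a c b d = - psi0 a b c d"
proof -
  define P where "P b c \<longleftrightarrow> (\<forall>a d. psi0 a c b d = - psi0 a b c d)" for b c
  have P_sym: "P c b" if "P b c" for b c
    using that by (simp add: P_def)
  have "\<forall>b c. rank7 b \<le> rank7 c \<longrightarrow> P b c"
    unfolding forall_7 rank7_simps
    by (intro conjI; simp; (simp only: P_def forall_7; (intro conjI; simp add: psi0_def phi0_table if_mult))?)
  then have "P b c"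
    using P_sym [of c b] by (meson nat_le_linear)
  then show ?thesis by (simp add: P_def)
qed

lemma psi0_eq_eps:
  "psi0 a b c d = e7 a b c d 1 2 7 + e7 a b c d 1 3 5 - e7 a b c d 1 4 6 - e7 a b c d 2 3 6
     - e7 a b c d 2 4 5 + e7 a b c d 3 4 7 + e7 a b c d 5 6 7"  (is "_ = ?e a b c d")
proof (rule sorted_quadruple_cases [where Q = "\<lambda>a b c d. psi0 a b c d = ?e a b c d"])
  show "psi0 b a c d = ?e b a c d" if "psi0 a b c d = ?e a b c d" for a b c d
    using that unfolding psi0_skew(1) [of b a] e7_swap(1) [of b a] by linarith
  show "psi0 a c b d = ?e a c b d" if "psi0 a b c d = ?e a b c d" for a b c d
    using that unfolding psi0_middle [of a c b d] e7_swap(2) [of a c b d] by linarith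
  show "psi0 a b d c = ?e a b d c" if "psi0 a b c d = ?e a b c d" for a b c d
    using that unfolding psi0_skew(2) [of a b d c] e7_swap(3) [of a b d c] by linarith
  show "psi0 a a c d = ?e a a c d" for a c d
    using psi0_skew(1) [of a a c d] by (simp add: e7_not_distinct)
qed (intro conjI; simp add: psi0_def phi0_table if_mult e7_not_distinct; simp add: e7_sort e7_base)

lemma altsum_eps: "altsum F = (\<Sum>f\<in>UNIV. eps f * F f)"
proof -
  have "altsum F = (\<Sum>p | p permutes UNIV. eps p * F p)"
    unfolding altsum_def by (intro sum.cong refl) (auto simp: eps_def permutes_bij)
  also have "\<dots> = (\<Sum>f\<in>UNIV. eps f * F f)"
    by (rule sum.mono_neutral_left) (auto simp: eps_def intro: bij_imp_permutes)
  finally show ?thesis .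
qed

lemma sum_vec7:
  fixes F :: "(7 \<Rightarrow> 7) \<Rightarrow> real"
  shows "(\<Sum>f\<in>UNIV. F f) = (\<Sum>a\<in>UNIV. \<Sum>b\<in>UNIV. \<Sum>c\<in>UNIV. \<Sum>d\<in>UNIV. \<Sum>e\<in>UNIV. \<Sum>f\<in>UNIV. \<Sum>g\<in>UNIV.
    F (vec7 a b c d e f g))"
proof -
  let ?v = "\<lambda>(a :: 7, b, c, d, e, f, g). vec7 a b c d e f g"
  have v: "vec7 a b c d e f g = h \<longleftrightarrow> a = h 1 \<and> b = h 2 \<and> c = h 3 \<and> d = h 4 \<and> e = h 5 \<and> f = h 6 \<and> g = h 7"
    for a b c d e f g and h :: "7 \<Rightarrow> 7"
    unfolding fun_eq_iff forall_7 by (simp add: vec7_def)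
  have "bij ?v"
  proof (rule bij_betw_byWitness [where f' = "\<lambda>h. (h 1, h 2, h 3, h 4, h 5, h 6, h 7)"])
    show "\<forall>x\<in>UNIV. (?v x 1, ?v x 2, ?v x 3, ?v x 4, ?v x 5, ?v x 6, ?v x 7) = x"
      by (auto simp: vec7_def)
  qed (auto simp: v)
  then have "(\<Sum>f\<in>UNIV. F f) = (\<Sum>x\<in>UNIV. F (?v x))"
    by (rule sum.reindex_bij_betw [symmetric])
  also have "\<dots> = (\<Sum>a\<in>UNIV. \<Sum>b\<in>UNIV. \<Sum>c\<in>UNIV. \<Sum>d\<in>UNIV. \<Sum>e\<in>UNIV. \<Sum>f\<in>UNIV. \<Sum>g\<in>UNIV.
    F (vec7 a b c d e f g))"
    by (simp add: UNIV_Times_UNIV [symmetric] sum.cartesian_product' del: UNIV_Times_UNIV)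
  finally show ?thesis .
qed

lemma phi0_tri:
  "phi0 e f g = tri 1 2 7 (axis e 1) (axis f 1) (axis g 1) + tri 1 3 5 (axis e 1) (axis f 1) (axis g 1)
     - tri 1 4 6 (axis e 1) (axis f 1) (axis g 1) - tri 2 3 6 (axis e 1) (axis f 1) (axis g 1)
     - tri 2 4 5 (axis e 1) (axis f 1) (axis g 1) + tri 3 4 7 (axis e 1) (axis f 1) (axis g 1)
     + tri 5 6 7 (axis e 1) (axis f 1) (axis g 1)"
  by (simp only: phi0_def Phi0_def)

text \<open>The four-form \<open>psi0\<close> is the Hodge dual of \<open>phi0\<close>.\<close>

lemma altsum_phi0:
  "altsum (\<lambda>p. k (p 1) (p 2) (p 3) (p 4) * phi0 (p 5) (p 6) (p 7)) =
    6 * (\<Sum>a\<in>UNIV. \<Sum>b\<in>UNIV. \<Sum>c\<in>UNIV. \<Sum>d\<in>UNIV. k a b c d * psi0 a b c d)"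
proof -
  have v: "vec7 a b c d e f g 1 = a" "vec7 a b c d e f g 2 = b" "vec7 a b c d e f g 3 = c" "vec7 a b c d e f g 4 = d"
    "vec7 a b c d e f g 5 = e" "vec7 a b c d e f g 6 = f" "vec7 a b c d e f g 7 = g" for a b c d e f g :: 7
    by (simp_all add: vec7_def)
  have *: "(\<Sum>e\<in>UNIV. \<Sum>f\<in>UNIV. \<Sum>g\<in>UNIV. e7 a b c d e f g * phi0 e f g) = 6 * psi0 a b c d" for a b c d
    unfolding phi0_tri distrib_left right_diff_distrib sum.distrib sum_subtractf e7_sum_tri psi0_eq_eps ..
  have "altsum (\<lambda>p. k (p 1) (p 2) (p 3) (p 4) * phi0 (p 5) (p 6) (p 7)) =
     (\<Sum>a\<in>UNIV. \<Sum>b\<in>UNIV. \<Sum>c\<in>UNIV. \<Sum>d\<in>UNIV. \<Sum>e\<in>UNIV. \<Sum>f\<in>UNIV. \<Sum>g\<in>UNIV.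
        e7 a b c d e f g * (k a b c d * phi0 e f g))"
    unfolding altsum_eps sum_vec7 v ..
  also have "\<dots> = (\<Sum>a\<in>UNIV. \<Sum>b\<in>UNIV. \<Sum>c\<in>UNIV. \<Sum>d\<in>UNIV. k a b c d *
      (\<Sum>e\<in>UNIV. \<Sum>f\<in>UNIV. \<Sum>g\<in>UNIV. e7 a b c d e f g * phi0 e f g))"
    by (simp only: sum_distrib_left mult.left_commute)
  also have "\<dots> = 6 * (\<Sum>a\<in>UNIV. \<Sum>b\<in>UNIV. \<Sum>c\<in>UNIV. \<Sum>d\<in>UNIV. k a b c d * psi0 a b c d)"
    unfolding * by (simp only: sum_distrib_left mult.left_commute)
  finally show ?thesis .
qed

abbreviation delta :: "7 \<Rightarrow> 7 \<Rightarrow> real" where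
  "delta a b \<equiv> (if a = b then 1 else 0)"

lemma if_conj_mult: "(if P \<and> Q then 1 else 0) = (if P then 1 else 0) * (if Q then 1 else (0::real))"
  by simp

lemma phi0_phi0:
  "(\<Sum>m\<in>UNIV. phi0 a b m * phi0 c d m) = psi0 a b c d + delta a c * delta b d - delta a d * delta b c"
  unfolding psi0_def if_conj_mult by linarith

lemma psi0_repeated: "psi0 a b a d = 0" "psi0 a b c a = 0" "psi0 a b b d = 0" "psi0 a b c b = 0"
  using psi0_middle [of a b b d] psi0_skew(1) [of a b b d] psi0_skew(1) [of b a a d] psi0_middle [of b a a d]
    psi0_skew(2) [of a b b c] psi0_middle [of a b b c] psi0_skew(1) [of b a c a] psi0_skew(2) [of b a a c]
     psi0_middle [of b a a c]
  by linarith+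

lemma psi0_pair_swap: "psi0 c d a b = psi0 a b c d"
proof -
  have "psi0 c d a b = (\<Sum>m\<in>UNIV. phi0 c d m * phi0 a b m) - delta c a * delta d b + delta c b * delta d a"
    unfolding phi0_phi0 by linarith
  also have "\<dots> = (\<Sum>m\<in>UNIV. phi0 a b m * phi0 c d m) - delta a c * delta b d + delta a d * delta b c"
    by (simp only: mult.commute [of "phi0 c d _"] eq_commute [of c a] eq_commute [of d b] eq_commute [of c b]
        eq_commute [of d a] mult.commute [of "delta b c"])
  also have "\<dots> = psi0 a b c d"
    unfolding phi0_phi0 by linarith
  finally show ?thesis .
qed

lemma phi0_phi0_trace: "(\<Sum>b\<in>UNIV. \<Sum>m\<in>UNIV. phi0 a b m * phi0 c b m) = 6 * delta a c"
proof -
  have "(\<Sum>b\<in>UNIV. \<Sum>m\<in>UNIV. phi0 a b m * phi0 c b m) = (\<Sum>b\<in>UNIV. delta a c - delta a b * delta b c)"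
    unfolding phi0_phi0 psi0_repeated by (intro sum.cong refl) simp
  also have "\<dots> = 6 * delta a c"
    by (simp add: sum_subtractf if_mult)
  finally show ?thesis .
qed

lemma phi0_cyclic: "phi0 b c a = phi0 a b c"
  using phi0_skew(2) [of b a c] phi0_skew(1) [of b a c] by simp

lemma phi0_psi0: "(\<Sum>a\<in>UNIV. \<Sum>b\<in>UNIV. phi0 u a b * psi0 a b c d) = 4 * phi0 u c d"
proof -
  have "(\<Sum>a\<in>UNIV. \<Sum>b\<in>UNIV. phi0 u a b * psi0 a b c d) =
     (\<Sum>a\<in>UNIV. \<Sum>b\<in>UNIV. (\<Sum>m\<in>UNIV. phi0 u a b * (phi0 a b m * phi0 c d m))
        - phi0 u a b * delta a c * delta b d + phi0 u a b * delta a d * delta b c)"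
  proof -
    have "psi0 a b c d = (\<Sum>m\<in>UNIV. phi0 a b m * phi0 c d m) - delta a c * delta b d + delta a d * delta b c" for a b
      unfolding phi0_phi0 by linarith
    then show ?thesis
      by (simp only: distrib_left right_diff_distrib sum_distrib_left mult.assoc)
  qed
  also have "\<dots> = (\<Sum>a\<in>UNIV. \<Sum>b\<in>UNIV. \<Sum>m\<in>UNIV. phi0 u a b * (phi0 a b m * phi0 c d m)) - phi0 u c d + phi0 u d c"
    by (simp add: sum.distrib sum_subtractf if_mult if_distrib [where f = "\<lambda>x. _ * x"] cong: if_cong)
  also have "(\<Sum>a\<in>UNIV. \<Sum>b\<in>UNIV. \<Sum>m\<in>UNIV. phi0 u a b * (phi0 a b m * phi0 c d m)) =
     (\<Sum>a\<in>UNIV. \<Sum>m\<in>UNIV. \<Sum>b\<in>UNIV. phi0 u a b * (phi0 a b m * phi0 c d m))"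
    by (rule sum.cong [OF refl], rule sum.swap)
  also have "\<dots> = (\<Sum>m\<in>UNIV. \<Sum>a\<in>UNIV. \<Sum>b\<in>UNIV. phi0 u a b * (phi0 a b m * phi0 c d m))"
    by (rule sum.swap)
  also have "\<dots> = (\<Sum>m\<in>UNIV. phi0 c d m * (\<Sum>a\<in>UNIV. \<Sum>b\<in>UNIV. phi0 u a b * phi0 m a b))"
  proof -
    have "phi0 u a b * (phi0 a b m * phi0 c d m) = phi0 c d m * (phi0 u a b * phi0 m a b)" for a b m
      using phi0_cyclic [of a b m] by simp
    then show ?thesis by (simp only: sum_distrib_left)
  qed
  also have "\<dots> = 6 * phi0 c d u"
    by (simp add: phi0_phi0_trace if_distrib [where f = "\<lambda>x. _ * x"] cong: if_cong)
  finally show ?thesis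
    using phi0_skew(2) [of u d c] phi0_cyclic [of c d u] by linarith
qed

text \<open>A skew matrix annihilating \<open>phi0\<close> lies in $\mathfrak{g}_2$, on which the operator
  \<open>A \<mapsto> *(phi0 \<and> A)\<close> has a single eigenvalue.\<close>

lemma g2_eigenvalue:
  assumes skew: "\<And>a b. A b a = - A a b"
    and inv: "\<And>e f g. (\<Sum>k\<in>UNIV. A e k * phi0 k f g + A f k * phi0 e k g + A g k * phi0 e f k) = 0"
  shows "(\<Sum>a\<in>UNIV. \<Sum>b\<in>UNIV. A a b * psi0 a b c d) = - 2 * A c d"
proof -
  have 1: "(\<Sum>f\<in>UNIV. \<Sum>g\<in>UNIV. \<Sum>k\<in>UNIV. A c k * phi0 k f g * phi0 d f g) = 6 * A c d"
  proof -
    have "(\<Sum>f\<in>UNIV. \<Sum>g\<in>UNIV. \<Sum>k\<in>UNIV. A c k * phi0 k f g * phi0 d f g) =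
       (\<Sum>f\<in>UNIV. \<Sum>k\<in>UNIV. \<Sum>g\<in>UNIV. A c k * phi0 k f g * phi0 d f g)"
      by (rule sum.cong [OF refl], rule sum.swap)
    also have "\<dots> = (\<Sum>k\<in>UNIV. \<Sum>f\<in>UNIV. \<Sum>g\<in>UNIV. A c k * phi0 k f g * phi0 d f g)"
      by (rule sum.swap)
    also have "\<dots> = (\<Sum>k\<in>UNIV. A c k * (\<Sum>f\<in>UNIV. \<Sum>g\<in>UNIV. phi0 k f g * phi0 d f g))"
      by (simp add: sum_distrib_left ac_simps)
    also have "\<dots> = 6 * A c d"
      by (simp add: phi0_phi0_trace if_distrib [where f = "\<lambda>x. _ * x"] cong: if_cong)
    finally show ?thesis .
  qed
  have 2: "(\<Sum>f\<in>UNIV. \<Sum>k\<in>UNIV. \<Sum>g\<in>UNIV. A f k * phi0 c k g * phi0 d f g) =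
     (\<Sum>a\<in>UNIV. \<Sum>b\<in>UNIV. A a b * psi0 a b c d) - A c d"
  proof -
    have p: "psi0 c k d f = psi0 f k c d" for f k
      using psi0_skew(1) [of c k d f] psi0_middle [of k c d f] psi0_pair_swap [of c f k d]
        psi0_middle [of k d c f] psi0_skew(2) [of c f k d]
        psi0_pair_swap [of f k c d] psi0_skew(1) [of f k c d] psi0_skew(2) [of k d f c] psi0_middle[of k c d f]
        psi0_skew(2) [of k d c f] psi0_skew(2) [of k c d f] psi0_middle [of k c f d] psi0_skew(2) [of k f c d]
      by linarith
    have z: "A f f = 0" for f using skew [of f f] by simp
    have "(\<Sum>f\<in>UNIV. \<Sum>k\<in>UNIV. \<Sum>g\<in>UNIV. A f k * phi0 c k g * phi0 d f g) =
      (\<Sum>f\<in>UNIV. \<Sum>k\<in>UNIV. A f k * (\<Sum>g\<in>UNIV. phi0 c k g * phi0 d f g))"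
      by (simp add: sum_distrib_left ac_simps)
    also have "\<dots> = (\<Sum>f\<in>UNIV. \<Sum>k\<in>UNIV. A f k * psi0 f k c d + delta k f * (A f k * delta c d) - delta k d * (delta c f * A f k))"
      unfolding phi0_phi0 p by (simp only: distrib_left right_diff_distrib ac_simps)
    also have "\<dots> = (\<Sum>a\<in>UNIV. \<Sum>b\<in>UNIV. A a b * psi0 a b c d) - A c d"
      by (simp add: sum.distrib sum_subtractf if_mult z)
    finally show ?thesis .
  qed
  have 4: "(\<Sum>f\<in>UNIV. \<Sum>g\<in>UNIV. \<Sum>k\<in>UNIV. A f k * phi0 c k g * phi0 d f g) =
     (\<Sum>a\<in>UNIV. \<Sum>b\<in>UNIV. A a b * psi0 a b c d) - A c d"
    unfolding 2 [symmetric] by (rule sum.cong [OF refl], rule sum.swap)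
  have 3: "(\<Sum>f\<in>UNIV. \<Sum>g\<in>UNIV. \<Sum>k\<in>UNIV. A g k * phi0 c f k * phi0 d f g) =
     (\<Sum>a\<in>UNIV. \<Sum>b\<in>UNIV. A a b * psi0 a b c d) - A c d"
  proof -
    have "(\<Sum>f\<in>UNIV. \<Sum>g\<in>UNIV. \<Sum>k\<in>UNIV. A g k * phi0 c f k * phi0 d f g) =
        (\<Sum>g\<in>UNIV. \<Sum>f\<in>UNIV. \<Sum>k\<in>UNIV. A g k * phi0 c f k * phi0 d f g)"
      by (rule sum.swap)
    also have "\<dots> = (\<Sum>f\<in>UNIV. \<Sum>g\<in>UNIV. \<Sum>k\<in>UNIV. A f k * phi0 c k g * phi0 d f g)"
    proof (intro sum.cong refl)
      fix f g k
      show "A f k * phi0 c g k * phi0 d g f = A f k * phi0 c k g * phi0 d f g"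
        using phi0_skew(2) [of c k g] phi0_skew(2) [of d f g] by simp
    qed
    finally show ?thesis unfolding 4 .
  qed
  have "0 = (\<Sum>f\<in>UNIV. \<Sum>g\<in>UNIV. (\<Sum>k\<in>UNIV. A c k * phi0 k f g + A f k * phi0 c k g + A g k * phi0 c f k) * phi0 d f g)"
    by (simp add: inv)
  also have "\<dots> = (\<Sum>f\<in>UNIV. \<Sum>g\<in>UNIV. \<Sum>k\<in>UNIV. A c k * phi0 k f g * phi0 d f g)
     + (\<Sum>f\<in>UNIV. \<Sum>g\<in>UNIV. \<Sum>k\<in>UNIV. A f k * phi0 c k g * phi0 d f g)
     + (\<Sum>f\<in>UNIV. \<Sum>g\<in>UNIV. \<Sum>k\<in>UNIV. A g k * phi0 c f k * phi0 d f g)"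
    by (simp only: sum_distrib_right distrib_right sum.distrib)
  finally show ?thesis
    unfolding 1 4 3 by simp
qed

section \<open>Adapted coframes\<close>

definition trilinear :: "('v::real_vector \<Rightarrow> 'v \<Rightarrow> 'v \<Rightarrow> real) \<Rightarrow> bool" where
  "trilinear P \<longleftrightarrow> (\<forall>y z. linear (\<lambda>x. P x y z)) \<and> (\<forall>x z. linear (\<lambda>y. P x y z)) \<and> (\<forall>x y. linear (\<lambda>z. P x y z))"

lemma trilinear_linear:
  assumes "trilinear P"
  shows "linear (\<lambda>x. P x y z)" "linear (\<lambda>y. P x y z)" "linear (\<lambda>z. P x y z)"
  using assms by (simp_all add: trilinear_def)

lemma linear_scale_right: "linear f \<Longrightarrow> linear (\<lambda>x. c * f x :: real)"
  by (simp add: linear_iff algebra_simps)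

lemma linear_scale_left: "linear f \<Longrightarrow> linear (\<lambda>x. f x * c :: real)"
  by (simp add: linear_iff algebra_simps)

lemma linear_comp: "linear f \<Longrightarrow> linear g \<Longrightarrow> linear (\<lambda>x. f (g x))"
  using linear_compose [of g f] by (simp add: o_def)

lemma trilinear_comp:
  assumes P: "trilinear P" and L: "linear L"
  shows "trilinear (\<lambda>x y z. P (L x) (L y) (L z))"
  unfolding trilinear_def using linear_comp [OF trilinear_linear(1) [OF P] L]
    linear_comp [OF trilinear_linear(2) [OF P] L] linear_comp [OF trilinear_linear(3) [OF P] L]
  by blast

lemma multilinear_7I:
  assumes "\<And>b c d e f g. linear (\<lambda>a. K a b c d e f g)" "\<And>a c d e f g. linear (\<lambda>b. K a b c d e f g)"
    "\<And>a b d e f g. linear (\<lambda>c. K a b c d e f g)" "\<And>a b c e f g. linear (\<lambda>d. K a b c d e f g)"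
    "\<And>a b c d f g. linear (\<lambda>e. K a b c d e f g)" "\<And>a b c d e g. linear (\<lambda>f. K a b c d e f g)"
    "\<And>a b c d e f. linear (\<lambda>g. K a b c d e f g)"
  shows "multilinear (\<lambda>f :: 7 \<Rightarrow> real^7. K (f 1) (f 2) (f 3) (f 4) (f 5) (f 6) (f 7))"
  unfolding multilinear_def
proof (intro allI)
  fix i :: 7 and f :: "7 \<Rightarrow> real^7"
  show "linear (\<lambda>v. K ((f(i := v)) 1) ((f(i := v)) 2) ((f(i := v)) 3) ((f(i := v)) 4)
     ((f(i := v)) 5) ((f(i := v)) 6) ((f(i := v)) 7))"
    using exhaust_7 [of i] by (elim disjE) (simp_all add: assms)
qed

lemma axis_expansion: "x = (\<Sum>i\<in>UNIV. x $ i *\<^sub>R axis i 1)" for x :: "real^'n"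
  using basis_expansion [of x] by (simp add: scalar_mult_eq_scaleR)

lemma linear_axis_expansion:
  fixes f :: "real^'n \<Rightarrow> real"
  assumes "linear f"
  shows "f x = (\<Sum>i\<in>UNIV. x $ i * f (axis i 1))"
  by (subst axis_expansion [of x]) (simp add: linear_sum [OF assms] linear_cmul [OF assms])

lemma trilinear_tri: "trilinear (tri i j k)"
  unfolding trilinear_def linear_iff tri_def by (simp add: algebra_simps)

lemma trilinear_Phi0: "trilinear Phi0"
  unfolding trilinear_def Phi0_def
  by (intro conjI allI linear_compose_add linear_compose_sub trilinear_linear [OF trilinear_tri])

lemma coframe_wedge_1: "coframe_wedge e [i] [u] = (e *v u) $ i"
  by (simp add: wedge_def lessThan_Suc permutes_sing sign_id)

lemma coframe_wedge_2:
  "coframe_wedge e [i, j] [u, v] = (e *v u) $ i * (e *v v) $ j - (e *v v) $ i * (e *v u) $ j"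
proof -
  have "{..<1 + 1} = insert 0 {1::nat}" by auto
  then have "{..<1 + length [j]} = insert 0 {1::nat}" by simp
  have perms: "sum F {p. p permutes {..<1 + length [j]}} = F id + F (Transposition.transpose 0 1)" for F :: "(nat \<Rightarrow> nat) \<Rightarrow> real"
    unfolding \<open>{..<1 + length [j]} = insert 0 {1::nat}\<close>
    by (subst sum_over_permutations_insert) (simp_all add: permutes_sing)
  have w: "coframe_wedge e [j] [w] = (e *v w) $ j" for w by (rule coframe_wedge_1)
  show ?thesis
    unfolding coframe_wedge.simps(2) [of e i] wedge_def perms
    by (simp add: coframe_wedge_1 [simplified] sign_swap_id sign_id)
qed

lemma coframe_wedge_3: "coframe_wedge e [i, j, k] [u, v, w] = tri i j k (e *v u) (e *v v) (e *v w)"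
proof -
  have "{..<1 + 2} = insert 0 (insert 1 {2::nat})" by auto
  then have S: "{..<1 + length [j, k]} = insert 0 (insert 1 {2::nat})" by simp
  have perms: "sum F {p. p permutes {..<1 + length [j, k]}} =
      F id + F (Transposition.transpose 1 2) + F (Transposition.transpose 0 1) + F (Transposition.transpose 0 1 \<circ> Transposition.transpose 1 2)
     + F (Transposition.transpose 0 2) + F (Transposition.transpose 0 2 \<circ> Transposition.transpose 1 2)" for F :: "(nat \<Rightarrow> nat) \<Rightarrow> real"
    unfolding S
    by (subst sum_over_permutations_insert, simp, simp, subst sum_over_permutations_insert) (simp_all add: permutes_sing)
  have sgn: "sign (Transposition.transpose (0::nat) 1 \<circ> Transposition.transpose 1 2) = 1"
      "sign (Transposition.transpose (0::nat) 2 \<circ> Transposition.transpose 1 2) = 1"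
    by (simp_all add: sign_compose permutation_swap_id sign_swap_id)
  show ?thesis
    unfolding coframe_wedge.simps(2) [of e i] wedge_def perms sgn
    by (simp add: coframe_wedge_2 [simplified] sign_swap_id sign_id tri_def Transposition.transpose_def numeral_eq_Suc field_simps)
qed

lemma adapted_coframe_Phi0:
  assumes "adapted_coframe p e"
  shows "p [u, v, w] = Phi0 (e *v u) (e *v v) (e *v w)"
  using assms unfolding adapted_coframe_def
  by (simp add: coframe_wedge_3 Phi0_def del: coframe_wedge.simps)

lemma sum_rotate: "(\<Sum>a\<in>A. \<Sum>b\<in>B. \<Sum>c\<in>C. G a b c) = (\<Sum>c\<in>C. \<Sum>a\<in>A. \<Sum>b\<in>B. G a b c)"
  by (rule trans [OF sum.cong [OF refl sum.swap] sum.swap])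

lemma sum_swap_pairs:
  "(\<Sum>a\<in>A. \<Sum>b\<in>B. \<Sum>c\<in>C. \<Sum>d\<in>D. G a b c d) = (\<Sum>c\<in>C. \<Sum>d\<in>D. \<Sum>a\<in>A. \<Sum>b\<in>B. G a b c d)"
  by (rule trans [OF sum_rotate]) (rule sum.cong [OF refl sum_rotate])

text \<open>Up to a constant, \<open>gram P x y\<close> is the 7-form $\iota_x P \wedge \iota_y P \wedge P$; for an adapted
  coframe it equals \<open>g x y\<close> times the volume form, which recovers both from the 3-form.\<close>

definition gram :: "(real^7 \<Rightarrow> real^7 \<Rightarrow> real^7 \<Rightarrow> real) \<Rightarrow> real^7 \<Rightarrow> real^7 \<Rightarrow> real" where
  "gram P x y = altsum (\<lambda>p. P x (axis (p 1) 1) (axis (p 2) 1) * P y (axis (p 3) 1) (axis (p 4) 1)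
     * P (axis (p 5) 1) (axis (p 6) 1) (axis (p 7) 1))"

lemma Phi0_axis: "Phi0 x (axis a 1) (axis b 1) = (\<Sum>i\<in>UNIV. x $ i * phi0 i a b)"
  unfolding phi0_def by (rule linear_axis_expansion [OF trilinear_linear(1) [OF trilinear_Phi0]])

lemma gram_Phi0: "gram Phi0 x y = 144 * (x \<bullet> y)"
proof -
  let ?F = "\<lambda>x a b. Phi0 x (axis a 1) (axis b 1)"
  have 1: "(\<Sum>a\<in>UNIV. \<Sum>b\<in>UNIV. ?F x a b * psi0 a b c d) = 4 * ?F x c d" for x c d
  proof -
    have "(\<Sum>a\<in>UNIV. \<Sum>b\<in>UNIV. ?F x a b * psi0 a b c d) =
        (\<Sum>a\<in>UNIV. \<Sum>b\<in>UNIV. \<Sum>i\<in>UNIV. x $ i * (phi0 i a b * psi0 a b c d))"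
      by (simp only: Phi0_axis sum_distrib_right mult.assoc)
    also have "\<dots> = (\<Sum>i\<in>UNIV. \<Sum>a\<in>UNIV. \<Sum>b\<in>UNIV. x $ i * (phi0 i a b * psi0 a b c d))"
      by (rule sum_rotate)
    also have "\<dots> = 4 * ?F x c d"
      by (simp only: sum_distrib_left [symmetric] phi0_psi0 Phi0_axis) (simp only: sum_distrib_left mult.left_commute)
    finally show ?thesis .
  qed
  have 2: "(\<Sum>c\<in>UNIV. \<Sum>d\<in>UNIV. ?F x c d * ?F y c d) = 6 * (x \<bullet> y)"
  proof -
    have "(\<Sum>c\<in>UNIV. \<Sum>d\<in>UNIV. phi0 i c d * ?F y c d) = 6 * y $ i" for i
    proof -
      have "(\<Sum>c\<in>UNIV. \<Sum>d\<in>UNIV. phi0 i c d * ?F y c d) =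
          (\<Sum>c\<in>UNIV. \<Sum>d\<in>UNIV. \<Sum>j\<in>UNIV. y $ j * (phi0 i c d * phi0 j c d))"
        by (simp only: Phi0_axis sum_distrib_left mult.left_commute)
      also have "\<dots> = (\<Sum>j\<in>UNIV. \<Sum>c\<in>UNIV. \<Sum>d\<in>UNIV. y $ j * (phi0 i c d * phi0 j c d))"
        by (rule sum_rotate)
      also have "\<dots> = 6 * y $ i"
        by (simp only: sum_distrib_left [symmetric] phi0_phi0_trace) (simp add: if_distrib [where f = "\<lambda>x. _ * x"] cong: if_cong)
      finally show ?thesis .
    qed
    note i = this
    have "(\<Sum>c\<in>UNIV. \<Sum>d\<in>UNIV. ?F x c d * ?F y c d) =
        (\<Sum>c\<in>UNIV. \<Sum>d\<in>UNIV. \<Sum>i\<in>UNIV. x $ i * (phi0 i c d * ?F y c d))"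
      by (simp only: Phi0_axis [of x] sum_distrib_right mult.assoc)
    also have "\<dots> = (\<Sum>i\<in>UNIV. \<Sum>c\<in>UNIV. \<Sum>d\<in>UNIV. x $ i * (phi0 i c d * ?F y c d))"
      by (rule sum_rotate)
    also have "\<dots> = 6 * (x \<bullet> y)"
      by (simp only: sum_distrib_left [symmetric] i) (simp only: inner_vec_def inner_real_def sum_distrib_left mult.left_commute)
    finally show ?thesis .
  qed
  have "gram Phi0 x y = 6 * (\<Sum>a\<in>UNIV. \<Sum>b\<in>UNIV. \<Sum>c\<in>UNIV. \<Sum>d\<in>UNIV. (?F x a b * ?F y c d) * psi0 a b c d)"
    unfolding gram_def phi0_def [symmetric] by (rule altsum_phi0)
  also have "\<dots> = 6 * (\<Sum>c\<in>UNIV. \<Sum>d\<in>UNIV. \<Sum>a\<in>UNIV. \<Sum>b\<in>UNIV. (?F x a b * ?F y c d) * psi0 a b c d)"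
    by (rule arg_cong [OF sum_swap_pairs])
  also have "\<dots> = 6 * (\<Sum>c\<in>UNIV. \<Sum>d\<in>UNIV. ?F y c d * (\<Sum>a\<in>UNIV. \<Sum>b\<in>UNIV. ?F x a b * psi0 a b c d))"
    by (simp only: sum_distrib_left ac_simps)
  also have "\<dots> = 6 * (4 * (\<Sum>c\<in>UNIV. \<Sum>d\<in>UNIV. ?F x c d * ?F y c d))"
    unfolding 1 by (simp only: sum_distrib_left ac_simps)
  finally show ?thesis unfolding 2 by simp
qed

lemma gram_comp:
  assumes P: "trilinear P"
  shows "gram (\<lambda>x y z. P (L *v x) (L *v y) (L *v z)) x y = det L * gram P (L *v x) (L *v y)"
proof -
  let ?K = "\<lambda>a b c d e f g. P (L *v x) a b * P (L *v y) c d * P e f g"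
  have "multilinear (\<lambda>f :: 7 \<Rightarrow> real^7. ?K (f 1) (f 2) (f 3) (f 4) (f 5) (f 6) (f 7))"
    by (rule multilinear_7I; intro linear_scale_right linear_scale_left trilinear_linear [OF P])
  from altsum_linear_image [OF this, of L] show ?thesis
    unfolding gram_def by simp
qed

lemma gram_adapted:
  assumes "adapted_coframe p e"
  shows "gram (\<lambda>u v w. p [u, v, w]) x y = 144 * det e * ((e *v x) \<bullet> (e *v y))"
  unfolding adapted_coframe_Phi0 [OF assms] gram_comp [OF trilinear_Phi0] gram_Phi0 by simp

lemma det_scaleR: "det (c *\<^sub>R A) = c ^ CARD('n) * det A" for A :: "real^'n^'n"
  by (simp add: det_def prod.distrib sum_distrib_left ac_simps)

lemma matrix_inner_gram: "(A *v x) \<bullet> (A *v y) = x \<bullet> ((transpose A ** A) *v y)" for A :: "real^'n^'n"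
  by (metis dot_lmul_matrix inner_commute matrix_vector_mul_assoc transpose_matrix_vector vector_transpose_matrix)

lemma matrix_eq_inner:
  fixes A B :: "real^'n^'n"
  assumes "\<And>x y. x \<bullet> (A *v y) = x \<bullet> (B *v y)"
  shows "A = B"
  using assms by (metis matrix_eq vector_eq_ldot)

lemma adapted_coframe_unique:
  assumes e: "adapted_coframe p e" and e': "adapted_coframe p e'"
  shows "det e' = det e" "transpose e' ** e' = transpose e ** e"
proof -
  have *: "det e *\<^sub>R (transpose e ** e) = det e' *\<^sub>R (transpose e' ** e')"
  proof (rule matrix_eq_inner)
    fix x y
    have "144 * det e * ((e *v x) \<bullet> (e *v y)) = 144 * det e' * ((e' *v x) \<bullet> (e' *v y))"
      using gram_adapted [OF e] gram_adapted [OF e'] by metis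
    then show "x \<bullet> ((det e *\<^sub>R (transpose e ** e)) *v y) = x \<bullet> ((det e' *\<^sub>R (transpose e' ** e')) *v y)"
      by (simp add: matrix_inner_gram scaleR_matrix_vector_assoc [symmetric])
  qed
  have "det (det e *\<^sub>R (transpose e ** e)) = det (det e' *\<^sub>R (transpose e' ** e'))"
    using * by simp
  then have "det e ^ 9 = det e' ^ 9"
    by (simp add: det_scaleR det_mul det_transpose eval_nat_numeral ac_simps)
  then have "root 9 (det e ^ 9) = root 9 (det e' ^ 9)" by (rule arg_cong)
  moreover have "root 9 (x ^ 9) = x" for x
    by (rule odd_real_root_power_cancel) simp
  ultimately show d: "det e' = det e" by metis
  have "det e \<noteq> 0"
    using e by (simp add: adapted_coframe_def invertible_det_nz)
  then show "transpose e' ** e' = transpose e ** e"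
    using * d by simp
qed

lemma some_coframe_adapted: "adapted_coframe p e \<Longrightarrow> adapted_coframe p (some_coframe p)"
  unfolding some_coframe_def by (rule someI)

lemma G2_metric_eq:
  assumes "adapted_coframe (\<phi> x) e"
  shows "G2_metric \<phi> x = transpose e ** e"
  unfolding G2_metric_def
  by (rule adapted_coframe_unique(2) [OF assms some_coframe_adapted [OF assms]])

lemma metric_tensor_eq:
  assumes "adapted_coframe (\<phi> x) e"
  shows "metric_tensor (G2_metric \<phi>) x [u, v] = (e *v u) \<bullet> (e *v v)"
  by (simp add: metric_tensor_def G2_metric_eq [of \<phi>, OF assms] matrix_inner_gram)

lemma adapted_coframe_comp:
  assumes e: "adapted_coframe p e" and L: "invertible L"
    and q: "\<And>u v w. q [u, v, w] = p [L *v u, L *v v, L *v w]"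
  shows "adapted_coframe q (e ** L)"
  unfolding adapted_coframe_def
proof (intro conjI allI impI)
  show "invertible (e ** L)"
    using e L by (simp add: adapted_coframe_def invertible_mult)
next
  fix vs :: "(real^7) list" assume "length vs = 3"
  then obtain u v w where vs: "vs = [u, v, w]"
    by (auto simp: numeral_3_eq_3 length_Suc_conv)
  have "q vs = Phi0 (e *v (L *v u)) (e *v (L *v v)) (e *v (L *v w))"
    by (simp add: vs q adapted_coframe_Phi0 [OF e])
  then show "q vs = coframe_wedge (e ** L) [1, 2, 7] vs + coframe_wedge (e ** L) [1, 3, 5] vs
      - coframe_wedge (e ** L) [1, 4, 6] vs - coframe_wedge (e ** L) [2, 3, 6] vs
      - coframe_wedge (e ** L) [2, 4, 5] vs + coframe_wedge (e ** L) [3, 4, 7] vs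
      + coframe_wedge (e ** L) [5, 6, 7] vs"
    by (simp add: vs coframe_wedge_3 Phi0_def matrix_vector_mul_assoc del: coframe_wedge.simps)
qed

section \<open>Calculus\<close>

lemma second_difference_estimate:
  fixes f :: "'a::real_normed_vector \<Rightarrow> real"
  assumes S: "open S" "x \<in> S"
    and f: "\<And>y. y \<in> S \<Longrightarrow> f differentiable (at y)"
    and fu: "(\<lambda>y. dir_deriv f y u) differentiable (at x)"
    and \<epsilon>: "\<epsilon> > 0"
  shows "\<exists>\<delta>>0. \<forall>h. 0 < h \<and> h < \<delta> \<longrightarrow>
    \<bar>f (x + h *\<^sub>R u + h *\<^sub>R v) - f (x + h *\<^sub>R u) - f (x + h *\<^sub>R v) + f x
      - h\<^sup>2 * dir_deriv (\<lambda>y. dir_deriv f y u) x v\<bar> \<le> \<epsilon> * h\<^sup>2"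
proof -
  define F where "F y = dir_deriv f y u" for y
  define D where "D = frechet_derivative F (at x)"
  define K where "K = norm u + norm v + 1"
  have K: "K > 0" by (simp add: K_def add_nonneg_pos)
  have FD: "(F has_derivative D) (at x)"
    using fu unfolding F_def D_def by (simp add: frechet_derivative_works)
  interpret D: bounded_linear D using FD by (rule has_derivative_bounded_linear)
  have "\<epsilon> / (2 * K) > 0" using \<epsilon> K by simp
  then obtain d where d: "d > 0"
      "\<And>y. norm (y - x) < d \<Longrightarrow> norm (F y - F x - D (y - x)) \<le> \<epsilon> / (2 * K) * norm (y - x)"
    using FD unfolding has_derivative_at_alt by blast
  obtain r where r: "r > 0" "ball x r \<subseteq> S"
    using S open_contains_ball by blast
  define \<delta> where "\<delta> = min d r / K"
  have \<delta>: "\<delta> > 0" using d(1) r(1) K by (simp add: \<delta>_def)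
  have "\<bar>f (x + h *\<^sub>R u + h *\<^sub>R v) - f (x + h *\<^sub>R u) - f (x + h *\<^sub>R v) + f x - h\<^sup>2 * D v\<bar> \<le> \<epsilon> * h\<^sup>2"
    if h: "0 < h" "h < \<delta>" for h
  proof -
    have hK: "h * K < min d r" using h K by (simp add: \<delta>_def field_simps)
    have n: "norm (t *\<^sub>R (h *\<^sub>R u) + s *\<^sub>R (h *\<^sub>R v)) \<le> h * K" if "0 \<le> t" "t \<le> 1" "0 \<le> s" "s \<le> 1" for t s
    proof -
      have "norm (t *\<^sub>R (h *\<^sub>R u) + s *\<^sub>R (h *\<^sub>R v)) \<le> t * (h * norm u) + s * (h * norm v)"
        using norm_triangle_ineq [of "t *\<^sub>R (h *\<^sub>R u)" "s *\<^sub>R (h *\<^sub>R v)"] that h by simp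
      also have "\<dots> \<le> 1 * (h * norm u) + 1 * (h * norm v)"
        using that h by (intro add_mono mult_right_mono) auto
      also have "\<dots> \<le> h * K" using h by (simp add: K_def algebra_simps)
      finally show ?thesis .
    qed
    have inS: "x + t *\<^sub>R (h *\<^sub>R u) + s *\<^sub>R (h *\<^sub>R v) \<in> S" if "0 \<le> t" "t \<le> 1" "0 \<le> s" "s \<le> 1" for t s
    proof -
      have "dist x (x + t *\<^sub>R (h *\<^sub>R u) + s *\<^sub>R (h *\<^sub>R v)) = norm (t *\<^sub>R (h *\<^sub>R u) + s *\<^sub>R (h *\<^sub>R v))"
        by (simp add: dist_norm norm_minus_commute ac_simps)
      then show ?thesis using n [OF that] hK r(2) by (auto simp: subset_eq)
    qed
    define g where "g t = f (x + t *\<^sub>R (h *\<^sub>R u) + 1 *\<^sub>R (h *\<^sub>R v)) - f (x + t *\<^sub>R (h *\<^sub>R u) + 0 *\<^sub>R (h *\<^sub>R v))" for t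
    define g' where "g' t = h * (F (x + t *\<^sub>R (h *\<^sub>R u) + 1 *\<^sub>R (h *\<^sub>R v)) - F (x + t *\<^sub>R (h *\<^sub>R u) + 0 *\<^sub>R (h *\<^sub>R v)))" for t
    have der: "((\<lambda>t. f (x + t *\<^sub>R (h *\<^sub>R u) + s *\<^sub>R (h *\<^sub>R v))) has_real_derivative h * F (x + t *\<^sub>R (h *\<^sub>R u) + s *\<^sub>R (h *\<^sub>R v))) (at t)"
      if ts: "0 \<le> t" "t \<le> 1" "0 \<le> s" "s \<le> 1" for t s
    proof -
      let ?y = "x + t *\<^sub>R (h *\<^sub>R u) + s *\<^sub>R (h *\<^sub>R v)"
      have fd: "(f has_derivative frechet_derivative f (at ?y)) (at ?y)"
        using f [OF inS [OF ts]] by (simp add: frechet_derivative_works)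
      interpret f': bounded_linear "frechet_derivative f (at ?y)" using fd by (rule has_derivative_bounded_linear)
      have "((\<lambda>t. x + t *\<^sub>R (h *\<^sub>R u) + s *\<^sub>R (h *\<^sub>R v)) has_derivative (\<lambda>k. k *\<^sub>R (h *\<^sub>R u))) (at t)"
        by (auto intro!: derivative_eq_intros)
      from has_derivative_compose [OF this fd]
      have "((\<lambda>t. f (x + t *\<^sub>R (h *\<^sub>R u) + s *\<^sub>R (h *\<^sub>R v))) has_derivative
          (\<lambda>k. frechet_derivative f (at ?y) (k *\<^sub>R (h *\<^sub>R u)))) (at t)" .
      moreover have "(\<lambda>k. frechet_derivative f (at ?y) (k *\<^sub>R (h *\<^sub>R u))) = (*) (h * F ?y)"
        by (rule ext) (simp only: f'.scaleR F_def real_scaleR_def; algebra)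
      ultimately show ?thesis
        unfolding has_field_derivative_def by (simp only:)
    qed
    have "(g has_real_derivative g' t) (at t)" if "0 \<le> t" "t \<le> 1" for t
      unfolding g_def [abs_def] g'_def right_diff_distrib
      by (intro DERIV_diff der that) auto
    then obtain t where t: "0 < t" "t < 1" "g 1 - g 0 = (1 - 0) * g' t"
      using MVT2 [of 0 1 g g'] by auto
    define r where "r y = F y - F x - D (y - x)" for y
    let ?y1 = "x + t *\<^sub>R (h *\<^sub>R u) + 1 *\<^sub>R (h *\<^sub>R v)" and ?y0 = "x + t *\<^sub>R (h *\<^sub>R u) + 0 *\<^sub>R (h *\<^sub>R v)"
    have rb: "\<bar>r (x + t *\<^sub>R (h *\<^sub>R u) + s *\<^sub>R (h *\<^sub>R v))\<bar> \<le> \<epsilon> / 2 * h" if s: "0 \<le> s" "s \<le> 1" for s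
    proof -
      let ?y = "x + t *\<^sub>R (h *\<^sub>R u) + s *\<^sub>R (h *\<^sub>R v)"
      have y: "norm (?y - x) \<le> h * K" using n [of t s] t s by (simp add: ac_simps)
      have "\<bar>r ?y\<bar> \<le> \<epsilon> / (2 * K) * norm (?y - x)"
        using d(2) [of ?y] y hK by (simp add: r_def)
      also have "\<dots> \<le> \<epsilon> / (2 * K) * (h * K)"
        using y \<epsilon> K by (intro mult_left_mono) auto
      also have "\<dots> = \<epsilon> / 2 * h" using K by simp
      finally show ?thesis .
    qed
    have e: "F ?y1 - F ?y0 = h * D v + r ?y1 - r ?y0"
      by (simp add: r_def D.diff D.add D.scaleR)
    have "g 1 - g 0 = h * (F ?y1 - F ?y0)"
      using t(3) by (simp only: g'_def diff_zero mult_1)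
    then have "g 1 - g 0 - h\<^sup>2 * D v = h * (r ?y1 - r ?y0)"
      unfolding e power2_eq_square by algebra
    then have "\<bar>g 1 - g 0 - h\<^sup>2 * D v\<bar> = h * \<bar>r ?y1 - r ?y0\<bar>"
      using h by (simp add: abs_mult)
    also have "\<dots> \<le> h * (\<epsilon> / 2 * h + \<epsilon> / 2 * h)"
      using rb [of 1] rb [of 0] h by (intro mult_left_mono) auto
    also have "\<dots> = \<epsilon> * h\<^sup>2" by (simp add: power2_eq_square)
    finally show ?thesis by (simp add: g_def algebra_simps)
  qed
  then show ?thesis using \<delta> unfolding D_def F_def by blast
qed

lemma dir_deriv_commute:
  fixes f :: "'a::real_normed_vector \<Rightarrow> real"
  assumes S: "open S" "x \<in> S"
    and f: "\<And>y. y \<in> S \<Longrightarrow> f differentiable (at y)"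
    and fu: "(\<lambda>y. dir_deriv f y u) differentiable (at x)"
    and fv: "(\<lambda>y. dir_deriv f y v) differentiable (at x)"
  shows "dir_deriv (\<lambda>y. dir_deriv f y u) x v = dir_deriv (\<lambda>y. dir_deriv f y v) x u" (is "?A = ?B")
proof -
  have "\<bar>?A - ?B\<bar> \<le> 0 + e" if "e > 0" for e
  proof -
    let ?\<Delta> = "\<lambda>h. f (x + h *\<^sub>R u + h *\<^sub>R v) - f (x + h *\<^sub>R u) - f (x + h *\<^sub>R v) + f x"
    have e: "e / 2 > 0" using that by simp
    obtain d1 where d1: "d1 > 0" "\<And>h. 0 < h \<Longrightarrow> h < d1 \<Longrightarrow> \<bar>?\<Delta> h - h\<^sup>2 * ?A\<bar> \<le> e / 2 * h\<^sup>2"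
      using second_difference_estimate [OF S f fu e, of v] by blast
    obtain d2 where d2: "d2 > 0" "\<And>h. 0 < h \<Longrightarrow> h < d2 \<Longrightarrow>
        \<bar>f (x + h *\<^sub>R v + h *\<^sub>R u) - f (x + h *\<^sub>R v) - f (x + h *\<^sub>R u) + f x - h\<^sup>2 * ?B\<bar> \<le> e / 2 * h\<^sup>2"
      using second_difference_estimate [OF S f fv e, of u] by blast
    define h where "h = min d1 d2 / 2"
    have h: "h > 0" "h < d1" "h < d2" using d1(1) d2(1) by (auto simp: h_def)
    have sw: "x + h *\<^sub>R v + h *\<^sub>R u = x + h *\<^sub>R u + h *\<^sub>R v" by (simp add: ac_simps)
    have "\<bar>h\<^sup>2 * ?A - h\<^sup>2 * ?B\<bar> \<le> e * h\<^sup>2"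
      using d1(2) [OF h(1,2)] d2(2) [OF h(1,3)] unfolding sw abs_le_iff by linarith
    then have "h\<^sup>2 * \<bar>?A - ?B\<bar> \<le> h\<^sup>2 * e"
      by (simp add: abs_mult right_diff_distrib [symmetric] mult.commute)
    then show ?thesis using h(1) by simp
  qed
  then have "\<bar>?A - ?B\<bar> \<le> 0" by (rule field_le_epsilon)
  then show ?thesis by simp
qed

lemma has_derivative_dir:
  "f differentiable (at x) \<Longrightarrow> (f has_derivative (\<lambda>h. dir_deriv f x h)) (at x)"
  by (simp add: frechet_derivative_works)

lemma dir_deriv_eq: "(f has_derivative f') (at x) \<Longrightarrow> dir_deriv f x v = f' v"
  by (metis frechet_derivative_at)

lemma linear_dir_deriv: "f differentiable (at x) \<Longrightarrow> linear (\<lambda>v. dir_deriv f x v)"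
  by (simp add: linear_frechet_derivative)

lemma linear_vec_expansion:
  fixes f :: "real^'n \<Rightarrow> 'c::real_vector"
  assumes "linear f"
  shows "f x = (\<Sum>i\<in>UNIV. x $ i *\<^sub>R f (axis i 1))"
  by (subst axis_expansion [of x]) (simp add: linear_sum [OF assms] linear_cmul [OF assms])

lemma has_derivative_linear_family:
  fixes L :: "'a::real_normed_vector \<Rightarrow> real^'n \<Rightarrow> 'c::real_normed_vector"
  assumes S: "open S" "x \<in> S" and lin: "\<And>y. y \<in> S \<Longrightarrow> linear (L y)"
    and L: "\<And>v. (\<lambda>y. L y v) differentiable (at x)"
    and X: "(X has_derivative X') (at x)"
  shows "((\<lambda>y. L y (X y)) has_derivative (\<lambda>h. dir_deriv (\<lambda>y. L y (X x)) x h + L x (X' h))) (at x)"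
proof -
  have D: "((\<lambda>y. L y (Y y)) has_derivative (\<lambda>h. (\<Sum>i\<in>UNIV. Y x $ i *\<^sub>R dir_deriv (\<lambda>y. L y (axis i 1)) x h) + L x (Y' h))) (at x)"
    if Y: "(Y has_derivative Y') (at x)" for Y Y'
  proof -
    have Yi: "((\<lambda>y. Y y $ i) has_derivative (\<lambda>h. Y' h $ i)) (at x)" for i
      using Y by (rule bounded_linear.has_derivative [OF bounded_linear_vec_nth])
    have "((\<lambda>y. \<Sum>i\<in>UNIV. Y y $ i *\<^sub>R L y (axis i 1)) has_derivative
        (\<lambda>h. \<Sum>i\<in>UNIV. Y x $ i *\<^sub>R dir_deriv (\<lambda>y. L y (axis i 1)) x h + Y' h $ i *\<^sub>R L x (axis i 1))) (at x)"
      by (intro has_derivative_sum has_derivative_scaleR Yi has_derivative_dir L)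
    also have "(\<lambda>h. \<Sum>i\<in>UNIV. Y x $ i *\<^sub>R dir_deriv (\<lambda>y. L y (axis i 1)) x h + Y' h $ i *\<^sub>R L x (axis i 1)) =
        (\<lambda>h. (\<Sum>i\<in>UNIV. Y x $ i *\<^sub>R dir_deriv (\<lambda>y. L y (axis i 1)) x h) + L x (Y' h))"
      by (rule ext) (simp only: sum.distrib linear_vec_expansion [OF lin [OF S(2)], where x = "Y' _"])
    finally show ?thesis
    proof (rule has_derivative_transform_within_open [OF _ S])
      fix y assume "y \<in> S"
      then show "(\<Sum>i\<in>UNIV. Y y $ i *\<^sub>R L y (axis i 1)) = L y (Y y)"
        using linear_vec_expansion [OF lin, of y "Y y"] by simp
    qed
  qed
  have "((\<lambda>y. L y (X x)) has_derivative (\<lambda>h. (\<Sum>i\<in>UNIV. X x $ i *\<^sub>R dir_deriv (\<lambda>y. L y (axis i 1)) x h) + L x 0)) (at x)"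
    using D [of "\<lambda>_. X x" "\<lambda>_. 0"] by simp
  then have "dir_deriv (\<lambda>y. L y (X x)) x h = (\<Sum>i\<in>UNIV. X x $ i *\<^sub>R dir_deriv (\<lambda>y. L y (axis i 1)) x h)" for h
    using lin [OF S(2)] by (simp add: dir_deriv_eq linear_0)
  then show ?thesis using D [OF X] by simp
qed

lemma dir_deriv_linear_family:
  fixes L :: "'a::real_normed_vector \<Rightarrow> real^'n \<Rightarrow> 'c::real_normed_vector"
  assumes S: "open S" "x \<in> S" and lin: "\<And>y. y \<in> S \<Longrightarrow> linear (L y)"
    and L: "\<And>v. (\<lambda>y. L y v) differentiable (at x)"
    and X: "X differentiable (at x)"
  shows "(\<lambda>y. L y (X y)) differentiable (at x)"
    "dir_deriv (\<lambda>y. L y (X y)) x h = dir_deriv (\<lambda>y. L y (X x)) x h + L x (dir_deriv X x h)"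
  using has_derivative_linear_family [OF S lin L has_derivative_dir [OF X]]
  by (auto simp: differentiable_def dir_deriv_eq)

lemma linear_dir_deriv_family:
  fixes L :: "'a::real_normed_vector \<Rightarrow> 'b::real_normed_vector \<Rightarrow> 'c::real_normed_vector"
  assumes S: "open S" "x \<in> S" and lin: "\<And>y. y \<in> S \<Longrightarrow> linear (L y)"
    and L: "\<And>v. (\<lambda>y. L y v) differentiable (at x)"
  shows "linear (\<lambda>v. dir_deriv (\<lambda>y. L y v) x h)"
proof (rule linearI)
  fix v w and c :: real
  have "((\<lambda>y. L y v + L y w) has_derivative (\<lambda>h. dir_deriv (\<lambda>y. L y v) x h + dir_deriv (\<lambda>y. L y w) x h)) (at x)"
    by (intro has_derivative_add has_derivative_dir L)
  then have "((\<lambda>y. L y (v + w)) has_derivative (\<lambda>h. dir_deriv (\<lambda>y. L y v) x h + dir_deriv (\<lambda>y. L y w) x h)) (at x)"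
    by (rule has_derivative_transform_within_open [OF _ S]) (simp add: linear_add lin)
  then show "dir_deriv (\<lambda>y. L y (v + w)) x h = dir_deriv (\<lambda>y. L y v) x h + dir_deriv (\<lambda>y. L y w) x h"
    by (rule dir_deriv_eq)
  have "((\<lambda>y. c *\<^sub>R L y v) has_derivative (\<lambda>h. c *\<^sub>R dir_deriv (\<lambda>y. L y v) x h)) (at x)"
    by (intro has_derivative_scaleR_right has_derivative_dir L)
  then have "((\<lambda>y. L y (c *\<^sub>R v)) has_derivative (\<lambda>h. c *\<^sub>R dir_deriv (\<lambda>y. L y v) x h)) (at x)"
    by (rule has_derivative_transform_within_open [OF _ S]) (simp add: linear_cmul lin)
  then show "dir_deriv (\<lambda>y. L y (c *\<^sub>R v)) x h = c *\<^sub>R dir_deriv (\<lambda>y. L y v) x h"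
    by (rule dir_deriv_eq)
qed

lemma dir_deriv_cong:
  assumes "open S" "x \<in> S" "\<And>y. y \<in> S \<Longrightarrow> f y = g y"
  shows "frechet_derivative f (at x) = frechet_derivative g (at x)" "f differentiable (at x) \<longleftrightarrow> g differentiable (at x)"
proof -
  have "(f has_derivative f') (at x) \<longleftrightarrow> (g has_derivative f') (at x)" for f'
    using has_derivative_transform_within_open [OF _ assms(1,2)] assms(3) by metis
  then show "frechet_derivative f (at x) = frechet_derivative g (at x)" "f differentiable (at x) \<longleftrightarrow> g differentiable (at x)"
    by (simp_all add: frechet_derivative_def differentiable_def)
qed

section \<open>Local geometry of a connection with skew torsion\<close>

definition tors ::
  "(real^7 \<Rightarrow> real^7 \<Rightarrow> real^7 \<Rightarrow> real) \<Rightarrow> 7 christoffel \<Rightarrow> real^7 \<Rightarrow> real^7 \<Rightarrow> real^7 \<Rightarrow> real^7 \<Rightarrow> real" where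
  "tors g G x u v w = g x (G x u v - G x v u) w"

definition curv :: "7 christoffel \<Rightarrow> real^7 \<Rightarrow> real^7 \<Rightarrow> real^7 \<Rightarrow> real^7 \<Rightarrow> real^7" where
  "curv G x u v w = dir_deriv (\<lambda>y. G y v w) x u + G x u (G x v w)
     - dir_deriv (\<lambda>y. G y u w) x v - G x v (G x u w)"

definition sym_part :: "7 christoffel \<Rightarrow> 7 christoffel" where
  "sym_part G x u v = (1/2) *\<^sub>R (G x u v + G x v u)"

locale skew_torsion =
  fixes S :: "(real^7) set"
    and g :: "real^7 \<Rightarrow> real^7 \<Rightarrow> real^7 \<Rightarrow> real"
    and P :: "real^7 \<Rightarrow> real^7 \<Rightarrow> real^7 \<Rightarrow> real^7 \<Rightarrow> real"
    and G :: "7 christoffel"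
  assumes open_S: "open S"
    and coframe: "x \<in> S \<Longrightarrow> \<exists>e. invertible e \<and> (\<forall>u v. g x u v = (e *v u) \<bullet> (e *v v)) \<and>
          (\<forall>u v w. P x u v w = Phi0 (e *v u) (e *v v) (e *v w))"
    and g_diff: "x \<in> S \<Longrightarrow> (\<lambda>y. g y u v) differentiable (at x)"
    and P_diff: "x \<in> S \<Longrightarrow> (\<lambda>y. P y u v w) differentiable (at x)"
    and G_bilinear: "x \<in> S \<Longrightarrow> bilinear (G x)"
    and G_diff: "x \<in> S \<Longrightarrow> (\<lambda>y. G y u v) differentiable (at x)"
    and nabla_g: "x \<in> S \<Longrightarrow> dir_deriv (\<lambda>y. g y v w) x u = g x (G x u v) w + g x v (G x u w)"
    and nabla_P: "x \<in> S \<Longrightarrow> dir_deriv (\<lambda>y. P y a b c) x u =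
          P x (G x u a) b c + P x a (G x u b) c + P x a b (G x u c)"
    and tors_null: "x \<in> S \<Longrightarrow> tors g G x u v v = 0"
    and tors_closed: "x \<in> S \<Longrightarrow> dir_deriv (\<lambda>y. tors g G y b c d) x a - dir_deriv (\<lambda>y. tors g G y a c d) x b
          + dir_deriv (\<lambda>y. tors g G y a b d) x c - dir_deriv (\<lambda>y. tors g G y a b c) x d = 0"
begin

abbreviation T :: "real^7 \<Rightarrow> real^7 \<Rightarrow> real^7 \<Rightarrow> real^7 \<Rightarrow> real" where
  "T \<equiv> tors g G"

lemma G_linear: "x \<in> S \<Longrightarrow> linear (\<lambda>u. G x u v)" "x \<in> S \<Longrightarrow> linear (\<lambda>v. G x u v)"
  using G_bilinear by (auto simp: bilinear_def)

lemma linear_mv: "linear (\<lambda>v. A *v v)" for A :: "real^'n^'m"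
  by (rule matrix_vector_mul_linear)

lemma g_linear: "x \<in> S \<Longrightarrow> linear (\<lambda>u. g x u v)" "x \<in> S \<Longrightarrow> linear (\<lambda>v. g x u v)"
  using coframe [of x]
  by (auto simp: linear_iff inner_add_left inner_add_right matrix_vector_right_distrib matrix_vector_mult_scaleR)

lemma g_sym: "x \<in> S \<Longrightarrow> g x u v = g x v u"
  using coframe [of x] by (metis inner_commute)

lemma P_trilinear:
  assumes "x \<in> S"
  shows "trilinear (P x)"
proof -
  obtain e where "\<forall>u v w. P x u v w = Phi0 (e *v u) (e *v v) (e *v w)"
    using coframe [OF assms] by blast
  then have "P x = (\<lambda>u v w. Phi0 (e *v u) (e *v v) (e *v w))"
    by (intro ext) simp
  then show ?thesis
    using trilinear_comp [OF trilinear_Phi0 linear_mv] by simp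
qed

lemma P_skew: "x \<in> S \<Longrightarrow> P x v u w = - P x u v w" "x \<in> S \<Longrightarrow> P x u w v = - P x u v w"
  using coframe [of x] Phi0_skew by metis+

lemmas G_simps = linear_add [OF G_linear(1)] linear_add [OF G_linear(2)] linear_diff [OF G_linear(1)] linear_diff [OF G_linear(2)]
  linear_cmul [OF G_linear(1)] linear_cmul [OF G_linear(2)] linear_neg [OF G_linear(1)] linear_neg [OF G_linear(2)]

lemmas g_simps = linear_add [OF g_linear(1)] linear_add [OF g_linear(2)] linear_diff [OF g_linear(1)] linear_diff [OF g_linear(2)]
  linear_cmul [OF g_linear(1)] linear_cmul [OF g_linear(2)] linear_neg [OF g_linear(1)] linear_neg [OF g_linear(2)]

lemma T_linear:
  assumes "x \<in> S"
  shows "linear (\<lambda>u. T x u v w)" "linear (\<lambda>v. T x u v w)" "linear (\<lambda>w. T x u v w)"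
  using assms by (auto simp: linear_iff tors_def G_simps g_simps algebra_simps)

lemma T_skew:
  assumes x: "x \<in> S"
  shows "T x v u w = - T x u v w" "T x u w v = - T x u v w"
proof -
  show "T x v u w = - T x u v w"
    using x by (simp add: tors_def g_simps)
  have "T x u (v + w) (v + w) = 0" "T x u v v = 0" "T x u w w = 0"
    using tors_null [OF x] by auto
  then show "T x u w v = - T x u v w"
    by (simp add: linear_add [OF T_linear(2) [OF x]] linear_add [OF T_linear(3) [OF x]])
qed

lemma T_cyclic: "x \<in> S \<Longrightarrow> T x v w u = T x u v w"
  using T_skew(2) [of x v u w] T_skew(1) [of x v u w] by simp

lemma T_diff: "x \<in> S \<Longrightarrow> (\<lambda>y. T y u v w) differentiable (at x)"
  unfolding tors_def
  by (rule dir_deriv_linear_family(1) [OF open_S, where L = "\<lambda>y v. g y v w"])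
    (auto intro: g_linear g_diff G_diff differentiable_diff)

lemma dir_deriv_g:
  assumes x: "x \<in> S" and X: "X differentiable (at x)"
  shows "(\<lambda>y. g y (X y) w) differentiable (at x)"
    "dir_deriv (\<lambda>y. g y (X y) w) x u = g x (G x u (X x) + dir_deriv X x u) w + g x (X x) (G x u w)"
  using dir_deriv_linear_family(1) [OF open_S x, where L = "\<lambda>y v. g y v w" and X = X]
    dir_deriv_linear_family(2) [OF open_S x, where L = "\<lambda>y v. g y v w" and X = X and h = u]
  by (simp_all add: X x g_linear g_diff nabla_g g_simps)

lemma dir_deriv_P:
  assumes x: "x \<in> S" and X: "X differentiable (at x)"
  shows "(\<lambda>y. P y (X y) b c) differentiable (at x)"
    "dir_deriv (\<lambda>y. P y (X y) b c) x u =
       P x (G x u (X x) + dir_deriv X x u) b c + P x (X x) (G x u b) c + P x (X x) b (G x u c)"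
  using dir_deriv_linear_family(1) [OF open_S x, where L = "\<lambda>y v. P y v b c" and X = X]
    dir_deriv_linear_family(2) [OF open_S x, where L = "\<lambda>y v. P y v b c" and X = X and h = u]
  by (simp_all add: X x trilinear_linear [OF P_trilinear] P_diff nabla_P linear_add [OF trilinear_linear(1) [OF P_trilinear]])

lemma curv_skew:
  assumes x: "x \<in> S"
  shows "g x (curv G x u v w) z + g x w (curv G x u v z) = 0"
proof -
  have D: "dir_deriv (\<lambda>y. g y w z) y v = g y (G y v w) z + g y (G y v z) w" if "y \<in> S" for y v
    using that by (simp add: nabla_g g_sym)
  have d: "(\<lambda>y. g y (G y v w) z + g y (G y v z) w) differentiable (at x)" for v
    by (intro differentiable_add dir_deriv_g x G_diff)
  have d': "(\<lambda>y. dir_deriv (\<lambda>y. g y w z) y v) differentiable (at x)" for v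
    using dir_deriv_cong(2) [OF open_S x D [of _ v]] d by simp
  have DD: "dir_deriv (\<lambda>y. dir_deriv (\<lambda>y. g y w z) y v) x u =
      g x (G x u (G x v w) + dir_deriv (\<lambda>y. G y v w) x u) z + g x (G x v w) (G x u z) +
      (g x (G x u (G x v z) + dir_deriv (\<lambda>y. G y v z) x u) w + g x (G x v z) (G x u w))" for u v
  proof -
    have "dir_deriv (\<lambda>y. dir_deriv (\<lambda>y. g y w z) y v) x u = dir_deriv (\<lambda>y. g y (G y v w) z + g y (G y v z) w) x u"
      using dir_deriv_cong(1) [OF open_S x D [of _ v]] by simp
    also have "\<dots> = dir_deriv (\<lambda>y. g y (G y v w) z) x u + dir_deriv (\<lambda>y. g y (G y v z) w) x u"
      by (rule dir_deriv_eq) (intro has_derivative_add has_derivative_dir dir_deriv_g x G_diff)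
    finally show ?thesis
      by (simp add: dir_deriv_g(2) [OF x G_diff [OF x]])
  qed
  have "dir_deriv (\<lambda>y. dir_deriv (\<lambda>y. g y w z) y v) x u = dir_deriv (\<lambda>y. dir_deriv (\<lambda>y. g y w z) y u) x v"
    by (rule dir_deriv_commute [OF open_S x]) (simp_all add: d' g_diff)
  then show ?thesis
    unfolding DD curv_def g_sym [OF x, of w] by (simp add: g_simps x g_sym [of x "G x u w" "G x v z"] g_sym [of x "G x v w" "G x u z"])
qed

lemma curv_P:
  assumes x: "x \<in> S"
  shows "P x (curv G x u v a) b c + P x a (curv G x u v b) c + P x a b (curv G x u v c) = 0"
proof -
  note lin = trilinear_linear [OF P_trilinear]
  have cyc: "P y a b c = P y b c a" if "y \<in> S" for y a b c
    using that P_skew by metis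
  have D: "dir_deriv (\<lambda>y. P y a b c) y v = P y (G y v a) b c + P y (G y v b) c a + P y (G y v c) a b" if "y \<in> S" for y v
    using that by (simp add: nabla_P cyc [of y a] cyc [of y _ a b])
  have d: "(\<lambda>y. P y (G y v a) b c + P y (G y v b) c a + P y (G y v c) a b) differentiable (at x)" for v
    by (intro differentiable_add dir_deriv_P x G_diff)
  have d': "(\<lambda>y. dir_deriv (\<lambda>y. P y a b c) y v) differentiable (at x)" for v
    using dir_deriv_cong(2) [OF open_S x D [of _ v]] d by simp
  have DD: "dir_deriv (\<lambda>y. dir_deriv (\<lambda>y. P y a b c) y v) x u =
      P x (G x u (G x v a) + dir_deriv (\<lambda>y. G y v a) x u) b c + P x (G x v a) (G x u b) c + P x (G x v a) b (G x u c) +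
      (P x (G x u (G x v b) + dir_deriv (\<lambda>y. G y v b) x u) c a + P x (G x v b) (G x u c) a + P x (G x v b) c (G x u a)) +
      (P x (G x u (G x v c) + dir_deriv (\<lambda>y. G y v c) x u) a b + P x (G x v c) (G x u a) b + P x (G x v c) a (G x u b))" for u v
  proof -
    have "dir_deriv (\<lambda>y. dir_deriv (\<lambda>y. P y a b c) y v) x u =
        dir_deriv (\<lambda>y. P y (G y v a) b c + P y (G y v b) c a + P y (G y v c) a b) x u"
      using dir_deriv_cong(1) [OF open_S x D [of _ v]] by simp
    also have "\<dots> = dir_deriv (\<lambda>y. P y (G y v a) b c) x u + dir_deriv (\<lambda>y. P y (G y v b) c a) x u
        + dir_deriv (\<lambda>y. P y (G y v c) a b) x u"
      by (rule dir_deriv_eq) (intro has_derivative_add has_derivative_dir dir_deriv_P x G_diff)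
    finally show ?thesis
      by (simp only: dir_deriv_P(2) [OF x G_diff [OF x]])
  qed
  have comm: "dir_deriv (\<lambda>y. dir_deriv (\<lambda>y. P y a b c) y v) x u = dir_deriv (\<lambda>y. dir_deriv (\<lambda>y. P y a b c) y u) x v"
    by (rule dir_deriv_commute [OF open_S x]) (simp_all add: d' P_diff)
  have cross: "P x (G x v a) (G x u b) c = P x (G x u b) c (G x v a)"
     "P x (G x u a) (G x v b) c = P x (G x v b) c (G x u a)"
     "P x (G x v a) b (G x u c) = P x (G x u c) (G x v a) b"
     "P x (G x u a) b (G x v c) = P x (G x v c) (G x u a) b"
     "P x (G x v b) (G x u c) a = P x (G x u c) a (G x v b)"
     "P x (G x u b) (G x v c) a = P x (G x v c) a (G x u b)"
    using cyc [OF x] by metis+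
  have "P x (curv G x u v a) b c + P x (curv G x u v b) c a + P x (curv G x u v c) a b = 0"
    using comm unfolding DD curv_def
    by (simp only: linear_add [OF lin(1) [OF x]] linear_diff [OF lin(1) [OF x]] cross)
  then show ?thesis
    using cyc [OF x, of a "curv G x u v b" c] cyc [OF x, of a b "curv G x u v c"] cyc [OF x, of b "curv G x u v c" a] by simp
qed

end

definition psi_contract :: "(7 \<Rightarrow> 7 \<Rightarrow> 7 \<Rightarrow> 7 \<Rightarrow> real) \<Rightarrow> real" where
  "psi_contract F = (\<Sum>a\<in>UNIV. \<Sum>b\<in>UNIV. \<Sum>c\<in>UNIV. \<Sum>d\<in>UNIV. F a b c d * psi0 a b c d)"

lemma psi_contract_swap:
  "psi_contract (\<lambda>a b c d. F b a c d) = - psi_contract F"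
  "psi_contract (\<lambda>a b c d. F a c b d) = - psi_contract F"
  "psi_contract (\<lambda>a b c d. F a b d c) = - psi_contract F"
proof -
  have 1: "F b a c d * psi0 a b c d = - (F b a c d * psi0 b a c d)" for a b c d
    by (simp add: psi0_skew(1) [of a b])
  have 2: "F a c b d * psi0 a b c d = - (F a c b d * psi0 a c b d)" for a b c d
    by (simp add: psi0_middle [of a b c])
  have 3: "F a b d c * psi0 a b c d = - (F a b d c * psi0 a b d c)" for a b c d
    by (simp add: psi0_skew(2) [of a b c])
  show "psi_contract (\<lambda>a b c d. F b a c d) = - psi_contract F"
    unfolding psi_contract_def 1 sum_negf by (rule arg_cong [OF sum.swap])
  show "psi_contract (\<lambda>a b c d. F a c b d) = - psi_contract F"
    unfolding psi_contract_def 2 sum_negf by (rule arg_cong [OF sum.cong [OF refl sum.swap]])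
  show "psi_contract (\<lambda>a b c d. F a b d c) = - psi_contract F"
    unfolding psi_contract_def 3 sum_negf by (rule arg_cong [OF sum.cong [OF refl sum.cong [OF refl sum.swap]]])
qed

lemma psi_contract_cycle:
  "psi_contract (\<lambda>a b c d. F b c a d) = psi_contract F"
  "psi_contract (\<lambda>a b c d. F c a b d) = psi_contract F"
  "psi_contract (\<lambda>a b c d. F d a b c) = - psi_contract F"
proof -
  show 1: "psi_contract (\<lambda>a b c d. F b c a d) = psi_contract F" for F
    using psi_contract_swap(2) [of "\<lambda>a b c d. F b a c d"] psi_contract_swap(1) [of F]
      psi_contract_swap(1) [of "\<lambda>a b c d. F a c b d"] psi_contract_swap(2) [of F] by simp
  show 2: "psi_contract (\<lambda>a b c d. F c a b d) = psi_contract F" for F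
    using 1 [of "\<lambda>a b c d. F c a b d"] by simp
  show "psi_contract (\<lambda>a b c d. F d a b c) = - psi_contract F"
    using psi_contract_swap(3) [of "\<lambda>a b c d. F c a b d"] 2 [of F] by simp
qed

lemma psi_contract_add: "psi_contract (\<lambda>a b c d. F a b c d + H a b c d) = psi_contract F + psi_contract H"
  by (simp only: psi_contract_def distrib_right sum.distrib)

lemma psi_contract_diff: "psi_contract (\<lambda>a b c d. F a b c d - H a b c d) = psi_contract F - psi_contract H"
  by (simp only: psi_contract_def left_diff_distrib sum_subtractf)

context skew_torsion
begin

lemma dir_deriv_T:
  assumes x: "x \<in> S"
  shows "dir_deriv (\<lambda>y. T y v w z) x u =
    g x (G x u (G x v w - G x w v) + (dir_deriv (\<lambda>y. G y v w) x u - dir_deriv (\<lambda>y. G y w v) x u)) z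
    + T x v w (G x u z)"
proof -
  have "dir_deriv (\<lambda>y. G y v w - G y w v) x u = dir_deriv (\<lambda>y. G y v w) x u - dir_deriv (\<lambda>y. G y w v) x u"
    by (rule dir_deriv_eq) (intro has_derivative_diff has_derivative_dir G_diff x)
  moreover have "(\<lambda>y. G y v w - G y w v) differentiable (at x)"
    by (intro differentiable_diff G_diff x)
  ultimately show ?thesis
    unfolding tors_def by (simp add: dir_deriv_g(2) [OF x])
qed

lemma bianchi:
  assumes x: "x \<in> S"
  shows "g x (curv G x u v w) z + g x (curv G x v w u) z + g x (curv G x w u v) z =
    dir_deriv (\<lambda>y. T y u v w) x z - (T x v w (G x u z) + T x w u (G x v z) + T x u v (G x w z))"
proof -
  have 1: "dir_deriv (\<lambda>y. T y u w z) x v = - dir_deriv (\<lambda>y. T y w u z) x v"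
  proof -
    have "dir_deriv (\<lambda>y. T y u w z) x v = dir_deriv (\<lambda>y. - T y w u z) x v"
      by (simp only: dir_deriv_cong(1) [OF open_S x T_skew(1) [where u = w and v = u and w = z]])
    also have "\<dots> = - dir_deriv (\<lambda>y. T y w u z) x v"
      by (rule dir_deriv_eq) (intro has_derivative_minus has_derivative_dir T_diff x)
    finally show ?thesis .
  qed
  have "dir_deriv (\<lambda>y. T y u v w) x z = dir_deriv (\<lambda>y. T y v w z) x u + dir_deriv (\<lambda>y. T y w u z) x v + dir_deriv (\<lambda>y. T y u v z) x w"
    using tors_closed [OF x, where a = u and b = v and c = w and d = z] unfolding 1 by simp
  then show ?thesis
    unfolding dir_deriv_T [OF x, of v w z] dir_deriv_T [OF x, of w u z] dir_deriv_T [OF x, of u v z] curv_def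
    by (simp add: g_simps G_simps x)
qed

text \<open>The Levi-Civita connection of \<open>g\<close> is \<open>sym_part G\<close>; summing this identity over an orthonormal
  frame compares the two scalar curvatures.\<close>

lemma curv_sym_part:
  assumes x: "x \<in> S"
  shows "g x (curv (sym_part G) x u v v) u = g x (curv G x u v v) u + 1/4 * T x u v (G x u v - G x v u)"
proof -
  let ?t = "\<lambda>u v. G x u v - G x v u"
  have D: "dir_deriv (\<lambda>y. sym_part G y a b) x h = (1/2) *\<^sub>R (dir_deriv (\<lambda>y. G y a b) x h + dir_deriv (\<lambda>y. G y b a) x h)" for a b h
    unfolding sym_part_def
    by (rule dir_deriv_eq) (intro has_derivative_scaleR_right has_derivative_add has_derivative_dir G_diff x)
  have t0: "T x u w u = 0" "T x w u u = 0" for w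
    using T_skew [OF x, of u w u] tors_null [OF x] by auto
  have "dir_deriv (\<lambda>y. T y u v u) x v = 0"
  proof -
    have "dir_deriv (\<lambda>y. T y u v u) x v = dir_deriv (\<lambda>y. 0) x v"
    proof -
      have "T y u v u = 0" if "y \<in> S" for y
        using T_skew(1) [OF that, of v u u] tors_null [OF that, of v u] by simp
      from dir_deriv_cong(1) [OF open_S x this] show ?thesis by simp
    qed
    then show ?thesis by simp
  qed
  from this [unfolded dir_deriv_T [OF x]]
  have a: "g x (G x v (?t u v)) u + g x (dir_deriv (\<lambda>y. G y u v) x v) u - g x (dir_deriv (\<lambda>y. G y v u) x v) u
     + T x u v (G x v u) = 0"
    by (simp add: g_simps x)
  have b: "g x (?t u (G x v v)) u = 0"
    using t0(1) [of "G x v v"] by (simp add: tors_def)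
  have c: "g x (?t v w) u = T x u v w" for w
    using T_cyclic [OF x, of v w u] by (simp add: tors_def)
  have "curv (sym_part G) x u v v = curv G x u v v - (1/2) *\<^sub>R ?t u (G x v v)
     + (1/2) *\<^sub>R (dir_deriv (\<lambda>y. G y u v) x v - dir_deriv (\<lambda>y. G y v u) x v)
     + (1/2) *\<^sub>R G x v (?t u v) + (1/2) *\<^sub>R ?t v (G x u v) - (1/4) *\<^sub>R ?t v (?t u v)"
    unfolding curv_def unfolding D unfolding sym_part_def
    by (simp add: G_simps x algebra_simps scaleR_add_left [symmetric] scaleR_2 [symmetric])
  then have "g x (curv (sym_part G) x u v v) u = g x (curv G x u v v) u
     + (1/2) * (g x (dir_deriv (\<lambda>y. G y u v) x v) u - g x (dir_deriv (\<lambda>y. G y v u) x v) u)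
     + (1/2) * g x (G x v (?t u v)) u + (1/2) * T x u v (G x u v) - (1/4) * T x u v (?t u v)"
    using b c [of "G x u v"] c [of "?t u v"] by (simp only: g_simps [OF x] b c) simp
  moreover have "T x u v (?t u v) = T x u v (G x u v) - T x u v (G x v u)"
    by (rule linear_diff [OF T_linear(3) [OF x]])
  ultimately show ?thesis using a by argo
qed

definition frame_at :: "real^7 \<Rightarrow> (7 \<Rightarrow> real^7) \<Rightarrow> bool" where
  "frame_at x E \<longleftrightarrow> (\<exists>e. invertible e \<and> (\<forall>u v. g x u v = (e *v u) \<bullet> (e *v v)) \<and>
     (\<forall>u v w. P x u v w = Phi0 (e *v u) (e *v v) (e *v w)) \<and> (\<forall>a. e *v E a = axis a 1))"

lemma frame_P: "frame_at x E \<Longrightarrow> P x (E a) (E b) (E c) = phi0 a b c"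
  by (auto simp: frame_at_def phi0_def)

lemma frame_expansion:
  assumes "frame_at x E"
  shows "v = (\<Sum>m\<in>UNIV. g x v (E m) *\<^sub>R E m)"
proof -
  obtain e where e: "invertible e" "\<And>u v. g x u v = (e *v u) \<bullet> (e *v v)" "\<And>a. e *v E a = axis a 1"
    using assms unfolding frame_at_def by blast
  have "e *v v = (\<Sum>m\<in>UNIV. (e *v v) $ m *\<^sub>R axis m 1)"
    by (rule axis_expansion)
  also have "\<dots> = e *v (\<Sum>m\<in>UNIV. g x v (E m) *\<^sub>R E m)"
    by (simp add: linear_sum [OF linear_mv] matrix_vector_mult_scaleR e(2,3) inner_axis)
  finally have "e *v v = e *v (\<Sum>m\<in>UNIV. g x v (E m) *\<^sub>R E m)" .
  moreover obtain e' where "e' ** e = mat 1"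
    using e(1) by (auto simp: invertible_def)
  then have "e' *v (e *v w) = w" for w
    by (simp add: matrix_vector_mul_assoc)
  ultimately show ?thesis by metis
qed

lemma frame_linear:
  fixes f :: "real^7 \<Rightarrow> real"
  assumes "frame_at x E" "linear f"
  shows "f v = (\<Sum>m\<in>UNIV. g x v (E m) * f (E m))"
  using arg_cong [OF frame_expansion [OF assms(1), of v], of f]
  by (simp only: linear_sum [OF assms(2)] linear_cmul [OF assms(2)] real_scaleR_def)

lemma torsion_square:
  assumes x: "x \<in> S" and E: "frame_at x E"
    and scal: "(\<Sum>a\<in>UNIV. \<Sum>b\<in>UNIV. g x (curv (sym_part G) x (E a) (E b) (E b)) (E a)) = 0"
  shows "psi_contract (\<lambda>a b c d. \<Sum>m\<in>UNIV. T x (E a) (E b) (E m) * T x (E c) (E d) (E m)) =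
    (\<Sum>a\<in>UNIV. \<Sum>b\<in>UNIV. \<Sum>m\<in>UNIV. (T x (E a) (E b) (E m))\<^sup>2)"
proof -
  define t where "t a b c = T x (E a) (E b) (E c)" for a b c
  define r where "r a b c d = g x (curv G x (E a) (E b) (E c)) (E d)" for a b c d
  define \<gamma> where "\<gamma> a d m = g x (G x (E a) (E d)) (E m)" for a d m
  define dt where "dt a b c d = dir_deriv (\<lambda>y. T y (E b) (E c) (E d)) x (E a)" for a b c d
  define h where "h a b c d = (\<Sum>m\<in>UNIV. t a b m * \<gamma> c d m)" for a b c d
  define X where "X = psi_contract (\<lambda>a b c d. \<Sum>m\<in>UNIV. t a b m * t c d m)"
  have T_E: "T x (E a) (E b) v = (\<Sum>m\<in>UNIV. t a b m * g x v (E m))" for a b v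
    using frame_linear [OF E T_linear(3) [OF x, of "E a" "E b"], of v] unfolding t_def by (simp only: mult.commute)
  have b: "r a b c d + r b c a d + r c a b d = dt d a b c - (h b c a d + h c a b d + h a b c d)" for a b c d
    using bianchi [OF x, of "E a" "E b" "E c" "E d"] unfolding r_def dt_def h_def \<gamma>_def T_E .
  have dt: "psi_contract (\<lambda>a b c d. dt d a b c) = 0"
  proof -
    have "dt a b c d - dt b a c d + dt c a b d - dt d a b c = 0" for a b c d
      unfolding dt_def by (rule tors_closed [OF x])
    then have "psi_contract (\<lambda>a b c d. dt a b c d - dt b a c d + dt c a b d - dt d a b c) = 0"
      by (simp add: psi_contract_def)
    then show ?thesis
      unfolding psi_contract_add psi_contract_diff psi_contract_swap(1) [of dt]
        psi_contract_cycle(2) [of dt] psi_contract_cycle(3) [of dt] by simp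
  qed
  have "psi_contract (\<lambda>a b c d. h a b c d - h a b d c) = X"
    unfolding X_def
  proof (intro arg_cong [where f = psi_contract] ext)
    fix a b c d
    have "\<gamma> c d m - \<gamma> d c m = t c d m" for m
      by (simp add: \<gamma>_def t_def tors_def g_simps x)
    then show "h a b c d - h a b d c = (\<Sum>m\<in>UNIV. t a b m * t c d m)"
      unfolding h_def by (simp only: sum_subtractf [symmetric] right_diff_distrib [symmetric])
  qed
  then have h: "2 * psi_contract h = X"
    unfolding psi_contract_diff psi_contract_swap(3) [of h] by simp
  have "psi_contract (\<lambda>a b c d. r a b c d + r b c a d + r c a b d) =
      psi_contract (\<lambda>a b c d. dt d a b c - (h b c a d + h c a b d + h a b c d))"
    by (simp only: b)
  then have 1: "3 * psi_contract r = - 3 * psi_contract h"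
    unfolding psi_contract_add psi_contract_diff dt psi_contract_cycle(1) [of r] psi_contract_cycle(2) [of r]
      psi_contract_cycle(1) [of h] psi_contract_cycle(2) [of h] by simp
  have skew: "r a b d c = - r a b c d" for a b c d
    using curv_skew [OF x, of "E a" "E b" "E c" "E d"] g_sym [OF x] by (simp add: r_def)
  have eig: "(\<Sum>c\<in>UNIV. \<Sum>d\<in>UNIV. r a b c d * psi0 c d a b) = - 2 * r a b a b" for a b
  proof (rule g2_eigenvalue)
    fix i j k
    let ?R = "curv G x (E a) (E b)"
    have "P x (?R (E i)) (E j) (E k) = (\<Sum>m\<in>UNIV. r a b i m * phi0 m j k)"
      using frame_linear [OF E trilinear_linear(1) [OF P_trilinear [OF x], of "E j" "E k"], of "?R (E i)"]
      unfolding r_def frame_P [OF E] .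
    moreover have "P x (E i) (?R (E j)) (E k) = (\<Sum>m\<in>UNIV. r a b j m * phi0 i m k)"
      using frame_linear [OF E trilinear_linear(2) [OF P_trilinear [OF x], of "E i" "E k"], of "?R (E j)"]
      unfolding r_def frame_P [OF E] .
    moreover have "P x (E i) (E j) (?R (E k)) = (\<Sum>m\<in>UNIV. r a b k m * phi0 i j m)"
      using frame_linear [OF E trilinear_linear(3) [OF P_trilinear [OF x], of "E i" "E j"], of "?R (E k)"]
      unfolding r_def frame_P [OF E] .
    ultimately show "(\<Sum>m\<in>UNIV. r a b i m * phi0 m j k + r a b j m * phi0 i m k + r a b k m * phi0 i j m) = 0"
      using curv_P [OF x, of "E a" "E b" "E i" "E j" "E k"] by (simp only: sum.distrib)
  qed (rule skew)
  have 2: "psi_contract r = - 2 * (\<Sum>a\<in>UNIV. \<Sum>b\<in>UNIV. r a b a b)"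
  proof -
    have "psi_contract r = (\<Sum>a\<in>UNIV. \<Sum>b\<in>UNIV. \<Sum>c\<in>UNIV. \<Sum>d\<in>UNIV. r a b c d * psi0 c d a b)"
      unfolding psi_contract_def by (intro sum.cong refl arg_cong2 [where f = "(*)"] psi0_pair_swap)
    then show ?thesis by (simp only: eig sum_distrib_left)
  qed
  have "T x (E a) (E b) (G x (E a) (E b) - G x (E b) (E a)) = (\<Sum>m\<in>UNIV. (t a b m)\<^sup>2)" for a b
  proof -
    have "g x (G x (E a) (E b) - G x (E b) (E a)) (E m) = t a b m" for m
      by (simp add: t_def tors_def)
    then show ?thesis
      using T_E [of a b "G x (E a) (E b) - G x (E b) (E a)"] by (simp only: power2_eq_square)
  qed
  then have "g x (curv (sym_part G) x (E a) (E b) (E b)) (E a) = - r a b a b + 1/4 * (\<Sum>m\<in>UNIV. (t a b m)\<^sup>2)" for a b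
    using curv_sym_part [OF x, of "E a" "E b"] skew [of a b b a] by (simp add: r_def)
  then have "(\<Sum>a\<in>UNIV. \<Sum>b\<in>UNIV. - r a b a b + 1/4 * (\<Sum>m\<in>UNIV. (t a b m)\<^sup>2)) = 0"
    using scal by simp
  then have "4 * (\<Sum>a\<in>UNIV. \<Sum>b\<in>UNIV. r a b a b) = (\<Sum>a\<in>UNIV. \<Sum>b\<in>UNIV. \<Sum>m\<in>UNIV. (t a b m)\<^sup>2)"
    unfolding sum.distrib sum_negf sum_distrib_left [symmetric] by linarith
  then show ?thesis
    using 1 2 h unfolding X_def t_def by linarith
qed

end

lemma altsum_swap_7:
  fixes K :: "7 \<Rightarrow> 7 \<Rightarrow> 7 \<Rightarrow> 7 \<Rightarrow> 7 \<Rightarrow> 7 \<Rightarrow> 7 \<Rightarrow> real"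
  shows
  "altsum (\<lambda>p. K (p 2) (p 1) (p 3) (p 4) (p 5) (p 6) (p 7)) = - altsum (\<lambda>p. K (p 1) (p 2) (p 3) (p 4) (p 5) (p 6) (p 7))"
  "altsum (\<lambda>p. K (p 1) (p 3) (p 2) (p 4) (p 5) (p 6) (p 7)) = - altsum (\<lambda>p. K (p 1) (p 2) (p 3) (p 4) (p 5) (p 6) (p 7))"
  "altsum (\<lambda>p. K (p 1) (p 2) (p 4) (p 3) (p 5) (p 6) (p 7)) = - altsum (\<lambda>p. K (p 1) (p 2) (p 3) (p 4) (p 5) (p 6) (p 7))"
  "altsum (\<lambda>p. K (p 1) (p 2) (p 3) (p 4) (p 6) (p 5) (p 7)) = - altsum (\<lambda>p. K (p 1) (p 2) (p 3) (p 4) (p 5) (p 6) (p 7))"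
  "altsum (\<lambda>p. K (p 1) (p 2) (p 3) (p 4) (p 5) (p 7) (p 6)) = - altsum (\<lambda>p. K (p 1) (p 2) (p 3) (p 4) (p 5) (p 6) (p 7))"
  "altsum (\<lambda>p. K (p 5) (p 2) (p 3) (p 4) (p 1) (p 6) (p 7)) = - altsum (\<lambda>p. K (p 1) (p 2) (p 3) (p 4) (p 5) (p 6) (p 7))"
  using altsum_transpose [of 1 2 "\<lambda>p. K (p 1) (p 2) (p 3) (p 4) (p 5) (p 6) (p 7)"]
    altsum_transpose [of 2 3 "\<lambda>p. K (p 1) (p 2) (p 3) (p 4) (p 5) (p 6) (p 7)"]
    altsum_transpose [of 3 4 "\<lambda>p. K (p 1) (p 2) (p 3) (p 4) (p 5) (p 6) (p 7)"]
    altsum_transpose [of 5 6 "\<lambda>p. K (p 1) (p 2) (p 3) (p 4) (p 5) (p 6) (p 7)"]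
    altsum_transpose [of 6 7 "\<lambda>p. K (p 1) (p 2) (p 3) (p 4) (p 5) (p 6) (p 7)"]
    altsum_transpose [of 1 5 "\<lambda>p. K (p 1) (p 2) (p 3) (p 4) (p 5) (p 6) (p 7)"]
  by (simp_all add: Transposition.transpose_def)

lemma has_derivative_altsum:
  assumes "\<And>p. ((\<lambda>y. F y p) has_derivative F' p) (at x)"
  shows "((\<lambda>y. altsum (F y)) has_derivative (\<lambda>h. altsum (\<lambda>p. F' p h))) (at x)"
  unfolding altsum_def by (intro has_derivative_sum has_derivative_mult_right assms)

lemma altsum_diff: "altsum (\<lambda>p. F p - H p) = altsum F - altsum H"
  using altsum_add [of F "\<lambda>p. - H p"] by (simp add: altsum_minus)

context skew_torsion
begin

definition flux :: "real^7 \<Rightarrow> real^7" where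
  "flux x = (\<chi> a. altsum (\<lambda>p. axis (p 1) 1 $ a * T x (axis (p 2) 1) (axis (p 3) 1) (axis (p 4) 1)
     * P x (axis (p 5) 1) (axis (p 6) 1) (axis (p 7) 1)))"

lemma frame_trace:
  assumes x: "x \<in> S" and E: "frame_at x E" and L: "linear L"
  shows "(\<Sum>a\<in>UNIV. L (axis a 1) $ a) = (\<Sum>m\<in>UNIV. g x (L (E m)) (E m))"
proof -
  have "L (axis a 1) $ a = (\<Sum>m\<in>UNIV. g x (axis a 1) (E m) * L (E m) $ a)" for a
  proof (rule frame_linear [OF E])
    show "linear (\<lambda>v. L v $ a)"
      using L by (simp add: linear_iff)
  qed
  then have "(\<Sum>a\<in>UNIV. L (axis a 1) $ a) = (\<Sum>m\<in>UNIV. \<Sum>a\<in>UNIV. L (E m) $ a * g x (axis a 1) (E m))"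
    by (simp only: mult.commute) (rule sum.swap)
  also have "\<dots> = (\<Sum>m\<in>UNIV. g x (L (E m)) (E m))"
    by (rule sum.cong [OF refl], rule linear_axis_expansion [symmetric], rule g_linear(1) [OF x])
  finally show ?thesis .
qed

lemma flux_has_derivative:
  assumes x: "x \<in> S"
  shows "((\<lambda>y. flux y $ a) has_derivative (\<lambda>h. altsum (\<lambda>p. axis (p 1) 1 $ a *
     (T x (axis (p 2) 1) (axis (p 3) 1) (axis (p 4) 1) * dir_deriv (\<lambda>y. P y (axis (p 5) 1) (axis (p 6) 1) (axis (p 7) 1)) x h
      + dir_deriv (\<lambda>y. T y (axis (p 2) 1) (axis (p 3) 1) (axis (p 4) 1)) x h * P x (axis (p 5) 1) (axis (p 6) 1) (axis (p 7) 1))))) (at x)"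
  unfolding flux_def vec_lambda_beta mult.assoc
  by (intro has_derivative_altsum has_derivative_mult_right has_derivative_mult has_derivative_dir T_diff P_diff x)

lemma flux_divergence:
  assumes x: "x \<in> S"
    and e: "invertible e" "\<And>u v. g x u v = (e *v u) \<bullet> (e *v v)"
      "\<And>u v w. P x u v w = Phi0 (e *v u) (e *v v) (e *v w)" "\<And>a. e *v E a = axis a 1"
  shows "(\<Sum>a\<in>UNIV. dir_deriv (\<lambda>y. flux y $ a) x (axis a 1)) =
    - 9 * det e * psi_contract (\<lambda>a b c d. \<Sum>m\<in>UNIV. T x (E a) (E b) (E m) * T x (E c) (E d) (E m))"
proof -
  have E: "frame_at x E"
    using e unfolding frame_at_def by blast
  define X where "X i = axis i (1::real)" for i :: 7
  define \<tau> where "\<tau> u v = G x u v - G x v u" for u v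
  define A where "A = altsum (\<lambda>p. dir_deriv (\<lambda>y. T y (X (p 2)) (X (p 3)) (X (p 4))) x (X (p 1)) * P x (X (p 5)) (X (p 6)) (X (p 7)))"
  define B where "B = altsum (\<lambda>p. T x (X (p 2)) (X (p 3)) (X (p 4)) * dir_deriv (\<lambda>y. P y (X (p 5)) (X (p 6)) (X (p 7))) x (X (p 1)))"
  define B' where "B' = altsum (\<lambda>p. T x (X (p 2)) (X (p 3)) (X (p 4)) * P x (G x (X (p 1)) (X (p 5))) (X (p 6)) (X (p 7)))"
  define Q where "Q = altsum (\<lambda>p. T x (X (p 2)) (X (p 3)) (X (p 4)) * P x (\<tau> (X (p 1)) (X (p 5))) (X (p 6)) (X (p 7)))"
  define U where "U = altsum (\<lambda>p. T x (\<tau> (X (p 1)) (X (p 2))) (X (p 3)) (X (p 4)) * P x (X (p 5)) (X (p 6)) (X (p 7)))"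
  note Tskew = T_skew [OF x] and Pskew = P_skew [OF x]
  note Tlin = T_linear [OF x] and Plin = trilinear_linear [OF P_trilinear [OF x]]
  have Xd: "X i $ a = (if a = i then 1 else 0)" for i a
    by (simp add: X_def axis_def eq_commute)
  have "(\<Sum>a\<in>UNIV. dir_deriv (\<lambda>y. flux y $ a) x (axis a 1)) = B + A"
  proof -
    let ?q = "\<lambda>p h. T x (X (p 2)) (X (p 3)) (X (p 4)) * dir_deriv (\<lambda>y. P y (X (p 5)) (X (p 6)) (X (p 7))) x h
      + dir_deriv (\<lambda>y. T y (X (p 2)) (X (p 3)) (X (p 4))) x h * P x (X (p 5)) (X (p 6)) (X (p 7))"
    have "(\<Sum>a\<in>UNIV. dir_deriv (\<lambda>y. flux y $ a) x (axis a 1)) =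
        (\<Sum>a\<in>UNIV. altsum (\<lambda>p. X (p 1) $ a * ?q p (X a)))"
      unfolding dir_deriv_eq [OF flux_has_derivative [OF x]] X_def ..
    also have "\<dots> = altsum (\<lambda>p. \<Sum>a\<in>UNIV. X (p 1) $ a * ?q p (X a))"
      by (rule altsum_sum [symmetric])
    also have "\<dots> = altsum (\<lambda>p. ?q p (X (p 1)))"
      unfolding Xd if_mult by simp
    finally show ?thesis by (simp only: altsum_add A_def B_def)
  qed
  moreover have "A = 0"
  proof -
    let ?K = "\<lambda>a b c d e f g. dir_deriv (\<lambda>y. T y (X b) (X c) (X d)) x (X a) * P x (X e) (X f) (X g)"
    have "?K a b c d e f g - ?K b a c d e f g + ?K c a b d e f g - ?K d a b c e f g = 0" for a b c d e f g
      unfolding left_diff_distrib [symmetric] distrib_right [symmetric] tors_closed [OF x] by simp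
    then have "0 = altsum (\<lambda>p. ?K (p 1) (p 2) (p 3) (p 4) (p 5) (p 6) (p 7) - ?K (p 2) (p 1) (p 3) (p 4) (p 5) (p 6) (p 7)
       + ?K (p 3) (p 1) (p 2) (p 4) (p 5) (p 6) (p 7) - ?K (p 4) (p 1) (p 2) (p 3) (p 5) (p 6) (p 7))"
      by (simp add: altsum_def)
    also have "\<dots> = A - altsum (\<lambda>p. ?K (p 2) (p 1) (p 3) (p 4) (p 5) (p 6) (p 7))
       + altsum (\<lambda>p. ?K (p 3) (p 1) (p 2) (p 4) (p 5) (p 6) (p 7)) - altsum (\<lambda>p. ?K (p 4) (p 1) (p 2) (p 3) (p 5) (p 6) (p 7))"
      by (simp only: altsum_add altsum_diff A_def)
    also have "altsum (\<lambda>p. ?K (p 2) (p 1) (p 3) (p 4) (p 5) (p 6) (p 7)) = - A"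
      unfolding A_def by (rule altsum_swap_7(1) [of ?K])
    also have "altsum (\<lambda>p. ?K (p 3) (p 1) (p 2) (p 4) (p 5) (p 6) (p 7)) = A"
      using altsum_swap_7(2) [of "\<lambda>a b c d e f g. ?K b a c d e f g"] altsum_swap_7(1) [of ?K]
      unfolding A_def by simp
    also have "altsum (\<lambda>p. ?K (p 4) (p 1) (p 2) (p 3) (p 5) (p 6) (p 7)) = - A"
      using altsum_swap_7(3) [of "\<lambda>a b c d e f g. ?K c a b d e f g"]
        altsum_swap_7(2) [of "\<lambda>a b c d e f g. ?K b a c d e f g"] altsum_swap_7(1) [of ?K]
      unfolding A_def by simp
    finally show ?thesis by simp
  qed
  moreover have "B = 3 * B'"
  proof -
    let ?K = "\<lambda>a b c d e f g. T x (X b) (X c) (X d) * P x (G x (X a) (X e)) (X f) (X g)"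
    have "B = altsum (\<lambda>p. ?K (p 1) (p 2) (p 3) (p 4) (p 5) (p 6) (p 7) - ?K (p 1) (p 2) (p 3) (p 4) (p 6) (p 5) (p 7)
       + ?K (p 1) (p 2) (p 3) (p 4) (p 7) (p 5) (p 6))"
      unfolding B_def nabla_P [OF x]
    proof (intro arg_cong [where f = altsum] ext)
      fix p
      show "T x (X (p 2)) (X (p 3)) (X (p 4)) *
         (P x (G x (X (p 1)) (X (p 5))) (X (p 6)) (X (p 7)) + P x (X (p 5)) (G x (X (p 1)) (X (p 6))) (X (p 7)) +
          P x (X (p 5)) (X (p 6)) (G x (X (p 1)) (X (p 7)))) =
         ?K (p 1) (p 2) (p 3) (p 4) (p 5) (p 6) (p 7) - ?K (p 1) (p 2) (p 3) (p 4) (p 6) (p 5) (p 7)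
       + ?K (p 1) (p 2) (p 3) (p 4) (p 7) (p 5) (p 6)"
        using Pskew(1) [of "G x (X (p 1)) (X (p 6))" "X (p 5)" "X (p 7)"]
          Pskew(2) [of "X (p 5)" "X (p 6)" "G x (X (p 1)) (X (p 7))"]
          Pskew(1) [of "X (p 5)" "G x (X (p 1)) (X (p 7))" "X (p 6)"]
        by (simp add: algebra_simps)
    qed
    also have "\<dots> = B' - altsum (\<lambda>p. ?K (p 1) (p 2) (p 3) (p 4) (p 6) (p 5) (p 7))
        + altsum (\<lambda>p. ?K (p 1) (p 2) (p 3) (p 4) (p 7) (p 5) (p 6))"
      by (simp only: altsum_add altsum_diff B'_def)
    also have "altsum (\<lambda>p. ?K (p 1) (p 2) (p 3) (p 4) (p 6) (p 5) (p 7)) = - B'"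
      unfolding B'_def by (rule altsum_swap_7(4) [of ?K])
    also have "altsum (\<lambda>p. ?K (p 1) (p 2) (p 3) (p 4) (p 7) (p 5) (p 6)) = B'"
      using altsum_swap_7(5) [of "\<lambda>a b c d e f g. ?K a b c d f e g"] altsum_swap_7(4) [of ?K]
      unfolding B'_def by simp
    finally show ?thesis by simp
  qed
  moreover have "2 * B' = Q"
  proof -
    let ?K = "\<lambda>a b c d e f g. T x (X b) (X c) (X d) * P x (G x (X a) (X e)) (X f) (X g)"
    have "Q = altsum (\<lambda>p. ?K (p 1) (p 2) (p 3) (p 4) (p 5) (p 6) (p 7) - ?K (p 5) (p 2) (p 3) (p 4) (p 1) (p 6) (p 7))"
      unfolding Q_def \<tau>_def linear_diff [OF Plin(1)] right_diff_distrib ..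
    also have "\<dots> = B' - altsum (\<lambda>p. ?K (p 5) (p 2) (p 3) (p 4) (p 1) (p 6) (p 7))"
      by (simp only: altsum_diff B'_def)
    also have "altsum (\<lambda>p. ?K (p 5) (p 2) (p 3) (p 4) (p 1) (p 6) (p 7)) = - B'"
      unfolding B'_def by (rule altsum_swap_7(6) [of ?K])
    finally show ?thesis by simp
  qed
  moreover have "Q = - U"
  proof -
    have \<tau>lin: "linear (\<lambda>v. \<tau> u v)" "linear (\<lambda>v. \<tau> v u)" for u
      unfolding \<tau>_def by (intro linear_compose_sub G_linear x)+
    have \<tau>_exp: "(\<Sum>k\<in>UNIV. X i $ k * f (\<tau> (X k) v)) = f (\<tau> (X i) v)" for f :: "real^7 \<Rightarrow> real" and i v
      unfolding Xd if_mult by simp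
    define M where "M k f = f 1 $ k * (T x (f 2) (f 3) (f 4) * P x (f 5) (f 6) (f 7))" for k and f :: "7 \<Rightarrow> real^7"
    have Mlin: "multilinear (M k)" for k
    proof -
      have c: "linear (\<lambda>v :: real^7. v $ k)" by (simp add: linear_iff)
      show ?thesis
        unfolding M_def
        by (rule multilinear_7I [of "\<lambda>a b c d e f g. a $ k * (T x b c d * P x e f g)"];
            intro linear_scale_right linear_scale_left Tlin Plin c)
    qed
    have tr: "(\<Sum>a\<in>UNIV. \<tau> u (X a) $ a) = 0" for u
    proof -
      have "(\<Sum>a\<in>UNIV. \<tau> u (X a) $ a) = (\<Sum>m\<in>UNIV. g x (\<tau> u (E m)) (E m))"
        unfolding X_def by (rule frame_trace [OF x E \<tau>lin(1)])
      also have "\<dots> = 0"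
        using tors_null [OF x] by (simp add: tors_def \<tau>_def)
      finally show ?thesis .
    qed
    have tr': "(\<Sum>a\<in>UNIV. \<tau> (X a) u $ a) = 0" for u
    proof -
      have "\<tau> (X a) u $ a = - \<tau> u (X a) $ a" for a by (simp add: \<tau>_def)
      then show ?thesis using tr [of u] by (simp add: sum_negf)
    qed
    let ?Y = "\<lambda>p j. X (p j)"
    \<comment> \<open>Letting \<open>\<tau> (X k)\<close> act as a derivation on a 7-form multiplies it by the trace of \<open>\<tau> (X k)\<close>, which is 0.\<close>
    have "0 = (\<Sum>k\<in>UNIV. \<Sum>i\<in>UNIV. altsum (\<lambda>p. M k ((?Y p)(i := \<tau> (X k) (X (p i))))))"
      using altsum_slots [OF Mlin \<tau>lin(1)] tr unfolding X_def by simp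
    also have "\<dots> = (\<Sum>i\<in>UNIV. altsum (\<lambda>p. \<Sum>k\<in>UNIV. M k ((?Y p)(i := \<tau> (X k) (X (p i))))))"
      by (subst sum.swap) (simp only: altsum_sum)
    also have "\<dots> =
       altsum (\<lambda>p. \<Sum>k\<in>UNIV. \<tau> (X k) (X (p 1)) $ k * (T x (X (p 2)) (X (p 3)) (X (p 4)) * P x (X (p 5)) (X (p 6)) (X (p 7))))
     + altsum (\<lambda>p. \<Sum>k\<in>UNIV. X (p 1) $ k * (T x (\<tau> (X k) (X (p 2))) (X (p 3)) (X (p 4)) * P x (X (p 5)) (X (p 6)) (X (p 7))))
     + altsum (\<lambda>p. \<Sum>k\<in>UNIV. X (p 1) $ k * (T x (X (p 2)) (\<tau> (X k) (X (p 3))) (X (p 4)) * P x (X (p 5)) (X (p 6)) (X (p 7))))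
     + altsum (\<lambda>p. \<Sum>k\<in>UNIV. X (p 1) $ k * (T x (X (p 2)) (X (p 3)) (\<tau> (X k) (X (p 4))) * P x (X (p 5)) (X (p 6)) (X (p 7))))
     + altsum (\<lambda>p. \<Sum>k\<in>UNIV. X (p 1) $ k * (T x (X (p 2)) (X (p 3)) (X (p 4)) * P x (\<tau> (X k) (X (p 5))) (X (p 6)) (X (p 7))))
     + altsum (\<lambda>p. \<Sum>k\<in>UNIV. X (p 1) $ k * (T x (X (p 2)) (X (p 3)) (X (p 4)) * P x (X (p 5)) (\<tau> (X k) (X (p 6))) (X (p 7))))
     + altsum (\<lambda>p. \<Sum>k\<in>UNIV. X (p 1) $ k * (T x (X (p 2)) (X (p 3)) (X (p 4)) * P x (X (p 5)) (X (p 6)) (\<tau> (X k) (X (p 7)))))"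
      unfolding sum_7 [of "\<lambda>i. altsum (F i)" for F] M_def by simp
    also have "altsum (\<lambda>p. \<Sum>k\<in>UNIV. \<tau> (X k) (X (p 1)) $ k * (T x (X (p 2)) (X (p 3)) (X (p 4)) * P x (X (p 5)) (X (p 6)) (X (p 7)))) = 0"
      unfolding sum_distrib_right [symmetric] tr' by (simp add: altsum_def)
    finally have "0 =
       altsum (\<lambda>p. T x (\<tau> (X (p 1)) (X (p 2))) (X (p 3)) (X (p 4)) * P x (X (p 5)) (X (p 6)) (X (p 7)))
     + altsum (\<lambda>p. T x (X (p 2)) (\<tau> (X (p 1)) (X (p 3))) (X (p 4)) * P x (X (p 5)) (X (p 6)) (X (p 7)))
     + altsum (\<lambda>p. T x (X (p 2)) (X (p 3)) (\<tau> (X (p 1)) (X (p 4))) * P x (X (p 5)) (X (p 6)) (X (p 7)))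
     + altsum (\<lambda>p. T x (X (p 2)) (X (p 3)) (X (p 4)) * P x (\<tau> (X (p 1)) (X (p 5))) (X (p 6)) (X (p 7)))
     + altsum (\<lambda>p. T x (X (p 2)) (X (p 3)) (X (p 4)) * P x (X (p 5)) (\<tau> (X (p 1)) (X (p 6))) (X (p 7)))
     + altsum (\<lambda>p. T x (X (p 2)) (X (p 3)) (X (p 4)) * P x (X (p 5)) (X (p 6)) (\<tau> (X (p 1)) (X (p 7))))"
      unfolding Xd if_mult by simp
    moreover
    let ?K = "\<lambda>a b c d e f g. T x (\<tau> (X a) (X b)) (X c) (X d) * P x (X e) (X f) (X g)"
    have "altsum (\<lambda>p. T x (X (p 2)) (\<tau> (X (p 1)) (X (p 3))) (X (p 4)) * P x (X (p 5)) (X (p 6)) (X (p 7))) = U"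
    proof -
      have "altsum (\<lambda>p. T x (X (p 2)) (\<tau> (X (p 1)) (X (p 3))) (X (p 4)) * P x (X (p 5)) (X (p 6)) (X (p 7))) =
          altsum (\<lambda>p. - ?K (p 1) (p 3) (p 2) (p 4) (p 5) (p 6) (p 7))"
        using Tskew(1) by (metis (no_types, opaque_lifting) mult_minus_left)
      then show ?thesis
        using altsum_swap_7(2) [of ?K] unfolding altsum_minus U_def by simp
    qed
    moreover have "altsum (\<lambda>p. T x (X (p 2)) (X (p 3)) (\<tau> (X (p 1)) (X (p 4))) * P x (X (p 5)) (X (p 6)) (X (p 7))) = U"
    proof -
      have "altsum (\<lambda>p. T x (X (p 2)) (X (p 3)) (\<tau> (X (p 1)) (X (p 4))) * P x (X (p 5)) (X (p 6)) (X (p 7))) =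
          altsum (\<lambda>p. ?K (p 1) (p 4) (p 2) (p 3) (p 5) (p 6) (p 7))"
        using T_cyclic [OF x] by metis
      then show ?thesis
        using altsum_swap_7(3) [of "\<lambda>a b c d e f g. ?K a c b d e f g"] altsum_swap_7(2) [of ?K]
        unfolding U_def by simp
    qed
    moreover
    let ?K = "\<lambda>a b c d e f g. T x (X b) (X c) (X d) * P x (\<tau> (X a) (X e)) (X f) (X g)"
    have "altsum (\<lambda>p. T x (X (p 2)) (X (p 3)) (X (p 4)) * P x (X (p 5)) (\<tau> (X (p 1)) (X (p 6))) (X (p 7))) = Q"
    proof -
      have "altsum (\<lambda>p. T x (X (p 2)) (X (p 3)) (X (p 4)) * P x (X (p 5)) (\<tau> (X (p 1)) (X (p 6))) (X (p 7))) =
          altsum (\<lambda>p. - ?K (p 1) (p 2) (p 3) (p 4) (p 6) (p 5) (p 7))"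
        using Pskew(1) by (metis (no_types, opaque_lifting) mult_minus_right)
      then show ?thesis
        using altsum_swap_7(4) [of ?K] unfolding altsum_minus Q_def by simp
    qed
    moreover have "altsum (\<lambda>p. T x (X (p 2)) (X (p 3)) (X (p 4)) * P x (X (p 5)) (X (p 6)) (\<tau> (X (p 1)) (X (p 7)))) = Q"
    proof -
      have "P x b c a = P x a b c" for a b c
        using Pskew(2) [of b a c] Pskew(1) [of b a c] by simp
      then have "altsum (\<lambda>p. T x (X (p 2)) (X (p 3)) (X (p 4)) * P x (X (p 5)) (X (p 6)) (\<tau> (X (p 1)) (X (p 7)))) =
          altsum (\<lambda>p. ?K (p 1) (p 2) (p 3) (p 4) (p 7) (p 5) (p 6))"
        by metis
      then show ?thesis
        using altsum_swap_7(5) [of "\<lambda>a b c d e f g. ?K a b c d f e g"] altsum_swap_7(4) [of ?K]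
        unfolding Q_def by simp
    qed
    ultimately show ?thesis
      unfolding U_def [symmetric] Q_def [symmetric] by linarith
  qed
  moreover have "U = 6 * det e * psi_contract (\<lambda>a b c d. \<Sum>m\<in>UNIV. T x (E a) (E b) (E m) * T x (E c) (E d) (E m))"
  proof -
    obtain e' where e': "e' ** e = mat 1" "e ** e' = mat 1"
      using e(1) by (auto simp: invertible_def)
    have E': "e' *v axis a 1 = E a" for a
      by (metis e' e(4) matrix_vector_mul_assoc matrix_vector_mul_lid)
    have X': "e' *v (e *v X a) = X a" for a
      by (simp add: matrix_vector_mul_assoc e')
    let ?K = "\<lambda>a b c d e f g. T x (\<tau> (e' *v a) (e' *v b)) (e' *v c) (e' *v d) * P x (e' *v e) (e' *v f) (e' *v g)"
    have l: "linear (\<lambda>v. \<tau> (e' *v u) (e' *v v))" "linear (\<lambda>v. \<tau> (e' *v v) (e' *v u))" for u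
      unfolding \<tau>_def
      by (intro linear_compose_sub linear_comp [OF G_linear(1) linear_mv] linear_comp [OF G_linear(2) linear_mv] x)+
    have "multilinear (\<lambda>f :: 7 \<Rightarrow> real^7. ?K (f 1) (f 2) (f 3) (f 4) (f 5) (f 6) (f 7))"
      by (rule multilinear_7I; intro linear_scale_right linear_scale_left
          linear_comp [OF Tlin(1) l(1)] linear_comp [OF Tlin(1) l(2)] linear_comp [OF Tlin(2) linear_mv] linear_comp [OF Tlin(3) linear_mv]
          linear_comp [OF Plin(1) linear_mv] linear_comp [OF Plin(2) linear_mv] linear_comp [OF Plin(3) linear_mv])
    from altsum_linear_image [OF this, of e]
    have "U = det e * altsum (\<lambda>p. T x (\<tau> (E (p 1)) (E (p 2))) (E (p 3)) (E (p 4)) * phi0 (p 5) (p 6) (p 7))"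
      unfolding X_def [symmetric] X' unfolding X_def E' frame_P [OF E] U_def .
    also have "altsum (\<lambda>p. T x (\<tau> (E (p 1)) (E (p 2))) (E (p 3)) (E (p 4)) * phi0 (p 5) (p 6) (p 7)) =
       6 * psi_contract (\<lambda>a b c d. T x (\<tau> (E a) (E b)) (E c) (E d))"
      unfolding psi_contract_def by (rule altsum_phi0)
    also have "(\<lambda>a b c d. T x (\<tau> (E a) (E b)) (E c) (E d)) = (\<lambda>a b c d. \<Sum>m\<in>UNIV. T x (E a) (E b) (E m) * T x (E c) (E d) (E m))"
    proof (intro ext)
      fix a b c d
      have "T x (\<tau> (E a) (E b)) (E c) (E d) = (\<Sum>m\<in>UNIV. g x (\<tau> (E a) (E b)) (E m) * T x (E m) (E c) (E d))"
        by (rule frame_linear [OF E Tlin(1)])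
      also have "\<dots> = (\<Sum>m\<in>UNIV. T x (E a) (E b) (E m) * T x (E c) (E d) (E m))"
        by (rule sum.cong [OF refl]) (metis T_cyclic [OF x] tors_def \<tau>_def)
      finally show "T x (\<tau> (E a) (E b)) (E c) (E d) = (\<Sum>m\<in>UNIV. T x (E a) (E b) (E m) * T x (E c) (E d) (E m))" .
    qed
    finally show ?thesis by simp
  qed
  ultimately show ?thesis by simp
qed

end

section \<open>Continuously differentiable functions\<close>

definition C1_on :: "'v::real_normed_vector set \<Rightarrow> ('v \<Rightarrow> 'w::real_normed_vector) \<Rightarrow> bool" where
  "C1_on S f \<longleftrightarrow> (\<forall>x\<in>S. f differentiable (at x)) \<and> (\<forall>v. continuous_on S (\<lambda>x. dir_deriv f x v))"

lemma smooth_on_C1: "smooth_on S f \<Longrightarrow> C1_on S f"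
  unfolding smooth_on_def C1_on_def using Ck_on.simps(2) [of 0 S f] by (metis Ck_on.simps(1))

lemma smooth_on_dir_deriv: "smooth_on S f \<Longrightarrow> smooth_on S (\<lambda>x. dir_deriv f x v)"
  unfolding smooth_on_def by (metis Ck_on.simps(2))

lemma C1_on_differentiable: "C1_on S f \<Longrightarrow> x \<in> S \<Longrightarrow> f differentiable (at x)"
  by (simp add: C1_on_def)

lemma C1_on_has_derivative: "C1_on S f \<Longrightarrow> x \<in> S \<Longrightarrow> (f has_derivative (\<lambda>v. dir_deriv f x v)) (at x)"
  by (simp add: C1_on_def has_derivative_dir)

lemma C1_on_deriv_continuous: "C1_on S f \<Longrightarrow> continuous_on S (\<lambda>x. dir_deriv f x v)"
  by (simp add: C1_on_def)

lemma C1_on_continuous: "C1_on S f \<Longrightarrow> continuous_on S f"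
  by (meson C1_on_differentiable continuous_at_imp_continuous_on differentiable_imp_continuous_within)

lemma C1_on_subset: "C1_on S f \<Longrightarrow> U \<subseteq> S \<Longrightarrow> C1_on U f"
  unfolding C1_on_def by (meson continuous_on_subset subsetD)

lemma C1_onI:
  assumes "\<And>x. x \<in> S \<Longrightarrow> (f has_derivative f' x) (at x)" "\<And>v. continuous_on S (\<lambda>x. f' x v)"
  shows "C1_on S f"
proof -
  have "dir_deriv f x v = f' x v" if "x \<in> S" for x v
    by (rule dir_deriv_eq [OF assms(1) [OF that]])
  then have "continuous_on S (\<lambda>x. dir_deriv f x v)" for v
    using assms(2) [of v] by (simp cong: continuous_on_cong)
  then show ?thesis
    using assms(1) unfolding C1_on_def differentiable_def by blast
qed

lemma C1_on_cong:
  assumes "open S" "\<And>x. x \<in> S \<Longrightarrow> f x = h x" "C1_on S f"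
  shows "C1_on S h"
proof (rule C1_onI)
  show "(h has_derivative (\<lambda>v. dir_deriv f x v)) (at x)" if "x \<in> S" for x
    by (rule has_derivative_transform_within_open [OF C1_on_has_derivative [OF assms(3) that] assms(1) that])
      (rule assms(2))
  show "continuous_on S (\<lambda>x. dir_deriv f x v)" for v
    by (rule C1_on_deriv_continuous [OF assms(3)])
qed

lemma C1_on_local:
  assumes "\<And>x. x \<in> S \<Longrightarrow> \<exists>U. open U \<and> x \<in> U \<and> C1_on U f"
  shows "C1_on S f"
  unfolding C1_on_def
proof (intro conjI ballI allI continuous_at_imp_continuous_on)
  fix x assume "x \<in> S"
  then obtain U where U: "open U" "x \<in> U" "C1_on U f" using assms by blast
  then show "f differentiable (at x)" by (simp add: C1_on_def)
  show "isCont (\<lambda>x. dir_deriv f x v) x" for v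
    using U C1_on_deriv_continuous continuous_on_eq_continuous_at by blast
qed

lemma C1_on_const [intro]: "C1_on S (\<lambda>x. c)"
  by (rule C1_onI [where f' = "\<lambda>x v. 0"]) auto

lemma C1_on_add: "C1_on S f \<Longrightarrow> C1_on S h \<Longrightarrow> C1_on S (\<lambda>x. f x + h x)"
  by (rule C1_onI, rule has_derivative_add) (auto intro!: C1_on_has_derivative continuous_intros C1_on_deriv_continuous)

lemma C1_on_sum: "(\<And>i. i \<in> I \<Longrightarrow> C1_on S (f i)) \<Longrightarrow> C1_on S (\<lambda>x. \<Sum>i\<in>I. f i x)"
  by (induction I rule: infinite_finite_induct) (auto intro: C1_on_add)

lemma C1_on_mult:
  fixes f h :: "'v::real_normed_vector \<Rightarrow> real"
  assumes "C1_on S f" "C1_on S h"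
  shows "C1_on S (\<lambda>x. f x * h x)"
proof (rule C1_onI)
  show "((\<lambda>x. f x * h x) has_derivative (\<lambda>v. f x * dir_deriv h x v + dir_deriv f x v * h x)) (at x)" if "x \<in> S" for x
    by (intro has_derivative_mult C1_on_has_derivative [OF _ that] assms)
  show "continuous_on S (\<lambda>x. f x * dir_deriv h x v + dir_deriv f x v * h x)" for v
    by (intro continuous_intros C1_on_continuous C1_on_deriv_continuous assms)
qed

lemma C1_on_diff: "C1_on S f \<Longrightarrow> C1_on S h \<Longrightarrow> C1_on S (\<lambda>x. f x - h x)"
  by (rule C1_onI, rule has_derivative_diff) (auto intro!: C1_on_has_derivative continuous_intros C1_on_deriv_continuous)

lemma C1_on_inverse:
  fixes f :: "'v::real_normed_vector \<Rightarrow> real"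
  assumes f: "C1_on S f" and nz: "\<And>x. x \<in> S \<Longrightarrow> f x \<noteq> 0"
  shows "C1_on S (\<lambda>x. inverse (f x))"
proof (rule C1_onI)
  show "((\<lambda>x. inverse (f x)) has_derivative (\<lambda>v. - (inverse (f x) * dir_deriv f x v * inverse (f x)))) (at x)" if "x \<in> S" for x
    by (rule Deriv.has_derivative_inverse [OF nz [OF that] C1_on_has_derivative [OF f that]])
  show "continuous_on S (\<lambda>x. - (inverse (f x) * dir_deriv f x v * inverse (f x)))" for v
    using nz by (intro continuous_intros C1_on_continuous C1_on_deriv_continuous f) auto
qed

lemma C1_on_compose:
  fixes f :: "real^'m \<Rightarrow> real" and h :: "'v::real_normed_vector \<Rightarrow> real^'m"
  assumes f: "C1_on V f" and h: "C1_on U h" and UV: "h ` U \<subseteq> V"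
  shows "C1_on U (\<lambda>x. f (h x))"
    "x \<in> U \<Longrightarrow> dir_deriv (\<lambda>x. f (h x)) x v = dir_deriv f (h x) (dir_deriv h x v)"
proof -
  have d: "((\<lambda>x. f (h x)) has_derivative (\<lambda>v. dir_deriv f (h x) (dir_deriv h x v))) (at x)" if "x \<in> U" for x
    using UV that by (intro has_derivative_compose [OF C1_on_has_derivative [OF h that]] C1_on_has_derivative [OF f]) auto
  then show "x \<in> U \<Longrightarrow> dir_deriv (\<lambda>x. f (h x)) x v = dir_deriv f (h x) (dir_deriv h x v)"
    by (rule dir_deriv_eq)
  have "continuous_on U (\<lambda>x. \<Sum>a\<in>UNIV. dir_deriv h x v $ a * dir_deriv f (h x) (axis a 1))" for v
    by (intro continuous_intros C1_on_deriv_continuous [OF h]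
        continuous_on_compose2 [OF C1_on_deriv_continuous [OF f] C1_on_continuous [OF h] UV])
  moreover have "dir_deriv f (h x) (dir_deriv h x v) = (\<Sum>a\<in>UNIV. dir_deriv h x v $ a * dir_deriv f (h x) (axis a 1))"
    if "x \<in> U" for x v
    using UV that by (intro linear_axis_expansion linear_dir_deriv C1_on_differentiable [OF f]) auto
  ultimately have "continuous_on U (\<lambda>x. dir_deriv f (h x) (dir_deriv h x v))" for v
    by (simp cong: continuous_on_cong)
  with d show "C1_on U (\<lambda>x. f (h x))"
    by (rule C1_onI)
qed

lemma has_real_derivative_max_square: "((\<lambda>t. (max 0 t)\<^sup>2) has_real_derivative 2 * max 0 t) (at t)" for t :: real
proof (cases t "0::real" rule: linorder_cases)
  case less
  have "((\<lambda>t. 0) has_real_derivative 2 * max 0 t) (at t)" using less by simp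
  then show ?thesis
    by (rule has_field_derivative_transform_within_open [where S = "{..<0}"]) (use less in auto)
next
  case equal
  have "((\<lambda>h::real. (max 0 h)\<^sup>2 / h) \<longlongrightarrow> 0) (at 0)"
  proof (rule Lim_null_comparison)
    show "\<forall>\<^sub>F h::real in at 0. norm ((max 0 h)\<^sup>2 / h) \<le> \<bar>h\<bar>"
      by (rule always_eventually) (auto simp: max_def power2_eq_square)
    show "((\<lambda>h::real. \<bar>h\<bar>) \<longlongrightarrow> 0) (at 0)"
      using tendsto_rabs [OF tendsto_ident_at [of "0::real" UNIV]] by simp
  qed
  then show ?thesis using equal by (simp add: DERIV_def)
next
  case greater
  have "((\<lambda>t. t\<^sup>2) has_real_derivative 2 * max 0 t) (at t)" using greater by (auto intro!: derivative_eq_intros)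
  then show ?thesis
    by (rule has_field_derivative_transform_within_open [where S = "{0<..}"]) (use greater in auto)
qed

definition bump :: "'v::real_inner \<Rightarrow> real \<Rightarrow> 'v \<Rightarrow> real" where
  "bump a r x = (max 0 (r\<^sup>2 - (x - a) \<bullet> (x - a)))\<^sup>2"

lemma bump_nonneg: "bump a r x \<ge> 0"
  by (simp add: bump_def)

lemma bump_pos: "x \<in> ball a r \<Longrightarrow> bump a r x > 0"
proof -
  assume "x \<in> ball a r"
  then have "norm (x - a) < r" by (simp add: dist_norm norm_minus_commute)
  then have "(norm (x - a))\<^sup>2 < r\<^sup>2" by (intro power_strict_mono) auto
  then show ?thesis by (simp add: bump_def power2_norm_eq_inner)
qed

lemma bump_zero: "x \<notin> cball a r \<Longrightarrow> r \<ge> 0 \<Longrightarrow> bump a r x = 0"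
proof -
  assume "x \<notin> cball a r" "r \<ge> 0"
  then have "r < norm (x - a)" by (simp add: dist_norm norm_minus_commute)
  then have "r\<^sup>2 < (norm (x - a))\<^sup>2" using \<open>r \<ge> 0\<close> by (intro power_strict_mono) auto
  then show ?thesis by (simp add: bump_def power2_norm_eq_inner)
qed

lemma C1_on_bump: "C1_on UNIV (bump a r)"
proof (rule C1_onI)
  fix x :: 'a
  have "((\<lambda>x. r\<^sup>2 - (x - a) \<bullet> (x - a)) has_derivative (\<lambda>v. - 2 * ((x - a) \<bullet> v))) (at x)"
    by (auto intro!: derivative_eq_intros simp: inner_commute)
  from has_derivative_compose [OF this has_real_derivative_max_square [unfolded has_field_derivative_def]]
  show "(bump a r has_derivative (\<lambda>v. 2 * max 0 (r\<^sup>2 - (x - a) \<bullet> (x - a)) * (- 2 * ((x - a) \<bullet> v)))) (at x)"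
    by (simp add: bump_def [abs_def])
  show "continuous_on UNIV (\<lambda>x. 2 * max 0 (r\<^sup>2 - (x - a) \<bullet> (x - a)) * (- 2 * ((x - a) \<bullet> v)))" for v :: 'a
    by (intro continuous_intros)
qed

section \<open>Integrals of compactly supported functions\<close>

lemma integrable_compact_support:
  fixes F :: "'a::euclidean_space \<Rightarrow> real"
  assumes "continuous_on UNIV F" "compact K" "\<And>x. x \<notin> K \<Longrightarrow> F x = 0"
  shows "integrable lborel F"
proof -
  have "integrable lborel (\<lambda>x. indicator K x *\<^sub>R F x)"
    using assms by (intro borel_integrable_compact) (auto intro: continuous_on_subset)
  moreover have "indicator K x *\<^sub>R F x = F x" for x
    using assms(3) [of x] by (cases "x \<in> K") auto
  ultimately show ?thesis by (simp only:)
qed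

lemma lborel_integral_translate:
  fixes F :: "'a::euclidean_space \<Rightarrow> real"
  assumes "continuous_on UNIV F"
  shows "(\<integral>x. F (c + x) \<partial>lborel) = (\<integral>x. F x \<partial>lborel)"
proof -
  have "F \<in> borel_measurable borel"
    using assms by (rule borel_measurable_continuous_onI)
  then have "(\<integral>x. F x \<partial>distr lborel borel ((+) c)) = (\<integral>x. F (c + x) \<partial>lborel)"
    by (intro integral_distr) auto
  then show ?thesis by (simp add: lborel_distr_plus)
qed

lemma integral_dir_deriv_zero:
  fixes F :: "'a::euclidean_space \<Rightarrow> real"
  assumes F: "C1_on UNIV F" and K: "compact K" and zero: "\<And>x. x \<notin> K \<Longrightarrow> F x = 0"
  shows "(\<integral>x. dir_deriv F x v \<partial>lborel) = 0"
proof -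
  have Fc: "continuous_on UNIV F" by (rule C1_on_continuous [OF F])
  have D0: "dir_deriv F x v = 0" if "x \<notin> K" for x
  proof -
    have "((\<lambda>x. 0) has_derivative (\<lambda>v. 0)) (at x)" by simp
    then have "(F has_derivative (\<lambda>v. 0)) (at x)"
      by (rule has_derivative_transform_within_open [where s = "- K"])
        (use that zero compact_imp_closed [OF K] in auto)
    then show ?thesis by (rule dir_deriv_eq)
  qed
  have Dc: "continuous_on UNIV (\<lambda>x. dir_deriv F x v)"
    by (rule C1_on_deriv_continuous [OF F])
  have "bounded ((\<lambda>x. dir_deriv F x v) ` K)"
    using K Dc by (intro compact_imp_bounded compact_continuous_image) (auto intro: continuous_on_subset)
  then obtain B where "\<And>x. x \<in> K \<Longrightarrow> \<bar>dir_deriv F x v\<bar> \<le> B"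
    by (auto simp: bounded_iff)
  then have B: "\<bar>dir_deriv F x v\<bar> \<le> max B 0" for x
    using D0 [of x] by (cases "x \<in> K") (auto intro: max.coboundedI1)
  obtain R where R: "\<And>x. x \<in> K \<Longrightarrow> norm x \<le> R"
    using compact_imp_bounded [OF K] by (auto simp: bounded_iff)
  define s where "s n = 1 / real (Suc n)" for n
  have s: "0 < s n" "s n \<le> 1" for n by (auto simp: s_def)
  have s0: "s \<longlonglongrightarrow> 0"
    unfolding s_def using LIMSEQ_inverse_real_of_nat by (simp add: inverse_eq_divide)
  define u where "u n x = (F (s n *\<^sub>R v + x) - F x) / s n" for n x
  have line: "((\<lambda>t. F (t *\<^sub>R v + x)) has_real_derivative dir_deriv F (t *\<^sub>R v + x) v) (at t)" for t x
  proof -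
    have fd: "(F has_derivative (\<lambda>w. dir_deriv F (t *\<^sub>R v + x) w)) (at (t *\<^sub>R v + x))"
      by (rule C1_on_has_derivative [OF F]) simp
    have "((\<lambda>t. t *\<^sub>R v + x) has_derivative (\<lambda>k. k *\<^sub>R v)) (at t)"
      by (auto intro!: derivative_eq_intros)
    from has_derivative_compose [OF this fd]
    have "((\<lambda>t. F (t *\<^sub>R v + x)) has_derivative (\<lambda>k. dir_deriv F (t *\<^sub>R v + x) (k *\<^sub>R v))) (at t)" .
    moreover have "(\<lambda>k. dir_deriv F (t *\<^sub>R v + x) (k *\<^sub>R v)) = (*) (dir_deriv F (t *\<^sub>R v + x) v)"
      using linear_cmul [OF linear_dir_deriv [OF C1_on_differentiable [OF F]]] by (auto simp: mult.commute)
    ultimately show ?thesis unfolding has_field_derivative_def by (simp only:)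
  qed
  have u0: "(\<integral>x. u n x \<partial>lborel) = 0" for n
  proof -
    have 1: "integrable lborel F"
      by (rule integrable_compact_support [OF Fc K zero])
    have 2: "integrable lborel (\<lambda>x. F (s n *\<^sub>R v + x))"
    proof (rule integrable_compact_support)
      show "continuous_on UNIV (\<lambda>x. F (s n *\<^sub>R v + x))"
        by (rule continuous_on_compose2 [OF Fc]) (auto intro!: continuous_intros)
      show "compact ((+) (- (s n *\<^sub>R v)) ` K)"
        using K by (rule compact_translation)
      show "F (s n *\<^sub>R v + x) = 0" if "x \<notin> (+) (- (s n *\<^sub>R v)) ` K" for x
      proof (rule zero)
        show "s n *\<^sub>R v + x \<notin> K"
        proof
          assume "s n *\<^sub>R v + x \<in> K"
          then have "- (s n *\<^sub>R v) + (s n *\<^sub>R v + x) \<in> (+) (- (s n *\<^sub>R v)) ` K" by (rule imageI)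
          then show False using that by simp
        qed
      qed
    qed
    show ?thesis
      unfolding u_def using 1 2 by (simp add: lborel_integral_translate [OF Fc])
  qed
  have "(\<lambda>n. \<integral>x. u n x \<partial>lborel) \<longlonglongrightarrow> (\<integral>x. dir_deriv F x v \<partial>lborel)"
  proof (rule integral_dominated_convergence)
    show "integrable lborel (\<lambda>x. max B 0 * indicator (cball 0 (R + norm v)) x)"
      by (intro integrable_mult_right integrable_real_indicator) (use emeasure_lborel_cball_finite [of 0 "R + norm v"] in \<open>auto simp: infinity_ennreal_def\<close>)
    show "(\<lambda>x. dir_deriv F x v) \<in> borel_measurable lborel"
      using borel_measurable_continuous_onI [OF Dc] by simp
    show "u n \<in> borel_measurable lborel" for n
      unfolding u_def using s [of n]
      by (simp, intro borel_measurable_continuous_onI continuous_intros continuous_on_compose2 [OF Fc]) auto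
    show "AE x in lborel. (\<lambda>n. u n x) \<longlonglongrightarrow> dir_deriv F x v"
    proof (rule AE_I2)
      fix x
      have "((\<lambda>h. (F (h *\<^sub>R v + x) - F x) / h) \<longlongrightarrow> dir_deriv F x v) (at 0)"
        using line [of x 0] by (simp add: DERIV_def)
      moreover have "filterlim s (at 0) sequentially"
        using s0 s by (simp add: filterlim_at eventually_sequentially less_imp_neq [symmetric])
      ultimately show "(\<lambda>n. u n x) \<longlonglongrightarrow> dir_deriv F x v"
        unfolding u_def by (rule filterlim_compose)
    qed
    show "AE x in lborel. norm (u n x) \<le> max B 0 * indicator (cball 0 (R + norm v)) x" for n
    proof (rule AE_I2)
      fix x
      have b: "\<bar>u n x\<bar> \<le> max B 0"
      proof -
        obtain z where "F (s n *\<^sub>R v + x) - F (0 *\<^sub>R v + x) = (s n - 0) * dir_deriv F (z *\<^sub>R v + x) v"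
          using MVT2 [OF s(1) [of n], of "\<lambda>t. F (t *\<^sub>R v + x)" "\<lambda>t. dir_deriv F (t *\<^sub>R v + x) v"] line by blast
        then have "u n x = dir_deriv F (z *\<^sub>R v + x) v"
          using s [of n] by (simp add: u_def)
        then show ?thesis using B by simp
      qed
      show "norm (u n x) \<le> max B 0 * indicator (cball 0 (R + norm v)) x"
      proof (cases "x \<in> cball 0 (R + norm v)")
        case True
        then show ?thesis using b by simp
      next
        case False
        then have x: "norm x > R + norm v" by simp
        have "x \<notin> K" using R [of x] x norm_ge_zero [of v] by linarith
        moreover have "s n *\<^sub>R v + x \<notin> K"
        proof
          assume "s n *\<^sub>R v + x \<in> K"
          then have "norm (s n *\<^sub>R v + x) \<le> R" by (rule R)
          moreover have "norm (s n *\<^sub>R v) \<le> norm v"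
            using s [of n] by (simp add: mult_left_le_one_le)
          moreover have "norm x \<le> norm (s n *\<^sub>R v + x) + norm (s n *\<^sub>R v)"
            using norm_triangle_ineq4 [of "s n *\<^sub>R v + x" "s n *\<^sub>R v"] by simp
          ultimately show False using x by linarith
        qed
        ultimately show ?thesis by (simp add: u_def zero)
      qed
    qed
  qed
  then show ?thesis by (simp add: u0 LIMSEQ_const_iff)
qed

lemma lborel_change_of_variables:
  fixes f :: "real^'n::{finite,wellorder} \<Rightarrow> real" and h :: "real^'n::_ \<Rightarrow> real^'n::_"
  assumes U: "open U" and h: "\<And>x. x \<in> U \<Longrightarrow> (h has_derivative h' x) (at x)" and inj: "inj_on h U"
    and 1: "integrable lborel (\<lambda>x. if x \<in> U then \<bar>det (matrix (h' x))\<bar> * f (h x) else 0)"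
    and 2: "integrable lborel (\<lambda>y. if y \<in> h ` U then f y else 0)"
  shows "(\<integral>x. (if x \<in> U then \<bar>det (matrix (h' x))\<bar> * f (h x) else 0) \<partial>lborel) =
    (\<integral>y. (if y \<in> h ` U then f y else 0) \<partial>lborel)"
proof -
  let ?v = "\<lambda>t. t *\<^sub>R (axis 1 1 :: real^1)"
  have v: "bounded_linear ?v" by (rule bounded_linear_scaleR_left)
  have "(\<lambda>y. if y \<in> h ` U then f y else 0) absolutely_integrable_on UNIV"
    using 2 by (simp add: set_integrable_def integrable_completion)
  then have f: "f absolutely_integrable_on h ` U"
    by (simp add: absolutely_integrable_restrict_UNIV)
  have "(\<lambda>x. if x \<in> U then \<bar>det (matrix (h' x))\<bar> * f (h x) else 0) absolutely_integrable_on UNIV"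
    using 1 by (simp add: set_integrable_def integrable_completion)
  then have fh: "(\<lambda>x. \<bar>det (matrix (h' x))\<bar> * f (h x)) absolutely_integrable_on U"
    by (simp add: absolutely_integrable_restrict_UNIV)
  have "integral (h ` U) (?v \<circ> f) = integral U (\<lambda>x. \<bar>det (matrix (h' x))\<bar> *\<^sub>R (?v \<circ> f) (h x))"
  proof (rule integral_change_of_variables [OF _ _ inj])
    show "U \<in> sets lebesgue" using U by (simp add: borel_open)
    show "(h has_derivative h' x) (at x within U)" if "x \<in> U" for x
      using h [OF that] by (rule has_derivative_at_withinI)
    show "(?v \<circ> f) absolutely_integrable_on h ` U \<or>
      (\<lambda>x. \<bar>det (matrix (h' x))\<bar> *\<^sub>R (?v \<circ> f) (h x)) absolutely_integrable_on U"
      using absolutely_integrable_linear [OF f v] by blast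
  qed
  also have "(\<lambda>x. \<bar>det (matrix (h' x))\<bar> *\<^sub>R (?v \<circ> f) (h x)) = ?v \<circ> (\<lambda>x. \<bar>det (matrix (h' x))\<bar> * f (h x))"
    by (simp add: o_def)
  finally have "?v (integral (h ` U) f) = ?v (integral U (\<lambda>x. \<bar>det (matrix (h' x))\<bar> * f (h x)))"
    unfolding integral_linear [OF set_lebesgue_integral_eq_integral(1) [OF f] v]
      integral_linear [OF set_lebesgue_integral_eq_integral(1) [OF fh] v] .
  then have "integral (h ` U) f = integral U (\<lambda>x. \<bar>det (matrix (h' x))\<bar> * f (h x))"
    by (simp add: axis_eq_0_iff)
  then show ?thesis
    using integral_lborel [OF 1] integral_lborel [OF 2] by (simp add: integral_restrict_UNIV)
qed

lemma continuous_on_extend_zero: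
  fixes f :: "'a::euclidean_space \<Rightarrow> real"
  assumes S: "open S" and K: "compact K" "K \<subseteq> S" and f: "continuous_on S f"
    and zero: "\<And>x. x \<in> S \<Longrightarrow> x \<notin> K \<Longrightarrow> f x = 0"
  shows "continuous_on UNIV (\<lambda>x. if x \<in> S then f x else 0)"
proof -
  have "continuous_on (S \<union> - K) (\<lambda>x. if x \<in> S then f x else 0)"
  proof (rule continuous_on_cases_local_open [where f = f and g = "\<lambda>x. 0"])
    have "open (- K)" using compact_imp_closed [OF K(1)] by (simp add: open_Compl)
    then show "openin (top_of_set (S \<union> - K)) S" "openin (top_of_set (S \<union> - K)) (- K)"
      using S by (auto intro: open_subset)
  qed (use f zero in auto)
  moreover have "S \<union> - K = UNIV" using K(2) by auto
  ultimately show ?thesis by simp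
qed

lemma C1_on_extend_zero:
  fixes f :: "'a::euclidean_space \<Rightarrow> real"
  assumes S: "open S" and K: "compact K" "K \<subseteq> S" and f: "C1_on S f"
    and zero: "\<And>x. x \<in> S \<Longrightarrow> x \<notin> K \<Longrightarrow> f x = 0"
  shows "C1_on UNIV (\<lambda>x. if x \<in> S then f x else 0)"
proof (rule C1_on_local)
  fix x
  show "\<exists>U. open U \<and> x \<in> U \<and> C1_on U (\<lambda>x. if x \<in> S then f x else 0)"
  proof (cases "x \<in> S")
    case True
    moreover have "C1_on S (\<lambda>x. if x \<in> S then f x else 0)"
      by (rule C1_on_cong [OF S _ f]) simp
    ultimately show ?thesis using S by blast
  next
    case False
    have "open (- K)" using compact_imp_closed [OF K(1)] by (simp add: open_Compl)
    moreover have "C1_on (- K) (\<lambda>x. if x \<in> S then f x else 0)"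
      by (rule C1_on_cong [OF calculation _ C1_on_const [of _ 0]]) (use zero in auto)
    ultimately show ?thesis using False K(2) by blast
  qed
qed

lemma nonneg_integral_zero_imp_zero:
  fixes f :: "'a::euclidean_space \<Rightarrow> real"
  assumes f: "continuous_on UNIV f" "\<And>x. f x \<ge> 0" "integrable lborel f" "(\<integral>x. f x \<partial>lborel) = 0"
  shows "f x = 0"
proof (rule ccontr)
  assume "f x \<noteq> 0"
  have "open {x. f x \<noteq> 0}"
    using open_Collect_neq [OF f(1) continuous_on_const [of UNIV 0]] by simp
  then obtain r where r: "r > 0" "ball x r \<subseteq> {x. f x \<noteq> 0}"
    using \<open>f x \<noteq> 0\<close> by (auto simp: open_contains_ball)
  have "AE x in lborel. f x = 0"
    using f integral_nonneg_eq_0_iff_AE [of lborel f] by auto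
  then have "{x. f x \<noteq> 0} \<in> null_sets lborel"
    using AE_iff_null_sets [of "{x. f x \<noteq> 0}" lborel] \<open>open {x. f x \<noteq> 0}\<close> by (auto simp: borel_open)
  then have "ball x r \<in> null_sets lborel"
    using r(2) by (auto intro: null_sets_subset)
  then have "emeasure lborel (ball x r) = 0" by auto
  then show False
    using r(1) open_not_negligible [of "ball x r"] negligible_iff_null_sets
    by (metis ball_eq_empty linorder_not_le null_sets_completionI open_ball \<open>ball x r \<in> null_sets lborel\<close>)
qed

section \<open>The divergence theorem on a compact manifold\<close>

abbreviation inv_chart :: "('a, 'n::finite) chart \<Rightarrow> real^'n \<Rightarrow> 'a" where
  "inv_chart c \<equiv> inv_into (fst c) (snd c)"

definition overlap :: "('a, 'n::finite) chart \<Rightarrow> ('a, 'n) chart \<Rightarrow> (real^'n) set" where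
  "overlap c d = snd c ` (fst c \<inter> fst d)"

locale compact_manifold =
  fixes M :: "'a topology" and A :: "('a, 'n::finite) chart set"
  assumes manifold: "smooth_manifold M A" and compact_M: "compact_space M"
begin

lemma chart_open: "c \<in> A \<Longrightarrow> openin M (fst c)" "c \<in> A \<Longrightarrow> open (target c)"
  using manifold by (auto simp: smooth_manifold_def)

lemma chart_subset: "c \<in> A \<Longrightarrow> fst c \<subseteq> topspace M"
  using chart_open(1) openin_subset by blast

lemma chart_cover: "q \<in> topspace M \<Longrightarrow> \<exists>c\<in>A. q \<in> fst c"
  using manifold by (auto simp: smooth_manifold_def)

lemma chart_homeomorphic: "c \<in> A \<Longrightarrow> homeomorphic_map (subtopology M (fst c)) (top_of_set (target c)) (snd c)"
  using manifold by (auto simp: smooth_manifold_def)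

lemma topspace_chart: "c \<in> A \<Longrightarrow> topspace (subtopology M (fst c)) = fst c"
  by (simp add: topspace_subtopology Int_absorb1 chart_subset)

lemma chart_inj: "c \<in> A \<Longrightarrow> inj_on (snd c) (fst c)"
  using homeomorphic_imp_injective_map [OF chart_homeomorphic] topspace_chart by fastforce

lemma inv_chart_left: "c \<in> A \<Longrightarrow> q \<in> fst c \<Longrightarrow> inv_chart c (snd c q) = q"
  using chart_inj by (simp add: inv_into_f_f)

lemma inv_chart_mem: "x \<in> target c \<Longrightarrow> inv_chart c x \<in> fst c"
  by (simp add: target_def inv_into_into)

lemma inv_chart_right: "x \<in> target c \<Longrightarrow> snd c (inv_chart c x) = x"
  by (simp add: target_def f_inv_into_f)

lemma open_chart_image:
  assumes c: "c \<in> A" and V: "openin M V" "V \<subseteq> fst c"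
  shows "open (snd c ` V)"
proof -
  have "openin (subtopology M (fst c)) V"
    using V by (metis inf.absorb_iff2 inf_commute openin_subtopology)
  then have "openin (top_of_set (target c)) (snd c ` V)"
    using homeomorphic_imp_open_map [OF chart_homeomorphic [OF c]] by (auto simp: open_map_def)
  then show ?thesis
    using chart_open(2) [OF c] openin_open_trans by blast
qed

lemma overlap_open: "c \<in> A \<Longrightarrow> d \<in> A \<Longrightarrow> open (overlap c d)"
  unfolding overlap_def by (intro open_chart_image openin_Int chart_open) auto

lemma overlap_subset: "overlap c d \<subseteq> target c"
  by (auto simp: overlap_def target_def)

lemma overlap_iff: "c \<in> A \<Longrightarrow> x \<in> overlap c d \<longleftrightarrow> x \<in> target c \<and> inv_chart c x \<in> fst d"
  by (auto simp: overlap_def target_def inv_chart_left)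

lemma inv_chart_transition: "d \<in> A \<Longrightarrow> c \<in> A \<Longrightarrow> x \<in> overlap c d \<Longrightarrow> inv_chart d (transition c d x) = inv_chart c x"
  by (simp add: transition_def overlap_iff inv_chart_left)

lemma transition_overlap: "c \<in> A \<Longrightarrow> d \<in> A \<Longrightarrow> x \<in> overlap c d \<Longrightarrow> transition c d x \<in> overlap d c"
  by (auto simp: transition_def overlap_def inv_chart_left)

lemma transition_inverse: "c \<in> A \<Longrightarrow> d \<in> A \<Longrightarrow> x \<in> overlap c d \<Longrightarrow> transition d c (transition c d x) = x"
  using overlap_subset by (auto simp: transition_def overlap_iff inv_chart_left inv_chart_right)

lemma transition_image: "c \<in> A \<Longrightarrow> d \<in> A \<Longrightarrow> transition c d ` overlap c d = overlap d c"
  using transition_overlap transition_inverse by (metis (no_types, lifting) image_eqI subsetI subset_antisym image_subsetI)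

lemma transition_inj: "c \<in> A \<Longrightarrow> d \<in> A \<Longrightarrow> inj_on (transition c d) (overlap c d)"
  by (metis inj_onI transition_inverse)

lemma transition_smooth: "c \<in> A \<Longrightarrow> d \<in> A \<Longrightarrow> smooth_on (overlap c d) (transition c d)"
  using manifold by (auto simp: smooth_manifold_def overlap_def)

lemma transition_C1: "c \<in> A \<Longrightarrow> d \<in> A \<Longrightarrow> C1_on (overlap c d) (transition c d)"
  by (intro smooth_on_C1 transition_smooth)

lemma closedin_inv_chart_image:
  assumes c: "c \<in> A" and K: "compact K" "K \<subseteq> target c"
  shows "closedin M (inv_chart c ` K)"
proof -
  obtain h where h: "homeomorphic_maps (subtopology M (fst c)) (top_of_set (target c)) (snd c) h"
    using chart_homeomorphic [OF c] homeomorphic_map_maps by blast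
  have "h x = inv_chart c x" if "x \<in> topspace (top_of_set (target c))" for x
  proof -
    have "h x \<in> fst c" "snd c (h x) = x"
      using h that topspace_chart [OF c] unfolding homeomorphic_maps_def continuous_map_def by auto
    then show ?thesis using inv_chart_left [OF c] by metis
  qed
  then have "continuous_map (top_of_set (target c)) (subtopology M (fst c)) (inv_chart c)"
    using h continuous_map_eq unfolding homeomorphic_maps_def by blast
  then have "continuous_map (top_of_set (target c)) M (inv_chart c)"
    by (simp add: continuous_map_in_subtopology)
  moreover have "compactin (top_of_set (target c)) K"
    using K by (simp add: compactin_subtopology)
  ultimately have "compactin M (inv_chart c ` K)"
    by (metis image_compactin)
  then show ?thesis
    using manifold compactin_imp_closedin by (auto simp: smooth_manifold_def)
qed

lemma C1_on_chart_bump: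
  assumes c: "c \<in> A" and r: "r \<ge> 0" "cball a r \<subseteq> target c" and d: "d \<in> A"
  shows "C1_on (target d) (\<lambda>x. if inv_chart d x \<in> fst c then bump a r (snd c (inv_chart d x)) else 0)" (is "C1_on _ ?b")
proof (rule C1_on_local)
  fix x assume x: "x \<in> target d"
  show "\<exists>U. open U \<and> x \<in> U \<and> C1_on U ?b"
  proof (cases "inv_chart d x \<in> fst c")
    case True
    have "C1_on (overlap d c) (\<lambda>x. bump a r (transition d c x))"
      by (rule C1_on_compose(1) [OF C1_on_bump transition_C1]) (use c d in auto)
    then have "C1_on (overlap d c) ?b"
      by (rule C1_on_cong [OF overlap_open, rotated -1]) (use c d in \<open>auto simp: overlap_iff transition_def\<close>)
    then show ?thesis
      using True x overlap_open [OF d c] overlap_iff [OF d] by blast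
  next
    case False
    let ?V = "topspace M - inv_chart c ` cball a r"
    let ?U = "snd d ` (fst d \<inter> ?V)"
    have "openin M ?V"
      using closedin_inv_chart_image [OF c compact_cball r(2)] by (simp add: closedin_def)
    then have U: "open ?U"
      by (intro open_chart_image d openin_Int chart_open) auto
    have "inv_chart d x \<notin> inv_chart c ` cball a r"
    proof
      assume "inv_chart d x \<in> inv_chart c ` cball a r"
      then obtain y where "inv_chart d x = inv_chart c y" "y \<in> target c" using r(2) by blast
      then show False using False inv_chart_mem [of y c] by simp
    qed
    moreover have "inv_chart d x \<in> fst d" "snd d (inv_chart d x) = x"
      using inv_chart_mem [OF x] inv_chart_right [OF x] by auto
    ultimately have "x \<in> ?U"
      using chart_subset [OF d] by (auto intro!: image_eqI [of x "snd d" "inv_chart d x"])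
    moreover have "C1_on ?U ?b"
    proof (rule C1_on_cong [OF U _ C1_on_const [of _ 0]])
      fix y assume "y \<in> ?U"
      then have y: "inv_chart d y \<notin> inv_chart c ` cball a r"
        using inv_chart_left [OF d] by auto
      have "snd c (inv_chart d y) \<notin> cball a r" if "inv_chart d y \<in> fst c"
        using y inv_chart_left [OF c that] by (metis image_eqI)
      then show "0 = ?b y" using bump_zero [OF _ r(1)] by auto
    qed
    ultimately show ?thesis using U by blast
  qed
qed

lemma partition_of_unity:
  obtains I :: "'a set" and c K and \<rho> :: "'a \<Rightarrow> 'a \<Rightarrow> real" where "finite I"
    "\<And>i. i \<in> I \<Longrightarrow> c i \<in> A" "\<And>i. i \<in> I \<Longrightarrow> compact (K i)" "\<And>i. i \<in> I \<Longrightarrow> K i \<subseteq> target (c i)"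
    "\<And>i q. i \<in> I \<Longrightarrow> \<rho> i q \<ge> 0" "\<And>q. q \<in> topspace M \<Longrightarrow> (\<Sum>i\<in>I. \<rho> i q) = 1"
    "\<And>i q. i \<in> I \<Longrightarrow> \<rho> i q \<noteq> 0 \<Longrightarrow> q \<in> fst (c i) \<and> snd (c i) q \<in> K i"
    "\<And>i d. i \<in> I \<Longrightarrow> d \<in> A \<Longrightarrow> C1_on (target d) (\<lambda>x. \<rho> i (inv_chart d x))"
proof -
  have "\<exists>c r. c \<in> A \<and> p \<in> fst c \<and> r > 0 \<and> cball (snd c p) r \<subseteq> target c" if p: "p \<in> topspace M" for p
  proof -
    obtain c where c: "c \<in> A" "p \<in> fst c" using chart_cover [OF p] by blast
    then have "snd c p \<in> target c" by (simp add: target_def)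
    then show ?thesis
      using c chart_open(2) [OF c(1)] by (metis open_contains_cball)
  qed
  then obtain c r where cr: "\<And>p. p \<in> topspace M \<Longrightarrow>
      c p \<in> A \<and> p \<in> fst (c p) \<and> r p > 0 \<and> cball (snd (c p) p) (r p) \<subseteq> target (c p)"
    by metis
  define U where "U p = inv_chart (c p) ` ball (snd (c p) p) (r p)" for p
  have U: "openin M (U p)" "p \<in> U p" if p: "p \<in> topspace M" for p
  proof -
    have c: "c p \<in> A" and b: "ball (snd (c p) p) (r p) \<subseteq> target (c p)"
      using cr [OF p] ball_subset_cball by blast+
    have "U p = {q \<in> topspace (subtopology M (fst (c p))). snd (c p) q \<in> ball (snd (c p) p) (r p)}"
      unfolding topspace_chart [OF c] U_def
    proof (intro set_eqI iffI)
      fix q assume "q \<in> inv_chart (c p) ` ball (snd (c p) p) (r p)"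
      then obtain x where x: "q = inv_chart (c p) x" "x \<in> ball (snd (c p) p) (r p)" by blast
      then have "x \<in> target (c p)" using b by blast
      then show "q \<in> {q \<in> fst (c p). snd (c p) q \<in> ball (snd (c p) p) (r p)}"
        using x inv_chart_mem [of x "c p"] inv_chart_right [of x "c p"] by simp
    next
      fix q assume q: "q \<in> {q \<in> fst (c p). snd (c p) q \<in> ball (snd (c p) p) (r p)}"
      then have "q = inv_chart (c p) (snd (c p) q)" using inv_chart_left [OF c] by simp
      with q show "q \<in> inv_chart (c p) ` ball (snd (c p) p) (r p)" by blast
    qed
    moreover have "openin (top_of_set (target (c p))) (ball (snd (c p) p) (r p))"
      using b by (simp add: open_subset)
    ultimately have "openin (subtopology M (fst (c p))) (U p)"
      using openin_continuous_map_preimage [OF homeomorphic_imp_continuous_map [OF chart_homeomorphic [OF c]]]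
      by (simp only:)
    then show "openin M (U p)"
      using openin_trans_full [OF _ chart_open(1) [OF c]] by blast
    show "p \<in> U p"
      unfolding U_def using cr [OF p] inv_chart_left [OF c] by (auto intro!: image_eqI [of _ _ "snd (c p) p"])
  qed
  have "\<exists>\<F>. finite \<F> \<and> \<F> \<subseteq> U ` topspace M \<and> topspace M \<subseteq> \<Union> \<F>"
  proof -
    have "\<forall>V\<in>U ` topspace M. openin M V" "topspace M \<subseteq> \<Union> (U ` topspace M)"
      using U by blast+
    with compact_M show ?thesis
      unfolding compact_space_alt by (meson image_subset_iff)
  qed
  then obtain I where I: "finite I" "I \<subseteq> topspace M" "topspace M \<subseteq> (\<Union>p\<in>I. U p)"
    by (metis finite_subset_image)
  define b where "b p q = (if q \<in> fst (c p) then bump (snd (c p) p) (r p) (snd (c p) q) else 0)" for p q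
  have b0: "b p q \<ge> 0" for p q by (simp add: b_def bump_nonneg)
  have bpos: "(\<Sum>p\<in>I. b p q) > 0" if q: "q \<in> topspace M" for q
  proof -
    obtain p where p: "p \<in> I" "q \<in> U p" using I(3) q by blast
    have c: "c p \<in> A" "ball (snd (c p) p) (r p) \<subseteq> target (c p)"
      using cr I(2) p(1) ball_subset_cball by blast+
    obtain y where y: "q = inv_chart (c p) y" "y \<in> ball (snd (c p) p) (r p)"
      using p(2) unfolding U_def by blast
    then have "y \<in> target (c p)" using c(2) by blast
    then have "q \<in> fst (c p)" "snd (c p) q \<in> ball (snd (c p) p) (r p)"
      using y inv_chart_mem [of y "c p"] inv_chart_right [of y "c p"] by auto
    then have "b p q > 0" by (simp only: b_def if_True bump_pos)
    then show ?thesis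
      using p(1) I(1) b0 by (intro sum_pos2) auto
  qed
  have bC: "C1_on (target d) (\<lambda>x. b p (inv_chart d x))" if "p \<in> I" "d \<in> A" for p d
    unfolding b_def using cr I(2) that by (intro C1_on_chart_bump) (auto simp: less_imp_le subset_eq)
  show thesis
  proof (rule that [of I c "\<lambda>p. cball (snd (c p) p) (r p)" "\<lambda>p q. b p q * inverse (\<Sum>p\<in>I. b p q)"])
    show "b p q * inverse (\<Sum>p\<in>I. b p q) \<ge> 0" for p q
      using b0 by (simp add: sum_nonneg)
    show "(\<Sum>i\<in>I. b i q * inverse (\<Sum>p\<in>I. b p q)) = 1" if "q \<in> topspace M" for q
      using bpos [OF that] by (simp add: sum_distrib_right [symmetric])
    show "q \<in> fst (c i) \<and> snd (c i) q \<in> cball (snd (c i) i) (r i)"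
      if "i \<in> I" "b i q * inverse (\<Sum>p\<in>I. b p q) \<noteq> 0" for i q
    proof -
      have "b i q \<noteq> 0" using that(2) by auto
      moreover have "r i \<ge> 0" using cr [of i] I(2) that(1) by (simp add: less_imp_le subset_eq)
      ultimately show ?thesis
        using bump_zero [of "snd (c i) q" "snd (c i) i" "r i"] unfolding b_def by presburger
    qed
    show "C1_on (target d) (\<lambda>x. b i (inv_chart d x) * inverse (\<Sum>p\<in>I. b p (inv_chart d x)))"
      if "i \<in> I" "d \<in> A" for i d
    proof (intro C1_on_mult C1_on_inverse C1_on_sum bC that)
      fix x assume "x \<in> target d"
      then have "inv_chart d x \<in> topspace M" using inv_chart_mem chart_subset that(2) by blast
      then show "(\<Sum>p\<in>I. b p (inv_chart d x)) \<noteq> 0" using bpos by force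
    qed
  qed (use I cr in auto)
qed

end

theorem nonneg_divergence_zero:
  fixes A :: "('a, 'n::{finite,wellorder}) chart set"
    and W :: "('a, 'n::_) chart \<Rightarrow> real^'n::_ \<Rightarrow> real^'n::_" and D :: "('a, 'n::_) chart \<Rightarrow> real^'n::_ \<Rightarrow> real"
  assumes M: "smooth_manifold M A" "compact_space M"
    and W: "\<And>c a. c \<in> A \<Longrightarrow> C1_on (target c) (\<lambda>x. W c x $ a)"
    and D: "\<And>c x. c \<in> A \<Longrightarrow> x \<in> target c \<Longrightarrow> D c x = (\<Sum>a\<in>UNIV. dir_deriv (\<lambda>x. W c x $ a) x (axis a 1))"
    and W_tr: "\<And>c d x. c \<in> A \<Longrightarrow> d \<in> A \<Longrightarrow> x \<in> overlap c d \<Longrightarrow>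
      dir_deriv (transition c d) x (W c x) = \<bar>det (matrix (dir_deriv (transition c d) x))\<bar> *\<^sub>R W d (transition c d x)"
    and D_tr: "\<And>c d x. c \<in> A \<Longrightarrow> d \<in> A \<Longrightarrow> x \<in> overlap c d \<Longrightarrow>
      D c x = \<bar>det (matrix (dir_deriv (transition c d) x))\<bar> * D d (transition c d x)"
    and D_nonneg: "\<And>c x. c \<in> A \<Longrightarrow> x \<in> target c \<Longrightarrow> 0 \<le> D c x"
    and c: "c \<in> A" and x: "x \<in> target c"
  shows "D c x = 0"
proof -
  interpret compact_manifold M A using M by unfold_locales
  obtain I :: "'a set" and ch K and \<rho> :: "'a \<Rightarrow> 'a \<Rightarrow> real" where I: "finite I"
    and ch: "\<And>i. i \<in> I \<Longrightarrow> ch i \<in> A" and K: "\<And>i. i \<in> I \<Longrightarrow> compact (K i)" "\<And>i. i \<in> I \<Longrightarrow> K i \<subseteq> target (ch i)"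
    and \<rho>: "\<And>i q. i \<in> I \<Longrightarrow> \<rho> i q \<ge> 0" and \<rho>_sum: "\<And>q. q \<in> topspace M \<Longrightarrow> (\<Sum>i\<in>I. \<rho> i q) = 1"
    and \<rho>_supp: "\<And>i q. i \<in> I \<Longrightarrow> \<rho> i q \<noteq> 0 \<Longrightarrow> q \<in> fst (ch i) \<and> snd (ch i) q \<in> K i"
    and \<rho>_C1: "\<And>i d. i \<in> I \<Longrightarrow> d \<in> A \<Longrightarrow> C1_on (target d) (\<lambda>x. \<rho> i (inv_chart d x))"
    by (rule partition_of_unity) (rule that; assumption)
  define R where "R j c x = \<rho> j (inv_chart c x)" for j and c :: "('a, 'n) chart" and x
  define F where "F j c x = dir_deriv (R j c) x (W c x) + R j c x * D c x" for j c x
  have R_C1: "C1_on (target c) (R j c)" if "j \<in> I" "c \<in> A" for j c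
    using \<rho>_C1 [OF that] by (simp add: R_def [abs_def])
  have top: "inv_chart c x \<in> topspace M" if "c \<in> A" "x \<in> target c" for c x
    using inv_chart_mem [OF that(2)] chart_subset [OF that(1)] by blast
  have R_sum: "(\<Sum>j\<in>I. R j c x) = 1" if "c \<in> A" "x \<in> target c" for c x
    unfolding R_def by (rule \<rho>_sum [OF top [OF that]])
  have R_supp: "R j (ch j) x = 0" if "j \<in> I" "x \<in> target (ch j)" "x \<notin> K j" for j x
    using \<rho>_supp [OF that(1), of "inv_chart (ch j) x"] inv_chart_right [OF that(2)] that(3) by (auto simp: R_def)
  have R_tr: "R j c x = R j d (transition c d x)" if "c \<in> A" "d \<in> A" "x \<in> overlap c d" for j c d x
    unfolding R_def using inv_chart_transition that by simp
  have F_tr: "F j c x = \<bar>det (matrix (dir_deriv (transition c d) x))\<bar> * F j d (transition c d x)"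
    if j: "j \<in> I" and cd: "c \<in> A" "d \<in> A" and x: "x \<in> overlap c d" for j c d x
  proof -
    let ?\<tau> = "transition c d"
    let ?m = "\<bar>det (matrix (dir_deriv ?\<tau> x))\<bar>"
    have \<tau>x: "?\<tau> x \<in> target d" using transition_overlap [OF cd x] overlap_subset by blast
    have "dir_deriv (R j c) x v = dir_deriv (R j d) (?\<tau> x) (dir_deriv ?\<tau> x v)" for v
    proof -
      have "dir_deriv (R j c) x v = dir_deriv (\<lambda>y. R j d (?\<tau> y)) x v"
        using dir_deriv_cong(1) [OF overlap_open [OF cd] x R_tr [OF cd]] by simp
      also have "\<dots> = dir_deriv (R j d) (?\<tau> x) (dir_deriv ?\<tau> x v)"
        using overlap_subset [of d c] transition_image [OF cd]
        by (intro C1_on_compose(2) [OF R_C1 [OF j cd(2)] transition_C1 [OF cd] _ x]) simp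
      finally show ?thesis .
    qed
    then have "dir_deriv (R j c) x (W c x) = dir_deriv (R j d) (?\<tau> x) (?m *\<^sub>R W d (?\<tau> x))"
      using W_tr [OF cd x] by simp
    also have "\<dots> = ?m * dir_deriv (R j d) (?\<tau> x) (W d (?\<tau> x))"
      using linear_cmul [OF linear_dir_deriv [OF C1_on_differentiable [OF R_C1 [OF j cd(2)] \<tau>x]]] by simp
    finally show ?thesis
      unfolding F_def R_tr [OF cd x] D_tr [OF cd x] by (simp add: algebra_simps)
  qed
  have F_zero: "F j c x = 0" if j: "j \<in> I" and c: "c \<in> A" and x: "x \<in> target c" and R0: "R j c x = 0" for j c x
  proof -
    have "(\<lambda>v. dir_deriv (R j c) x v) = (\<lambda>v. 0)"
    proof (rule differential_zero_maxmin [OF x chart_open(2) [OF c] C1_on_has_derivative [OF R_C1 [OF j c] x]])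
      show "(\<forall>y\<in>target c. R j c y \<le> R j c x) \<or> (\<forall>y\<in>target c. R j c x \<le> R j c y)"
        unfolding R0 using \<rho> [OF j] by (simp add: R_def)
    qed
    then have "dir_deriv (R j c) x (W c x) = 0" by metis
    then show ?thesis by (simp add: F_def R0)
  qed
  have D_cont: "continuous_on (target c) (D c)" if "c \<in> A" for c
  proof -
    have "continuous_on (target c) (\<lambda>x. \<Sum>a\<in>UNIV. dir_deriv (\<lambda>x. W c x $ a) x (axis a 1))"
      by (intro continuous_intros C1_on_deriv_continuous W that)
    then show ?thesis using D [OF that] by (simp cong: continuous_on_cong)
  qed
  have W_exp: "dir_deriv (R j c) x (W c x) = (\<Sum>a\<in>UNIV. W c x $ a * dir_deriv (R j c) x (axis a 1))"
    if "j \<in> I" "c \<in> A" "x \<in> target c" for j c x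
    by (intro linear_axis_expansion linear_dir_deriv C1_on_differentiable [OF R_C1] that)
  have F_cont: "continuous_on (target c) (F j c)" if "j \<in> I" "c \<in> A" for j c
  proof -
    have "continuous_on (target c) (\<lambda>x. (\<Sum>a\<in>UNIV. W c x $ a * dir_deriv (R j c) x (axis a 1)) + R j c x * D c x)"
      by (intro continuous_intros C1_on_deriv_continuous C1_on_continuous [OF W] C1_on_continuous [OF R_C1] R_C1 D_cont that)
    then show ?thesis
      unfolding F_def using W_exp [OF that] by (simp cong: continuous_on_cong)
  qed
  have F_sum: "(\<Sum>j\<in>I. F j c x) = D c x" if c: "c \<in> A" and x: "x \<in> target c" for c x
  proof -
    have "((\<lambda>y. \<Sum>j\<in>I. R j c y) has_derivative (\<lambda>v. \<Sum>j\<in>I. dir_deriv (R j c) x v)) (at x)"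
      by (intro has_derivative_sum C1_on_has_derivative [OF R_C1] c x)
    moreover have "((\<lambda>y. \<Sum>j\<in>I. R j c y) has_derivative (\<lambda>v. 0)) (at x)"
      by (rule has_derivative_transform_within_open [OF _ chart_open(2) [OF c] x, of "\<lambda>y. 1"]) (use R_sum [OF c] in auto)
    ultimately have "(\<lambda>v. \<Sum>j\<in>I. dir_deriv (R j c) x v) = (\<lambda>v. 0)"
      by (rule has_derivative_unique)
    then have "(\<Sum>j\<in>I. dir_deriv (R j c) x (W c x)) = 0" by metis
    then show ?thesis
      unfolding F_def sum.distrib sum_distrib_right [symmetric] R_sum [OF c x] by simp
  qed
  define H where "H i j c x = (if x \<in> target c then R i c x * F j c x else 0)" for i j c x
  have int: "continuous_on UNIV (\<lambda>x. if x \<in> target (ch i) then f x else 0)"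
      "integrable lborel (\<lambda>x. if x \<in> target (ch i) then f x else 0)"
    if i: "i \<in> I" and f: "continuous_on (target (ch i)) f" "\<And>x. x \<in> target (ch i) \<Longrightarrow> R i (ch i) x = 0 \<Longrightarrow> f x = 0"
    for i and f :: "real^'n::_ \<Rightarrow> real"
  proof -
    have z: "f x = 0" if "x \<in> target (ch i)" "x \<notin> K i" for x
      using f(2) R_supp i that by blast
    show 1: "continuous_on UNIV (\<lambda>x. if x \<in> target (ch i) then f x else 0)"
      by (rule continuous_on_extend_zero [OF chart_open(2) [OF ch [OF i]] K(1) [OF i] K(2) [OF i] f(1) z])
    show "integrable lborel (\<lambda>x. if x \<in> target (ch i) then f x else 0)"
      by (rule integrable_compact_support [OF 1 K(1) [OF i]]) (use z in auto)
  qed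
  have H_int: "integrable lborel (H i j (ch i))" "integrable lborel (H i j (ch j))" if ij: "i \<in> I" "j \<in> I" for i j
  proof -
    show "integrable lborel (H i j (ch i))"
      unfolding H_def by (intro int continuous_intros C1_on_continuous [OF R_C1] F_cont ij ch) auto
    show "integrable lborel (H i j (ch j))"
      unfolding H_def by (intro int continuous_intros C1_on_continuous [OF R_C1] F_cont ij ch) (auto simp: F_zero ij ch)
  qed
  have H_eq: "(\<integral>x. H i j (ch i) x \<partial>lborel) = (\<integral>x. H i j (ch j) x \<partial>lborel)" if ij: "i \<in> I" "j \<in> I" for i j
  proof -
    let ?O = "overlap (ch i) (ch j)" and ?\<tau> = "transition (ch i) (ch j)"
    let ?f = "\<lambda>y. R i (ch j) y * F j (ch j) y"
    have c: "ch i \<in> A" "ch j \<in> A" using ch ij by auto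
    have 1: "H i j (ch i) x = (if x \<in> ?O then \<bar>det (matrix (dir_deriv ?\<tau> x))\<bar> * ?f (?\<tau> x) else 0)" for x
    proof (cases "x \<in> ?O")
      case True
      then show ?thesis
        using overlap_subset [of "ch i" "ch j"] R_tr [OF c True, of i] F_tr [OF ij(2) c True] by (auto simp: H_def)
    next
      case False
      have "F j (ch i) x = 0" if x: "x \<in> target (ch i)"
      proof (rule F_zero [OF ij(2) c(1) x])
        have "inv_chart (ch i) x \<notin> fst (ch j)" using False x overlap_iff [OF c(1)] by blast
        then show "R j (ch i) x = 0" using \<rho>_supp [OF ij(2)] by (auto simp: R_def)
      qed
      then show ?thesis using False by (simp add: H_def)
    qed
    have 2: "H i j (ch j) y = (if y \<in> ?\<tau> ` ?O then ?f y else 0)" for y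
    proof (cases "y \<in> ?\<tau> ` ?O")
      case True
      then show ?thesis
        using overlap_subset [of "ch j" "ch i"] transition_image [OF c] by (auto simp: H_def)
    next
      case False
      have "R i (ch j) y = 0" if y: "y \<in> target (ch j)"
      proof -
        have "inv_chart (ch j) y \<notin> fst (ch i)"
          using False y overlap_iff [OF c(2)] unfolding transition_image [OF c] by blast
        then show ?thesis using \<rho>_supp [OF ij(1)] by (auto simp: R_def)
      qed
      then show ?thesis using False by (simp add: H_def)
    qed
    show ?thesis
      unfolding 1 2
    proof (rule lborel_change_of_variables [OF overlap_open [OF c] _ transition_inj [OF c]])
      show "(?\<tau> has_derivative dir_deriv ?\<tau> x) (at x)" if "x \<in> ?O" for x
        by (rule C1_on_has_derivative [OF transition_C1 [OF c] that])
    qed (use H_int [OF ij] in \<open>simp_all only: 1 [symmetric] 2 [symmetric]\<close>)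
  qed
  have F_int: "(\<integral>x. (if x \<in> target (ch j) then F j (ch j) x else 0) \<partial>lborel) = 0" if j: "j \<in> I" for j
  proof -
    let ?c = "ch j"
    have c: "?c \<in> A" by (rule ch [OF j])
    define V where "V a x = (if x \<in> target ?c then R j ?c x * W ?c x $ a else 0)" for a x
    have V_C1: "C1_on UNIV (V a)" for a
      unfolding V_def [abs_def]
      by (intro C1_on_extend_zero [OF chart_open(2) [OF c] K(1) [OF j] K(2) [OF j]] C1_on_mult R_C1 W j c)
        (simp add: R_supp [OF j])
    have V_zero: "V a x = 0" if "x \<notin> K j" for a x
      using R_supp [OF j _ that] by (simp add: V_def)
    have "(if x \<in> target ?c then F j ?c x else 0) = (\<Sum>a\<in>UNIV. dir_deriv (V a) x (axis a 1))" for x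
    proof (cases "x \<in> target ?c")
      case True
      have "dir_deriv (V a) x (axis a 1) = R j ?c x * dir_deriv (\<lambda>x. W ?c x $ a) x (axis a 1)
          + dir_deriv (R j ?c) x (axis a 1) * W ?c x $ a" for a
      proof (rule dir_deriv_eq)
        have "((\<lambda>x. R j ?c x * W ?c x $ a) has_derivative (\<lambda>h. R j ?c x * dir_deriv (\<lambda>x. W ?c x $ a) x h
          + dir_deriv (R j ?c) x h * W ?c x $ a)) (at x)"
          by (intro has_derivative_mult C1_on_has_derivative [OF R_C1] C1_on_has_derivative [OF W] j c True)
        then show "(V a has_derivative (\<lambda>h. R j ?c x * dir_deriv (\<lambda>x. W ?c x $ a) x h
          + dir_deriv (R j ?c) x h * W ?c x $ a)) (at x)"
          by (rule has_derivative_transform_within_open [OF _ chart_open(2) [OF c] True]) (simp add: V_def)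
      qed
      then show ?thesis
        using True W_exp [OF j c True]
        by (simp add: F_def D [OF c True] sum.distrib sum_distrib_left ac_simps)
    next
      case False
      then have x: "x \<in> - K j" using K(2) [OF j] by blast
      have "(V a has_derivative (\<lambda>h. 0)) (at x)" for a
        by (rule has_derivative_transform_within_open [OF _ _ x, of "\<lambda>y. 0"])
          (use compact_imp_closed [OF K(1) [OF j]] V_zero in auto)
      then have "dir_deriv (V a) x (axis a 1) = 0" for a
        by (rule dir_deriv_eq)
      then show ?thesis using False by simp
    qed
    then have "(\<integral>x. (if x \<in> target ?c then F j ?c x else 0) \<partial>lborel) =
        (\<integral>x. (\<Sum>a\<in>UNIV. dir_deriv (V a) x (axis a 1)) \<partial>lborel)" by simp
    also have "\<dots> = (\<Sum>a\<in>UNIV. \<integral>x. dir_deriv (V a) x (axis a 1) \<partial>lborel)"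
    proof (rule Bochner_Integration.integral_sum)
      fix a
      show "integrable lborel (\<lambda>x. dir_deriv (V a) x (axis a 1))"
      proof (rule integrable_compact_support [OF C1_on_deriv_continuous [OF V_C1] K(1) [OF j]])
        fix x assume "x \<notin> K j"
        then have x: "x \<in> - K j" by simp
        have "(V a has_derivative (\<lambda>h. 0)) (at x)"
          by (rule has_derivative_transform_within_open [OF _ _ x, of "\<lambda>y. 0"])
            (use compact_imp_closed [OF K(1) [OF j]] V_zero in auto)
        then show "dir_deriv (V a) x (axis a 1) = 0" by (rule dir_deriv_eq)
      qed
    qed
    also have "\<dots> = 0"
      by (intro sum.neutral ballI integral_dir_deriv_zero [OF V_C1 K(1) [OF j]] V_zero)
    finally show ?thesis .
  qed
  define N where "N i x = (if x \<in> target (ch i) then R i (ch i) x * D (ch i) x else 0)" for i x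
  have N: "continuous_on UNIV (N i)" "integrable lborel (N i)" if i: "i \<in> I" for i
    unfolding N_def by (intro int continuous_intros C1_on_continuous [OF R_C1] D_cont i ch; simp)+
  have N_nonneg: "N i x \<ge> 0" if "i \<in> I" for i x
    unfolding N_def R_def using D_nonneg [OF ch [OF that]] \<rho> [OF that] by simp
  have "(\<Sum>i\<in>I. \<integral>x. N i x \<partial>lborel) = (\<Sum>i\<in>I. \<Sum>j\<in>I. \<integral>x. H i j (ch i) x \<partial>lborel)"
  proof (rule sum.cong [OF refl])
    fix i assume i: "i \<in> I"
    have "N i x = (\<Sum>j\<in>I. H i j (ch i) x)" for x
      unfolding N_def H_def using F_sum [OF ch [OF i]] by (simp add: sum_distrib_left [symmetric])
    then show "(\<integral>x. N i x \<partial>lborel) = (\<Sum>j\<in>I. \<integral>x. H i j (ch i) x \<partial>lborel)"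
      using H_int(1) i by (simp add: Bochner_Integration.integral_sum)
  qed
  also have "\<dots> = (\<Sum>i\<in>I. \<Sum>j\<in>I. \<integral>x. H i j (ch j) x \<partial>lborel)"
    by (intro sum.cong refl H_eq)
  also have "\<dots> = (\<Sum>j\<in>I. \<Sum>i\<in>I. \<integral>x. H i j (ch j) x \<partial>lborel)"
    by (rule sum.swap)
  also have "\<dots> = (\<Sum>j\<in>I. 0)"
  proof (rule sum.cong [OF refl])
    fix j assume j: "j \<in> I"
    have "(\<Sum>i\<in>I. H i j (ch j) x) = (if x \<in> target (ch j) then F j (ch j) x else 0)" for x
      unfolding H_def using R_sum [OF ch [OF j]] by (simp add: sum_distrib_right [symmetric])
    then show "(\<Sum>i\<in>I. \<integral>x. H i j (ch j) x \<partial>lborel) = 0"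
      using F_int [OF j] H_int(2) j by (simp add: Bochner_Integration.integral_sum [symmetric])
  qed
  finally have "(\<Sum>i\<in>I. \<integral>x. N i x \<partial>lborel) = 0" by simp
  moreover have "(\<integral>x. N i x \<partial>lborel) \<ge> 0" if "i \<in> I" for i
    using N_nonneg [OF that] by simp
  ultimately have N0: "(\<integral>x. N i x \<partial>lborel) = 0" if "i \<in> I" for i
    using that I by (simp add: sum_nonneg_eq_0_iff)
  have "\<exists>i\<in>I. \<rho> i (inv_chart c x) \<noteq> 0"
    using \<rho>_sum [OF top [OF c x]] by (metis sum.neutral zero_neq_one)
  then obtain i where i: "i \<in> I" "\<rho> i (inv_chart c x) \<noteq> 0" by blast
  then have o: "x \<in> overlap c (ch i)"
    using \<rho>_supp x overlap_iff [OF c] by blast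
  let ?y = "transition c (ch i) x"
  have "N i ?y = 0"
    using nonneg_integral_zero_imp_zero [OF N(1) [OF i(1)] N_nonneg [OF i(1)] N(2) [OF i(1)] N0 [OF i(1)]] .
  moreover have "?y \<in> target (ch i)"
    using transition_overlap [OF c ch [OF i(1)] o] overlap_subset by blast
  moreover have "R i (ch i) ?y \<noteq> 0"
    using i(2) inv_chart_transition [OF ch [OF i(1)] c o] by (simp add: R_def)
  ultimately have "D (ch i) ?y = 0" by (simp add: N_def)
  then show ?thesis using D_tr [OF c ch [OF i(1)] o] by simp
qed

section \<open>Scalar curvature in an adapted frame\<close>

lemma C1_on_component:
  fixes f :: "'v::real_normed_vector \<Rightarrow> real^'n"
  assumes "C1_on U f"
  shows "C1_on U (\<lambda>x. f x $ i)"
proof (rule C1_onI)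
  show "((\<lambda>x. f x $ i) has_derivative (\<lambda>v. dir_deriv f x v $ i)) (at x)" if "x \<in> U" for x
    by (rule bounded_linear.has_derivative [OF bounded_linear_vec_nth C1_on_has_derivative [OF assms that]])
  show "continuous_on U (\<lambda>x. dir_deriv f x v $ i)" for v
    by (intro continuous_intros C1_on_deriv_continuous assms)
qed

lemma curv_trilinear:
  assumes S: "open S" "x \<in> S" and H: "\<And>y. y \<in> S \<Longrightarrow> bilinear (H y)"
    and d: "\<And>u v. (\<lambda>y. H y u v) differentiable (at x)"
  shows "linear (\<lambda>u. curv H x u v w)" "linear (\<lambda>v. curv H x u v w)" "linear (\<lambda>w. curv H x u v w)"
proof -
  have l: "linear (\<lambda>u. H y u v)" "linear (\<lambda>v. H y u v)" if "y \<in> S" for y u v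
    using H [OF that] by (auto simp: bilinear_def)
  have D: "linear (\<lambda>v. dir_deriv (\<lambda>y. H y v w) x h)" "linear (\<lambda>w. dir_deriv (\<lambda>y. H y v w) x h)"
    "linear (\<lambda>h. dir_deriv (\<lambda>y. H y v w) x h)" for v w h
    by (auto intro!: linear_dir_deriv_family [OF S] linear_dir_deriv l d)
  note l = l [OF S(2)]
  show "linear (\<lambda>u. curv H x u v w)" "linear (\<lambda>v. curv H x u v w)" "linear (\<lambda>w. curv H x u v w)"
    unfolding curv_def
    by (intro linear_compose_add linear_compose_sub D l linear_comp [OF l(2) l(1)] linear_comp [OF l(2) l(2)])+
qed

lemma matrix_inv_unique:
  fixes A B :: "real^'n^'n"
  assumes "A ** B = mat 1" "B ** A = mat 1"
  shows "matrix_inv A = B"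
proof -
  have "A ** matrix_inv A = mat 1 \<and> matrix_inv A ** A = mat 1"
    unfolding matrix_inv_def by (rule someI [of _ B]) (use assms in simp)
  then show ?thesis using assms(1) by (metis matrix_mul_assoc matrix_mul_lid matrix_mul_rid)
qed

lemma curvature_eq_curv:
  assumes "\<And>w. \<Gamma> x 0 w = 0"
  shows "curvature \<Gamma> x u v w = curv \<Gamma> x u v w"
proof -
  have c: "dir_deriv (\<lambda>_. b) x h = 0" for b :: "real^7" and x h :: "real^7"
    by (rule dir_deriv_eq) simp
  show ?thesis
    by (simp add: curvature_def nabla_def [abs_def] lie_bracket_def curv_def c assms algebra_simps)
qed

context skew_torsion
begin

lemma sym_part_bilinear: "x \<in> S \<Longrightarrow> bilinear (sym_part G x)"
  unfolding bilinear_def sym_part_def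
  by (intro conjI allI linear_compose_scale_right linear_compose_add G_linear)

lemma sym_part_diff: "x \<in> S \<Longrightarrow> (\<lambda>y. sym_part G y u v) differentiable (at x)"
  unfolding sym_part_def
  by (intro differentiable_scaleR differentiable_const differentiable_add G_diff)

lemma levi_civita_eq:
  assumes x: "x \<in> S" and Gm: "\<And>y u v. metric_tensor Gm y [u, v] = g y u v"
  shows "levi_civita Gm x u v = sym_part G x u v"
proof -
  obtain e :: "real^7^7" where e: "invertible e" "\<forall>u v. g x u v = (e *v u) \<bullet> (e *v v)"
    using coframe [OF x] by blast
  have Gx: "Gm x = transpose e ** e"
    by (rule matrix_eq_inner) (use Gm [of x] e(2) in \<open>simp add: metric_tensor_def matrix_inner_gram\<close>)
  then have inv: "invertible (Gm x)"
    using e(1) by (simp add: invertible_mult transpose_invertible)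
  have "dir_deriv (\<lambda>y. g y v (axis l 1)) x u + dir_deriv (\<lambda>y. g y u (axis l 1)) x v - dir_deriv (\<lambda>y. g y u v) x (axis l 1)
      = 2 * (Gm x *v sym_part G x u v) $ l" for l
  proof -
    let ?l = "axis l 1 :: real^7"
    have "dir_deriv (\<lambda>y. g y v ?l) x u + dir_deriv (\<lambda>y. g y u ?l) x v - dir_deriv (\<lambda>y. g y u v) x ?l =
        g x (G x u v) ?l + g x (G x v u) ?l + T x u ?l v + T x v ?l u"
      unfolding nabla_g [OF x] tors_def
      by (simp add: g_simps x g_sym [OF x, of v] g_sym [OF x, of u])
    also have "T x u ?l v + T x v ?l u = 0"
      using T_skew(2) [OF x, where u = v and w = ?l and v = u] T_skew(1) [OF x, where v = v and u = u and w = ?l]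
        T_skew(2) [OF x, where u = u and w = v and v = ?l] by linarith
    then have "g x (G x u v) ?l + g x (G x v u) ?l + T x u ?l v + T x v ?l u = 2 * g x (sym_part G x u v) ?l"
      by (simp add: sym_part_def g_simps x)
    also have "g x (sym_part G x u v) ?l = g x ?l (sym_part G x u v)" by (rule g_sym [OF x])
    also have "\<dots> = (Gm x *v sym_part G x u v) $ l"
      unfolding Gm [symmetric] by (simp add: metric_tensor_def inner_axis')
    finally show ?thesis .
  qed
  then have "levi_civita Gm x u v = (1/2) *\<^sub>R (matrix_inv (Gm x) *v (2 *\<^sub>R (Gm x *v sym_part G x u v)))"
    unfolding levi_civita_def Gm
    by (intro arg_cong [where f = "\<lambda>z. (1/2) *\<^sub>R (matrix_inv (Gm x) *v z)"]) (simp add: vec_eq_iff)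
  also have "\<dots> = (matrix_inv (Gm x) ** Gm x) *v sym_part G x u v"
    by (simp add: matrix_vector_mult_scaleR matrix_vector_mul_assoc)
  also have "\<dots> = sym_part G x u v"
    using inv matrix_inv_unique by (metis invertible_def matrix_vector_mul_lid)
  finally show ?thesis .
qed

lemma riemannian_scalar_frame:
  assumes x: "x \<in> S" and Gm: "\<And>y u v. metric_tensor Gm y [u, v] = g y u v" and E: "frame_at x E"
  shows "riemannian_scalar Gm x = (\<Sum>a\<in>UNIV. \<Sum>b\<in>UNIV. g x (curv (sym_part G) x (E a) (E b) (E b)) (E a))"
proof -
  let ?C = "curv (sym_part G) x"
  have lin: "linear (\<lambda>u. ?C u v w)" "linear (\<lambda>v. ?C u v w)" "linear (\<lambda>w. ?C u v w)" for u v w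
    by (rule curv_trilinear [OF open_S x]; intro sym_part_bilinear sym_part_diff x; assumption)+
  obtain e :: "real^7^7" where e: "invertible e" "\<forall>u v. g x u v = (e *v u) \<bullet> (e *v v)" "\<forall>a. e *v E a = axis a 1"
    using E unfolding frame_at_def by blast
  have Gx: "Gm x = transpose e ** e"
    by (rule matrix_eq_inner) (use Gm [of x] e(2) in \<open>simp add: metric_tensor_def matrix_inner_gram\<close>)
  obtain e' where e': "e' ** e = mat 1" "e ** e' = mat 1"
    using e(1) by (auto simp: invertible_def)
  have E': "E a = e' *v axis a 1" for a
    using e(3) e'(1) by (metis matrix_vector_mul_assoc matrix_vector_mul_lid)
  have "matrix_inv (Gm x) = e' ** transpose e'"
  proof (rule matrix_inv_unique)
    have t: "transpose e' ** transpose e = mat 1" "transpose e ** transpose e' = mat 1"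
      using e' by (metis matrix_transpose_mul transpose_mat)+
    show "Gm x ** (e' ** transpose e') = mat 1"
      unfolding Gx using e' t by (metis matrix_mul_assoc matrix_mul_lid)
    show "e' ** transpose e' ** Gm x = mat 1"
      unfolding Gx using e' t by (metis matrix_mul_assoc matrix_mul_lid)
  qed
  then have Ginv: "matrix_inv (Gm x) $ j $ k = (\<Sum>b\<in>UNIV. E b $ j * E b $ k)" for j k
    by (simp add: matrix_matrix_mult_def transpose_def E' matrix_vector_mul_component inner_axis)
  have cong: "frechet_derivative (\<lambda>y. levi_civita Gm y u v) (at x) = frechet_derivative (\<lambda>y. sym_part G y u v) (at x)" for u v
    by (rule dir_deriv_cong(1) [OF open_S x]) (rule levi_civita_eq [OF _ Gm])
  have "levi_civita Gm x 0 w = 0" for w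
    unfolding levi_civita_eq [OF x Gm] using sym_part_bilinear [OF x] by (simp add: bilinear_lzero)
  then have curv: "curvature (levi_civita Gm) x u v w = ?C u v w" for u v w
    by (simp add: curvature_eq_curv curv_def cong levi_civita_eq [OF x Gm])
  have ric: "ricci (levi_civita Gm) x v w = (\<Sum>a\<in>UNIV. g x (?C (E a) v w) (E a))" for v w
    unfolding ricci_def curv by (rule frame_trace [OF x E lin(1)])
  have ric_lin: "linear (\<lambda>v. ricci (levi_civita Gm) x v w)" "linear (\<lambda>w. ricci (levi_civita Gm) x v w)" for v w
    unfolding ric
    by (rule linear_compose_sum, rule ballI, rule linear_comp [OF g_linear(1) [OF x] lin(2)])
      (rule linear_compose_sum, rule ballI, rule linear_comp [OF g_linear(1) [OF x] lin(3)])
  have "riemannian_scalar Gm x = (\<Sum>j\<in>UNIV. \<Sum>k\<in>UNIV. \<Sum>b\<in>UNIV. E b $ j * (E b $ k * ricci (levi_civita Gm) x (axis j 1) (axis k 1)))"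
    unfolding riemannian_scalar_def Ginv sum_distrib_right mult.assoc ..
  also have "\<dots> = (\<Sum>b\<in>UNIV. \<Sum>j\<in>UNIV. \<Sum>k\<in>UNIV. E b $ j * (E b $ k * ricci (levi_civita Gm) x (axis j 1) (axis k 1)))"
    by (rule sum_rotate)
  also have "\<dots> = (\<Sum>b\<in>UNIV. ricci (levi_civita Gm) x (E b) (E b))"
    unfolding sum_distrib_left [symmetric] linear_axis_expansion [OF ric_lin(2), symmetric]
      linear_axis_expansion [OF ric_lin(1), symmetric] ..
  also have "\<dots> = (\<Sum>a\<in>UNIV. \<Sum>b\<in>UNIV. g x (?C (E a) (E b) (E b)) (E a))"
    unfolding ric by (rule sum.swap)
  finally show ?thesis .
qed

lemma g_C1:
  assumes G: "\<And>u v. continuous_on S (\<lambda>y. G y u v)"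
  shows "C1_on S (\<lambda>y. g y v w)"
proof (rule C1_onI)
  show "((\<lambda>y. g y v w) has_derivative (\<lambda>u. dir_deriv (\<lambda>y. g y v w) x u)) (at x)" if "x \<in> S" for x
    by (rule has_derivative_dir [OF g_diff [OF that]])
  have gc: "continuous_on S (\<lambda>y. g y v w)" for v w
    using g_diff by (meson continuous_at_imp_continuous_on differentiable_imp_continuous_within)
  have "continuous_on S (\<lambda>y. (\<Sum>i\<in>UNIV. G y u v $ i * g y (axis i 1) w) + (\<Sum>i\<in>UNIV. G y u w $ i * g y (axis i 1) v))" for u
    by (intro continuous_intros G gc)
  moreover have "dir_deriv (\<lambda>y. g y v w) x u = (\<Sum>i\<in>UNIV. G x u v $ i * g x (axis i 1) w) + (\<Sum>i\<in>UNIV. G x u w $ i * g x (axis i 1) v)"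
    if "x \<in> S" for x u
    unfolding nabla_g [OF that] g_sym [OF that, of v] linear_axis_expansion [OF g_linear(1) [OF that], of "G x u v" w]
      linear_axis_expansion [OF g_linear(1) [OF that], of "G x u w" v] ..
  ultimately show "continuous_on S (\<lambda>x. dir_deriv (\<lambda>y. g y v w) x u)" for u
    by (simp cong: continuous_on_cong)
qed

lemma P_C1:
  assumes G: "\<And>u v. continuous_on S (\<lambda>y. G y u v)"
  shows "C1_on S (\<lambda>y. P y a b c)"
proof (rule C1_onI)
  show "((\<lambda>y. P y a b c) has_derivative (\<lambda>u. dir_deriv (\<lambda>y. P y a b c) x u)) (at x)" if "x \<in> S" for x
    by (rule has_derivative_dir [OF P_diff [OF that]])
  have Pc: "continuous_on S (\<lambda>y. P y a b c)" for a b c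
    using P_diff by (meson continuous_at_imp_continuous_on differentiable_imp_continuous_within)
  have "continuous_on S (\<lambda>y. (\<Sum>i\<in>UNIV. G y u a $ i * P y (axis i 1) b c) + (\<Sum>i\<in>UNIV. G y u b $ i * P y a (axis i 1) c)
      + (\<Sum>i\<in>UNIV. G y u c $ i * P y a b (axis i 1)))" for u
    by (intro continuous_intros G Pc)
  moreover have "dir_deriv (\<lambda>y. P y a b c) x u = (\<Sum>i\<in>UNIV. G x u a $ i * P x (axis i 1) b c) + (\<Sum>i\<in>UNIV. G x u b $ i * P x a (axis i 1) c)
      + (\<Sum>i\<in>UNIV. G x u c $ i * P x a b (axis i 1))"
    if "x \<in> S" for x u
    unfolding nabla_P [OF that] linear_axis_expansion [OF trilinear_linear(1) [OF P_trilinear [OF that]], of "G x u a" b c]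
      linear_axis_expansion [OF trilinear_linear(2) [OF P_trilinear [OF that]], of a "G x u b" c]
      linear_axis_expansion [OF trilinear_linear(3) [OF P_trilinear [OF that]], of a b "G x u c"] ..
  ultimately show "continuous_on S (\<lambda>x. dir_deriv (\<lambda>y. P y a b c) x u)" for u
    by (simp cong: continuous_on_cong)
qed

lemma T_C1:
  assumes G: "\<And>u v. C1_on S (\<lambda>y. G y u v)"
  shows "C1_on S (\<lambda>y. T y u v w)"
proof (rule C1_on_cong [OF open_S])
  show "C1_on S (\<lambda>y. \<Sum>i\<in>UNIV. (G y u v $ i - G y v u $ i) * g y (axis i 1) w)"
    by (intro C1_on_sum C1_on_mult C1_on_diff C1_on_component G g_C1 C1_on_continuous [OF G])
  show "(\<Sum>i\<in>UNIV. (G y u v $ i - G y v u $ i) * g y (axis i 1) w) = T y u v w" if "y \<in> S" for y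
    unfolding tors_def linear_axis_expansion [OF g_linear(1) [OF that], of "G y u v - G y v u" w] by simp
qed

lemma flux_C1:
  assumes G: "\<And>u v. C1_on S (\<lambda>y. G y u v)"
  shows "C1_on S (\<lambda>y. flux y $ a)"
  unfolding flux_def vec_lambda_beta altsum_def
  by (intro C1_on_sum C1_on_mult C1_on_const T_C1 P_C1 G C1_on_continuous [OF G])

lemma tors_zero_imp_symmetric:
  assumes x: "x \<in> S" and E: "frame_at x E" and T0: "\<And>a b c. T x (E a) (E b) (E c) = 0"
  shows "G x u v = G x v u"
proof -
  have "T x (E a) (E b) w = 0" for a b w
    unfolding frame_linear [OF E T_linear(3) [OF x], of _ _ w] T0 by simp
  then have "T x (E a) v w = 0" for a w
    unfolding frame_linear [OF E T_linear(2) [OF x], of _ v] by simp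
  then have "T x u v w = 0" for w
    unfolding frame_linear [OF E T_linear(1) [OF x], of u] by simp
  then have "G x u v - G x v u = 0"
    using frame_expansion [OF E, of "G x u v - G x v u"] by (simp add: tors_def)
  then show ?thesis by simp
qed

end

section \<open>Compact $G_2$ manifolds with closed torsion\<close>

lemma smooth_dir_deriv_commute:
  fixes f :: "real^'n \<Rightarrow> real^'m"
  assumes U: "open U" "x \<in> U" and f: "smooth_on U f"
  shows "dir_deriv (\<lambda>y. dir_deriv f y v) x u = dir_deriv (\<lambda>y. dir_deriv f y u) x v"
proof -
  have C1: "C1_on U f" "C1_on U (\<lambda>y. dir_deriv f y v)" for v
    using f by (auto intro: smooth_on_C1 smooth_on_dir_deriv)
  have comp: "dir_deriv (\<lambda>y. h y $ k) y v = dir_deriv h y v $ k" if "C1_on U h" "y \<in> U" for h :: "real^'n \<Rightarrow> real^'m" and y v k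
    by (rule dir_deriv_eq, rule bounded_linear.has_derivative [OF bounded_linear_vec_nth C1_on_has_derivative [OF that]])
  have "dir_deriv (\<lambda>y. dir_deriv f y v) x u $ k = dir_deriv (\<lambda>y. dir_deriv f y u) x v $ k" for k
  proof -
    have 1: "dir_deriv (\<lambda>y. dir_deriv (\<lambda>y. f y $ k) y v) x u = dir_deriv (\<lambda>y. dir_deriv f y v) x u $ k" for u v
      unfolding comp [OF C1(2) U(2), symmetric]
      by (simp only: dir_deriv_cong(1) [OF U comp [OF C1(1)]])
    have 2: "(\<lambda>y. dir_deriv (\<lambda>y. f y $ k) y v) differentiable (at x)" for v
      by (subst dir_deriv_cong(2) [OF U comp [OF C1(1)]], assumption)
        (rule C1_on_differentiable [OF C1_on_component [OF C1(2)] U(2)])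
    show ?thesis
      unfolding 1 [symmetric]
      by (rule dir_deriv_commute [OF U]) (auto intro: C1_on_differentiable [OF C1_on_component [OF C1(1)]] 2)
  qed
  then show ?thesis by (simp add: vec_eq_iff)
qed

lemma nabla_const: "nabla \<Gamma> (\<lambda>_. u) (\<lambda>_. v) x = \<Gamma> x u v"
proof -
  have "dir_deriv (\<lambda>_. v) x u = 0" by (rule dir_deriv_eq) simp
  then show ?thesis by (simp add: nabla_def)
qed

lemma torsion_eq_tors:
  "torsion Gm \<Gamma> x [u, v, w] = tors (\<lambda>x u v. metric_tensor Gm x [u, v]) \<Gamma> x u v w"
proof -
  have "lie_bracket (\<lambda>_. u) (\<lambda>_. v) x = 0"
    using dir_deriv_eq [of "\<lambda>_. v" "\<lambda>_. 0" x] dir_deriv_eq [of "\<lambda>_. u" "\<lambda>_. 0" x] by (simp add: lie_bracket_def)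
  then show ?thesis
    by (simp add: torsion_def nabla_const tors_def)
qed

locale closed_torsion_G2 = compact_manifold M A
  for M :: "'a topology" and A :: "('a, 7) chart set" +
  fixes \<phi> :: "('a, 7) chart \<Rightarrow> real^7 \<Rightarrow> 7 tensor" and \<Gamma> :: "('a, 7) chart \<Rightarrow> 7 christoffel"
  assumes G2: "G2_structure A \<phi>"
    and char_conn: "characteristic_connection A \<phi> \<Gamma>"
    and closed: "closed_torsion A \<phi> \<Gamma>"
    and scal: "\<And>c x. c \<in> A \<Longrightarrow> x \<in> target c \<Longrightarrow> riemannian_scalar (G2_metric (\<phi> c)) x = 0"
begin

abbreviation met :: "('a, 7) chart \<Rightarrow> real^7 \<Rightarrow> real^7 \<Rightarrow> real^7 \<Rightarrow> real" where
  "met c \<equiv> \<lambda>x u v. metric_tensor (G2_metric (\<phi> c)) x [u, v]"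

abbreviation form :: "('a, 7) chart \<Rightarrow> real^7 \<Rightarrow> real^7 \<Rightarrow> real^7 \<Rightarrow> real^7 \<Rightarrow> real" where
  "form c \<equiv> \<lambda>x u v w. \<phi> c x [u, v, w]"

abbreviation tor :: "('a, 7) chart \<Rightarrow> real^7 \<Rightarrow> real^7 \<Rightarrow> real^7 \<Rightarrow> real^7 \<Rightarrow> real" where
  "tor c \<equiv> tors (met c) (\<Gamma> c)"

lemma met_eq: "adapted_coframe (\<phi> c x) e \<Longrightarrow> met c x u v = (e *v u) \<bullet> (e *v v)"
  by (rule metric_tensor_eq)

lemma coframe_near:
  assumes "c \<in> A" "x \<in> target c"
  obtains U e where "open U" "x \<in> U" "U \<subseteq> target c" "C1_on U e" "\<And>y. y \<in> U \<Longrightarrow> adapted_coframe (\<phi> c y) (e y)"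
  using G2 assms unfolding G2_structure_def by (metis smooth_on_C1)

lemma some_adapted: "c \<in> A \<Longrightarrow> x \<in> target c \<Longrightarrow> adapted_coframe (\<phi> c x) (some_coframe (\<phi> c x))"
  by (metis coframe_near some_coframe_adapted)

lemma \<Gamma>_C1: "c \<in> A \<Longrightarrow> C1_on (target c) (\<lambda>x. \<Gamma> c x u v)"
  using char_conn unfolding characteristic_connection_def connection_def by (auto intro: smooth_on_C1)

lemma skew:
  assumes c: "c \<in> A"
  shows "skew_torsion (target c) (met c) (form c) (\<Gamma> c)"
proof
  show "open (target c)" by (rule chart_open(2) [OF c])
next
  fix x assume x: "x \<in> target c"
  have cc: "connection A \<Gamma>"
    "\<And>u vs. length vs = 2 \<Longrightarrow> nabla_tensor (\<Gamma> c) (metric_tensor (G2_metric (\<phi> c))) x u vs = 0"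
    "\<And>u vs. length vs = 3 \<Longrightarrow> nabla_tensor (\<Gamma> c) (\<phi> c) x u vs = 0"
    "alternating_form 3 (torsion (G2_metric (\<phi> c)) (\<Gamma> c) x)"
    using char_conn c x unfolding characteristic_connection_def by auto
  obtain U e where U: "open U" "x \<in> U" "U \<subseteq> target c" and e: "C1_on U e" "\<And>y. y \<in> U \<Longrightarrow> adapted_coframe (\<phi> c y) (e y)"
    by (rule coframe_near [OF c x]) (rule that)
  show "\<exists>e. invertible e \<and> (\<forall>u v. met c x u v = (e *v u) \<bullet> (e *v v)) \<and>
      (\<forall>u v w. form c x u v w = Phi0 (e *v u) (e *v v) (e *v w))"
    using e(2) [OF U(2)] by (intro exI [of _ "e x"])
      (simp add: adapted_coframe_def met_eq [OF e(2) [OF U(2)]] adapted_coframe_Phi0 [OF e(2) [OF U(2)]])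
  have ev: "(\<lambda>y. (e y *v u) $ i) differentiable (at x)" for u i
  proof -
    have "((\<lambda>y. (e y *v u) $ i) has_derivative (\<lambda>h. (dir_deriv e x h *v u) $ i)) (at x)"
    proof (rule bounded_linear.has_derivative [OF _ C1_on_has_derivative [OF e(1) U(2)]])
      have "linear (\<lambda>B :: real^7^7. (B *v u) $ i)"
        by (rule linearI) (simp_all add: matrix_vector_mult_add_rdistrib scaleR_matrix_vector_assoc [symmetric])
      then show "bounded_linear (\<lambda>B :: real^7^7. (B *v u) $ i)"
        by (simp add: linear_conv_bounded_linear)
    qed
    then show ?thesis by (auto simp: differentiable_def)
  qed
  show "(\<lambda>y. met c y u v) differentiable (at x)" for u v
  proof -
    have "(\<lambda>y. \<Sum>i\<in>UNIV. (e y *v u) $ i * (e y *v v) $ i) differentiable (at x)"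
      by (intro differentiable_sum finite ballI differentiable_mult ev)
    moreover have "(\<Sum>i\<in>UNIV. (e y *v u) $ i * (e y *v v) $ i) = met c y u v" if "y \<in> U" for y
      by (simp add: met_eq [OF e(2) [OF that]] inner_vec_def)
    ultimately show ?thesis
      by (simp only: dir_deriv_cong(2) [OF U(1,2), of "\<lambda>y. \<Sum>i\<in>UNIV. (e y *v u) $ i * (e y *v v) $ i"])
  qed
  show "(\<lambda>y. form c y u v w) differentiable (at x)" for u v w
  proof -
    have "(\<lambda>y. tri i j k (e y *v u) (e y *v v) (e y *v w)) differentiable (at x)" for i j k
      unfolding tri_def by (intro differentiable_add differentiable_diff differentiable_mult ev)
    then have "(\<lambda>y. Phi0 (e y *v u) (e y *v v) (e y *v w)) differentiable (at x)"
      unfolding Phi0_def by (intro differentiable_add differentiable_diff)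
    moreover have "Phi0 (e y *v u) (e y *v v) (e y *v w) = form c y u v w" if "y \<in> U" for y
      by (simp add: adapted_coframe_Phi0 [OF e(2) [OF that]])
    ultimately show ?thesis
      by (simp only: dir_deriv_cong(2) [OF U(1,2), of "\<lambda>y. Phi0 (e y *v u) (e y *v v) (e y *v w)"])
  qed
  show "bilinear (\<Gamma> c x)"
    using cc(1) c x unfolding connection_def by blast
  show "(\<lambda>y. \<Gamma> c y u v) differentiable (at x)" for u v
    by (rule C1_on_differentiable [OF \<Gamma>_C1 [OF c] x])
  show "dir_deriv (\<lambda>y. met c y v w) x u = met c x (\<Gamma> c x u v) w + met c x v (\<Gamma> c x u w)" for u v w
    using cc(2) [of "[v, w]" u] by (simp add: nabla_tensor_def lessThan_Suc numeral_2_eq_2)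
  show "dir_deriv (\<lambda>y. form c y a b d) x u = form c x (\<Gamma> c x u a) b d + form c x a (\<Gamma> c x u b) d + form c x a b (\<Gamma> c x u d)" for a b d u
    using cc(3) [of "[a, b, d]" u] by (simp add: nabla_tensor_def lessThan_Suc numeral_3_eq_3)
  show "tor c x u v v = 0" for u v
  proof -
    have "torsion (G2_metric (\<phi> c)) (\<Gamma> c) x [u, v, v] = 0"
      using cc(4) unfolding alternating_form_def by (elim conjE allE [of _ "[u, v, v]"] allE [of _ 1] allE [of _ 2]) simp
    then show ?thesis by (simp add: torsion_eq_tors)
  qed
  show "dir_deriv (\<lambda>y. tor c y b p q) x a - dir_deriv (\<lambda>y. tor c y a p q) x b
      + dir_deriv (\<lambda>y. tor c y a b q) x p - dir_deriv (\<lambda>y. tor c y a b p) x q = 0" for a b p q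
  proof -
    have "ext_deriv (torsion (G2_metric (\<phi> c)) (\<Gamma> c)) x [a, b, p, q] = 0"
      using closed c x unfolding closed_torsion_def by auto
    then show ?thesis
      by (simp add: ext_deriv_def lessThan_Suc torsion_eq_tors numeral_eq_Suc)
  qed
qed

abbreviation flux_c :: "('a, 7) chart \<Rightarrow> real^7 \<Rightarrow> real^7" where
  "flux_c c \<equiv> skew_torsion.flux (met c) (form c) (\<Gamma> c)"

definition orient :: "('a, 7) chart \<Rightarrow> real^7 \<Rightarrow> real" where
  "orient c x = sgn (det (some_coframe (\<phi> c x)))"

lemma orient_eq:
  assumes "adapted_coframe (\<phi> c x) e"
  shows "orient c x = sgn (det e)"
  unfolding orient_def
  by (simp only: adapted_coframe_unique(1) [OF assms some_coframe_adapted [OF assms]])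

lemma orient_locally_const:
  assumes c: "c \<in> A" and x: "x \<in> target c"
  obtains V where "open V" "x \<in> V" "V \<subseteq> target c" "\<And>y. y \<in> V \<Longrightarrow> orient c y = orient c x"
proof -
  obtain U e where U: "open U" "x \<in> U" "U \<subseteq> target c" and e: "C1_on U e" "\<And>y. y \<in> U \<Longrightarrow> adapted_coframe (\<phi> c y) (e y)"
    by (rule coframe_near [OF c x]) (rule that)
  have ec: "continuous_on U (\<lambda>y. det (e y) * det (e x))"
    unfolding det_def by (intro continuous_intros C1_on_continuous [OF e(1)])
  let ?V = "U \<inter> (\<lambda>y. det (e y) * det (e x)) -` {0<..}"
  have nz: "det (e x) \<noteq> 0"
    using e(2) [OF U(2)] by (simp add: adapted_coframe_def invertible_det_nz)
  show thesis
  proof (rule that [of ?V])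
    show "open ?V" by (rule continuous_open_preimage [OF ec U(1)]) simp
    show "x \<in> ?V" using U(2) nz by (simp add: zero_less_mult_iff) linarith
    show "orient c y = orient c x" if "y \<in> ?V" for y
      using that orient_eq [OF e(2), of y] orient_eq [OF e(2) [OF U(2)]] by (auto simp: zero_less_mult_iff)
  qed (use U in auto)
qed

text \<open>The 6-form \<open>T \<and> \<phi>\<close> as a vector density; the factor \<open>orient\<close> makes it transform with
  \<open>\<bar>det\<bar>\<close> instead of \<open>det\<close>, since the charts need not be oriented.\<close>

definition W :: "('a, 7) chart \<Rightarrow> real^7 \<Rightarrow> real^7" where
  "W c x = - (orient c x *\<^sub>R flux_c c x)"

lemma W_local:
  assumes c: "c \<in> A" and x: "x \<in> target c"
  obtains V where "open V" "x \<in> V" "V \<subseteq> target c" "\<And>y a. y \<in> V \<Longrightarrow> W c y $ a = - orient c x * flux_c c y $ a"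
proof -
  obtain V where V: "open V" "x \<in> V" "V \<subseteq> target c" "\<And>y. y \<in> V \<Longrightarrow> orient c y = orient c x"
    by (rule orient_locally_const [OF c x]) (rule that)
  show thesis
    by (rule that [OF V(1-3)]) (simp add: W_def V(4))
qed

lemma W_C1:
  assumes c: "c \<in> A"
  shows "C1_on (target c) (\<lambda>x. W c x $ a)"
proof (rule C1_on_local)
  fix x assume x: "x \<in> target c"
  interpret skew_torsion "target c" "met c" "form c" "\<Gamma> c" by (rule skew [OF c])
  obtain V where V: "open V" "x \<in> V" "V \<subseteq> target c" "\<And>y a. y \<in> V \<Longrightarrow> W c y $ a = - orient c x * flux y $ a"
    by (rule W_local [OF c x]) (rule that)
  have "C1_on V (\<lambda>y. - orient c x * flux y $ a)"
    by (intro C1_on_mult C1_on_const C1_on_subset [OF flux_C1 [OF \<Gamma>_C1 [OF c]] V(3)])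
  then have "C1_on V (\<lambda>y. W c y $ a)"
    by (rule C1_on_cong [OF V(1), rotated]) (simp add: V(4))
  then show "\<exists>U. open U \<and> x \<in> U \<and> C1_on U (\<lambda>x. W c x $ a)"
    using V by blast
qed

definition D :: "('a, 7) chart \<Rightarrow> real^7 \<Rightarrow> real" where
  "D c x = (\<Sum>a\<in>UNIV. dir_deriv (\<lambda>x. W c x $ a) x (axis a 1))"

lemma D_eq:
  assumes c: "c \<in> A" and x: "x \<in> target c" and e: "adapted_coframe (\<phi> c x) e" "\<And>a. e *v E a = axis a 1"
  shows "D c x = 9 * \<bar>det e\<bar> * psi_contract (\<lambda>a b p q. \<Sum>m\<in>UNIV. tor c x (E a) (E b) (E m) * tor c x (E p) (E q) (E m))"
proof -
  interpret skew_torsion "target c" "met c" "form c" "\<Gamma> c" by (rule skew [OF c])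
  obtain V where V: "open V" "x \<in> V" "V \<subseteq> target c" "\<And>y a. y \<in> V \<Longrightarrow> W c y $ a = - orient c x * flux y $ a"
    by (rule W_local [OF c x]) (rule that)
  have "dir_deriv (\<lambda>x. W c x $ a) x h = - orient c x * dir_deriv (\<lambda>y. flux y $ a) x h" for a h
  proof -
    have "dir_deriv (\<lambda>x. W c x $ a) x h = dir_deriv (\<lambda>y. - orient c x * flux y $ a) x h"
      by (simp only: dir_deriv_cong(1) [OF V(1,2,4)])
    also have "\<dots> = - orient c x * dir_deriv (\<lambda>y. flux y $ a) x h"
      by (rule dir_deriv_eq) (intro has_derivative_mult_right C1_on_has_derivative [OF flux_C1 [OF \<Gamma>_C1 [OF c]] x])
    finally show ?thesis .
  qed
  then have "D c x = - orient c x * (\<Sum>a\<in>UNIV. dir_deriv (\<lambda>y. flux y $ a) x (axis a 1))"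
    unfolding D_def by (simp only: sum_distrib_left)
  also have "(\<Sum>a\<in>UNIV. dir_deriv (\<lambda>y. flux y $ a) x (axis a 1)) =
      - 9 * det e * psi_contract (\<lambda>a b p q. \<Sum>m\<in>UNIV. tor c x (E a) (E b) (E m) * tor c x (E p) (E q) (E m))"
    using e by (intro flux_divergence x met_eq adapted_coframe_Phi0) (auto simp: adapted_coframe_def)
  finally show ?thesis
    unfolding orient_eq [OF e(1)] by (simp add: abs_sgn mult_ac)
qed

lemma obtain_adapted_frame:
  assumes "adapted_coframe p e"
  obtains E where "\<And>a. e *v E a = axis a 1"
proof -
  obtain e' where "e ** e' = mat 1"
    using assms unfolding adapted_coframe_def invertible_def by blast
  then have "e *v (e' *v axis a 1) = axis a 1" for a
    by (simp add: matrix_vector_mul_assoc)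
  then show thesis by (rule that)
qed

lemma square_torsion:
  assumes c: "c \<in> A" and x: "x \<in> target c" and e: "adapted_coframe (\<phi> c x) e" "\<And>a. e *v E a = axis a 1"
  shows "skew_torsion.frame_at (met c) (form c) x E"
    "psi_contract (\<lambda>a b p q. \<Sum>m\<in>UNIV. tor c x (E a) (E b) (E m) * tor c x (E p) (E q) (E m)) =
      (\<Sum>a\<in>UNIV. \<Sum>b\<in>UNIV. \<Sum>m\<in>UNIV. (tor c x (E a) (E b) (E m))\<^sup>2)"
proof -
  interpret skew_torsion "target c" "met c" "form c" "\<Gamma> c" by (rule skew [OF c])
  show E: "frame_at x E"
    unfolding frame_at_def
    using e by (intro exI [of _ e]) (simp add: adapted_coframe_def met_eq [OF e(1)] adapted_coframe_Phi0 [OF e(1)])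
  show "psi_contract (\<lambda>a b p q. \<Sum>m\<in>UNIV. tor c x (E a) (E b) (E m) * tor c x (E p) (E q) (E m)) =
      (\<Sum>a\<in>UNIV. \<Sum>b\<in>UNIV. \<Sum>m\<in>UNIV. (tor c x (E a) (E b) (E m))\<^sup>2)"
    by (rule torsion_square [OF x E]) (simp add: riemannian_scalar_frame [OF x _ E, symmetric] scal [OF c x])
qed

definition jacobian :: "('a, 7) chart \<Rightarrow> ('a, 7) chart \<Rightarrow> real^7 \<Rightarrow> real^7^7" where
  "jacobian c d x = matrix (dir_deriv (transition c d) x)"

context
  fixes c d :: "('a, 7) chart" and x :: "real^7"
  assumes c: "c \<in> A" and d: "d \<in> A" and x: "x \<in> overlap c d"
begin

abbreviation "\<tau> \<equiv> transition c d"
abbreviation "L \<equiv> jacobian c d x"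

lemma in_targets: "x \<in> target c" "\<tau> x \<in> target d"
  using x overlap_subset transition_overlap [OF c d x] by blast+

lemma L_apply: "dir_deriv \<tau> x v = L *v v"
  unfolding jacobian_def
  by (rule matrix_vector_mul(2) [THEN fun_cong, OF linear_dir_deriv [OF C1_on_differentiable [OF transition_C1 [OF c d] x]], symmetric])

lemma L_invertible: "invertible L"
proof -
  let ?\<sigma> = "transition d c"
  let ?N = "matrix (dir_deriv ?\<sigma> (\<tau> x))"
  have N: "dir_deriv ?\<sigma> (\<tau> x) v = ?N *v v" for v
    by (rule matrix_vector_mul(2) [THEN fun_cong, OF linear_dir_deriv [OF C1_on_differentiable
      [OF transition_C1 [OF d c] transition_overlap [OF c d x]]], symmetric])
  have "((\<lambda>y. ?\<sigma> (\<tau> y)) has_derivative (\<lambda>v. dir_deriv ?\<sigma> (\<tau> x) (dir_deriv \<tau> x v))) (at x)"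
    by (rule has_derivative_compose [OF C1_on_has_derivative [OF transition_C1 [OF c d] x]
      C1_on_has_derivative [OF transition_C1 [OF d c] transition_overlap [OF c d x]]])
  moreover have "((\<lambda>y. ?\<sigma> (\<tau> y)) has_derivative (\<lambda>v. v)) (at x)"
    by (rule has_derivative_transform_within_open [OF has_derivative_ident overlap_open [OF c d] x])
      (simp add: transition_inverse [OF c d])
  ultimately have "(\<lambda>v. dir_deriv ?\<sigma> (\<tau> x) (dir_deriv \<tau> x v)) = (\<lambda>v. v)"
    by (rule has_derivative_unique)
  then have "(?N ** L) *v v = mat 1 *v v" for v
    unfolding matrix_vector_mul_assoc [symmetric] L_apply [symmetric] N [symmetric] by (simp add: fun_eq_iff)
  then have "?N ** L = mat 1" by (simp add: matrix_eq)
  then show ?thesis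
    using matrix_left_right_inverse by (auto simp: invertible_def)
qed

lemma P_transition: "form c x u v w = form d (\<tau> x) (L *v u) (L *v v) (L *v w)"
proof -
  have "length vs = 3 \<Longrightarrow> \<phi> c x vs = \<phi> d (\<tau> x) (map (dir_deriv \<tau> x) vs)" for vs
    using G2 c d x [unfolded overlap_def] unfolding G2_structure_def tensor_field_def by blast
  from this [of "[u, v, w]"] show ?thesis by (simp add: L_apply)
qed

lemma coframe_transition:
  assumes "adapted_coframe (\<phi> d (\<tau> x)) e"
  shows "adapted_coframe (\<phi> c x) (e ** L)"
  by (rule adapted_coframe_comp [OF assms L_invertible P_transition])

lemma g_transition: "met c x u v = met d (\<tau> x) (L *v u) (L *v v)"
proof -
  note e = some_adapted [OF d in_targets(2)]
  show ?thesis
    unfolding met_eq [OF e] met_eq [OF coframe_transition [OF e]]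
    by (simp only: matrix_vector_mul_assoc)
qed

lemma T_transition: "tor c x u v w = tor d (\<tau> x) (L *v u) (L *v v) (L *v w)"
proof -
  have "dir_deriv \<tau> x (\<Gamma> c x u v) = dir_deriv (\<lambda>y. dir_deriv \<tau> y v) x u + \<Gamma> d (\<tau> x) (dir_deriv \<tau> x u) (dir_deriv \<tau> x v)" for u v
    using char_conn c d x [unfolded overlap_def] unfolding characteristic_connection_def connection_def Let_def by blast
  from this [of u v] this [of v u]
  have "L *v (\<Gamma> c x u v - \<Gamma> c x v u) = \<Gamma> d (\<tau> x) (L *v u) (L *v v) - \<Gamma> d (\<tau> x) (L *v v) (L *v u)"
    using smooth_dir_deriv_commute [OF overlap_open [OF c d] x transition_smooth [OF c d], of u v]
    by (simp add: L_apply matrix_vector_mult_diff_distrib)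
  then show ?thesis
    unfolding tors_def g_transition by simp
qed

lemma orient_transition: "orient c x = orient d (\<tau> x) * sgn (det L)"
proof -
  note e = some_adapted [OF d in_targets(2)]
  show ?thesis
    unfolding orient_eq [OF e] orient_eq [OF coframe_transition [OF e]] by (simp add: det_mul sgn_mult)
qed

lemma flux_transition: "L *v flux_c c x = det L *\<^sub>R flux_c d (\<tau> x)"
proof -
  interpret C: skew_torsion "target c" "met c" "form c" "\<Gamma> c" by (rule skew [OF c])
  interpret D: skew_torsion "target d" "met d" "form d" "\<Gamma> d" by (rule skew [OF d])
  note lin = D.T_linear [OF in_targets(2)] trilinear_linear [OF D.P_trilinear [OF in_targets(2)]]
  show ?thesis
    unfolding vec_eq_iff
  proof
    fix a
    have ca: "linear (\<lambda>v :: real^7. v $ a)" by (simp add: linear_iff)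
    let ?K = "\<lambda>u\<^sub>1 u\<^sub>2 u\<^sub>3 u\<^sub>4 u\<^sub>5 u\<^sub>6 u\<^sub>7. u\<^sub>1 $ a * tor d (\<tau> x) u\<^sub>2 u\<^sub>3 u\<^sub>4 * form d (\<tau> x) u\<^sub>5 u\<^sub>6 u\<^sub>7"
    have "multilinear (\<lambda>f :: 7 \<Rightarrow> real^7. ?K (f 1) (f 2) (f 3) (f 4) (f 5) (f 6) (f 7))"
      by (rule multilinear_7I; intro linear_scale_right linear_scale_left lin ca)
    from altsum_linear_image [OF this, of L]
    have "altsum (\<lambda>p. (L *v axis (p 1) 1) $ a * tor c x (axis (p 2) 1) (axis (p 3) 1) (axis (p 4) 1)
        * form c x (axis (p 5) 1) (axis (p 6) 1) (axis (p 7) 1)) = det L * flux_c d (\<tau> x) $ a"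
      unfolding T_transition P_transition D.flux_def by simp
    moreover have "(L *v flux_c c x) $ a = altsum (\<lambda>p. (L *v axis (p 1) 1) $ a * tor c x (axis (p 2) 1) (axis (p 3) 1) (axis (p 4) 1)
        * form c x (axis (p 5) 1) (axis (p 6) 1) (axis (p 7) 1))"
    proof -
      have "(L *v flux_c c x) $ a = (\<Sum>b\<in>UNIV. L $ a $ b * flux_c c x $ b)"
        by (simp add: matrix_vector_mult_def)
      also have "\<dots> = altsum (\<lambda>p. \<Sum>b\<in>UNIV. L $ a $ b * (axis (p 1) 1 $ b * tor c x (axis (p 2) 1) (axis (p 3) 1) (axis (p 4) 1)
        * form c x (axis (p 5) 1) (axis (p 6) 1) (axis (p 7) 1)))"
        unfolding altsum_sum altsum_cmult C.flux_def by simp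
      also have "\<dots> = altsum (\<lambda>p. (L *v axis (p 1) 1) $ a * tor c x (axis (p 2) 1) (axis (p 3) 1) (axis (p 4) 1)
        * form c x (axis (p 5) 1) (axis (p 6) 1) (axis (p 7) 1))"
        by (simp only: matrix_vector_mult_def vec_lambda_beta sum_distrib_right mult.assoc)
      finally show ?thesis .
    qed
    ultimately show "(L *v flux_c c x) $ a = (det L *\<^sub>R flux_c d (\<tau> x)) $ a" by simp
  qed
qed

lemma W_transition: "dir_deriv \<tau> x (W c x) = \<bar>det L\<bar> *\<^sub>R W d (\<tau> x)"
proof -
  have "L *v W c x = - (orient c x *\<^sub>R (L *v flux_c c x))"
    unfolding W_def by (simp only: linear_neg [OF matrix_vector_mul_linear] matrix_vector_mult_scaleR)
  also have "\<dots> = \<bar>det L\<bar> *\<^sub>R W d (\<tau> x)"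
    unfolding flux_transition orient_transition W_def by (simp add: abs_sgn mult_ac)
  finally show ?thesis by (simp only: L_apply)
qed

lemma D_transition: "D c x = \<bar>det L\<bar> * D d (\<tau> x)"
proof -
  note e = some_adapted [OF d in_targets(2)]
  let ?e = "some_coframe (\<phi> d (\<tau> x))"
  obtain E where E: "\<And>a. (?e ** L) *v E a = axis a 1"
    by (rule obtain_adapted_frame [OF coframe_transition [OF e]]) (rule that)
  then have E': "?e *v (L *v E a) = axis a 1" for a
    by (simp add: matrix_vector_mul_assoc)
  show ?thesis
    unfolding D_eq [OF c in_targets(1) coframe_transition [OF e] E] D_eq [OF d in_targets(2) e E'] T_transition
    by (simp add: det_mul abs_mult)
qed

end

lemma D_zero:
  assumes c: "c \<in> A" and x: "x \<in> target c"
  shows "D c x = 0"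
proof (rule nonneg_divergence_zero [OF manifold compact_M W_C1 _ W_transition [unfolded jacobian_def] D_transition [unfolded jacobian_def] _ c x])
  fix c x assume c: "c \<in> A" and x: "x \<in> target c"
  show "D c x = (\<Sum>a\<in>UNIV. dir_deriv (\<lambda>x. W c x $ a) x (axis a 1))" by (rule D_def)
  note e = some_adapted [OF c x]
  obtain E where E: "\<And>a. some_coframe (\<phi> c x) *v E a = axis a 1"
    by (rule obtain_adapted_frame [OF e]) (rule that)
  show "0 \<le> D c x"
    unfolding D_eq [OF c x e E] square_torsion(2) [OF c x e E]
    by (intro mult_nonneg_nonneg sum_nonneg) auto
qed

lemma \<Gamma>_symmetric:
  assumes c: "c \<in> A" and x: "x \<in> target c"
  shows "\<Gamma> c x u v = \<Gamma> c x v u"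
proof -
  interpret skew_torsion "target c" "met c" "form c" "\<Gamma> c" by (rule skew [OF c])
  note e = some_adapted [OF c x]
  obtain E where E: "\<And>a. some_coframe (\<phi> c x) *v E a = axis a 1"
    by (rule obtain_adapted_frame [OF e]) (rule that)
  have "det (some_coframe (\<phi> c x)) \<noteq> 0"
    using e by (simp add: adapted_coframe_def invertible_det_nz)
  then have "(\<Sum>a\<in>UNIV. \<Sum>b\<in>UNIV. \<Sum>m\<in>UNIV. (T x (E a) (E b) (E m))\<^sup>2) = 0"
    using D_zero [OF c x] unfolding D_eq [OF c x e E] square_torsion(2) [OF c x e E] by simp
  then have "T x (E a) (E b) (E m) = 0" for a b m
    by (simp add: sum_nonneg_eq_0_iff sum_nonneg)
  then show ?thesis
    by (rule tors_zero_imp_symmetric [OF x square_torsion(1) [OF c x e E]])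
qed

lemma parallel: "parallel_G2 A \<phi>"
  unfolding parallel_G2_def
proof (intro ballI allI impI)
  fix c x u and vs :: "(real^7) list"
  assume c: "c \<in> A" and x: "x \<in> target c" and vs: "length vs = 3"
  interpret skew_torsion "target c" "met c" "form c" "\<Gamma> c" by (rule skew [OF c])
  have "levi_civita (G2_metric (\<phi> c)) x u v = \<Gamma> c x u v" for v
    unfolding levi_civita_eq [OF x refl] sym_part_def \<Gamma>_symmetric [OF c x, of v u]
    by (simp add: scaleR_2 [symmetric])
  then have "nabla_tensor (levi_civita (G2_metric (\<phi> c))) (\<phi> c) x u vs = nabla_tensor (\<Gamma> c) (\<phi> c) x u vs"
    by (simp add: nabla_tensor_def)
  then show "nabla_tensor (levi_civita (G2_metric (\<phi> c))) (\<phi> c) x u vs = 0"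
    using char_conn c x vs unfolding characteristic_connection_def by auto
qed

end

theorem corollary1p5:
  fixes M :: "'a topology"
    and A :: "('a, 7) chart set"
    and \<phi> :: "('a, 7) chart \<Rightarrow> real^7 \<Rightarrow> 7 tensor"
    and \<Gamma> :: "('a, 7) chart \<Rightarrow> 7 christoffel"
  assumes "smooth_manifold M A"
    and "compact_space M"
    and "integrable_G2 A \<phi>"
    and "characteristic_connection A \<phi> \<Gamma>"
    and "closed_torsion A \<phi> \<Gamma>"
    and "\<forall>c\<in>A. \<forall>x\<in>target c. riemannian_scalar (G2_metric (\<phi> c)) x = 0"
  shows "parallel_G2 A \<phi>"
proof -
  interpret closed_torsion_G2 M A \<phi> \<Gamma>
    using assms by unfold_locales (auto simp: integrable_G2_def)
  show ?thesis by (rule parallel)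
qed

end
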